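(* Let $\kappa,\rho\in\mathcal P_b^r$. The set $\{x_{w,\underline l,\underline a}\mid w\in{}_\kappa S_\rho,\ \underline l\in\{0,1\}^b,\ \underline a\in\mathbb N^b\}$ is a $\mathbb Z\times\mathbb Z^2$-graded $\Bbbk$-basis of $1_\kappa X1_\rho$.
   Context: $\Bbbk$ is a commutative unital ring. $T^{\lambda,r}=\bigoplus_bT_b^{\lambda,(1,\dots,1)}$ is the dg-enhanced KLRW algebra with $r$ red strands all labelled $1$: the $\Bbbk$-algebra of braid-like diagrams (bottom to top; product = stacking, zero on mismatch) with a leftmost vertical blue strand $\lambda$, $r$ non-crossing red strands, and black strands that may cross black/red strands, carry dots, and be nailed to the blue strand when first to its right (nail homological degree $1$, dots/crossings $0$), up to graded braid-like isotopy (far-apart generators of homological degrees $a,c$ commute up to $(-1)^{ac}$), with relations ($x_j$ dot, $\tau_j$ crossing of strands $j,j+1$, $\omega$ nail, top factor left): $\tau_j^2=0$, braid relation and $\tau_jx_j-x_{j+1}\tau_j=1=x_j\tau_j-\tau_jx_{j+1}$ on black strands; dots slide through black/red crossings; black/red double crossing $=$ one dot on the black strand; braid relation for two black and one red unless red is middle, then $\tau_j\tau_{j+1}\tau_j=\tau_{j+1}\tau_j\tau_{j+1}+1$; $\omega x_1=x_1\omega$, $\omega^2=0$, $\tau_1\omega\tau_1\omega=-\omega\tau_1\omega\tau_1$. $(q,\lambda)$-degrees: black/black crossing $(-2,0)$, dot $(2,0)$, black/red crossing $(1,0)$, nail $(0,2)$. $\mathcal P_b^r$, $1_\rho$: compositions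 $(b_0,\dots,b_r)$ of $b$ and the corresponding idempotents ($b_0$ black strands between blue and the first red strand, $b_i$ right of the $i$-th red strand). The double braiding bimodule $X$ is the $(T^{\lambda,r},T^{\lambda,r})$-bimodule generated, for each idempotent in which the first red strand is immediately to the right of the blue strand, by the diagram in which this red strand winds once around the blue strand (the double braiding), all other strands vertical; the generator has homological degree $0$ and $(q,\lambda)$-degree $(0,-1)$; relations: those of $T^{\lambda,r}$, graded braid-like isotopy, and: a nail on a black strand which is immediately to the left (between blue and first red strand) or immediately to the right of the first red strand can be moved from below the double braiding to above it. ${}_\kappa S_\rho$: permutations viewed as diagrams with blue strand on the left, ordered at the bottom by $1_\rho$ and at the top by $1_\kappa$, no red/red crossings in any reduced expression; a reduced expression $\sigma_{i_1}\cdots\sigma_{i_k}$ is left-adjusted if $\sum i_j$ is minimal (every strand pulled as far left as possible). The element $x_{w,\underline l,\underline a}\in1_\kappa X1_\rho$ is obtained by: choosing a left-adjusted reduced expression of $w$ as a diagram; for each $i$ with $l_i=1$, nailing the $i$-th black strand (counted at the top from the left) on the blue strand by pulling it from its leftmost position; adding $a_i$ dots on the $i$-th black strand at the top; and finally attaching the first red strand to the blue strand (inserting the double braiding) by pulling it from its leftmost position. *)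

theory Defs
  imports "HOL-Combinatorics.Permutations"
begin

text \<open>A state lists the colours of the non-blue strands from left to right;
position 0 is the strand immediately to the right of the blue strand.\<close>

datatype color = Black | Red

text \<open>Elementary generators: a dot on the (black) strand at position j,
a crossing of the strands at positions j and j+1, a nail of the strand at
position 0 on the blue strand, and the double braiding of the (red) strand
at position 0 around the blue strand (the generator of the bimodule X).\<close>

datatype gen = Dot nat | Cr nat | Nail | DB

fun valid :: "color list \<Rightarrow> gen \<Rightarrow> bool" where
  "valid s (Dot j) = (j < length s \<and> s ! j = Black)"
| "valid s (Cr j) = (Suc j < length s \<and> \<not> (s ! j = Red \<and> s ! Suc j = Red))"
| "valid s Nail = (s \<noteq> [] \<and> s ! 0 = Black)"
| "valid s DB = (s \<noteq> [] \<and> s ! 0 = Red)"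

fun step :: "color list \<Rightarrow> gen \<Rightarrow> color list" where
  "step s (Cr j) = s[j := s ! Suc j, Suc j := s ! j]"
| "step s _ = s"

text \<open>A diagram is a pair (bottom state, list of generators from bottom to top).
run gives the top state if the word is composable.\<close>

fun run :: "color list \<Rightarrow> gen list \<Rightarrow> color list option" where
  "run s [] = Some s"
| "run s (g # gs) = (if valid s g then run (step s g) gs else None)"

type_synonym path = "color list \<times> gen list"

text \<open>Strands touched by a generator: 0 is the blue strand, Suc j the strand at
position j.\<close>
fun supp :: "gen \<Rightarrow> nat set" where
  "supp (Dot j) = {Suc j}"
| "supp (Cr j) = {Suc j, Suc (Suc j)}"
| "supp Nail = {0, 1}"
| "supp DB = {0, 1}"

fun hdeg :: "gen \<Rightarrow> nat" where
  "hdeg Nail = 1"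
| "hdeg _ = 0"

text \<open>rels s: the relations with bottom state s, each written as a formal
linear combination (coefficient, word bottom-to-top) that is set to zero.
The product ab of the paper (a on top of b) corresponds to the word b @ a.\<close>

definition rels :: "color list \<Rightarrow> ('k::comm_ring_1 \<times> gen list) list set" where
"rels s =
   \<comment> \<open>black/black: tau^2 = 0 and the nilHecke relations\<close>
   {[(1, [Cr j, Cr j])] | j. Suc j < length s \<and> s!j = Black \<and> s!Suc j = Black}
 \<union> {[(1, [Dot j, Cr j]), (-1, [Cr j, Dot (Suc j)]), (-1, [])] | j.
       Suc j < length s \<and> s!j = Black \<and> s!Suc j = Black}
 \<union> {[(1, [Cr j, Dot j]), (-1, [Dot (Suc j), Cr j]), (-1, [])] | j.
       Suc j < length s \<and> s!j = Black \<and> s!Suc j = Black}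
   \<comment> \<open>braid relations (three black strands, or two black and one red not in the middle)\<close>
 \<union> {[(1, [Cr j, Cr (Suc j), Cr j]), (-1, [Cr (Suc j), Cr j, Cr (Suc j)])] | j.
       Suc (Suc j) < length s \<and> s!Suc j = Black \<and>
       ((s!j = Black \<and> s!Suc (Suc j) = Black) \<or> (s!j = Red \<and> s!Suc (Suc j) = Black)
        \<or> (s!j = Black \<and> s!Suc (Suc j) = Red))}
   \<comment> \<open>braid relation with the red strand in the middle\<close>
 \<union> {[(1, [Cr j, Cr (Suc j), Cr j]), (-1, [Cr (Suc j), Cr j, Cr (Suc j)]), (-1, [])] | j.
       Suc (Suc j) < length s \<and> s!j = Black \<and> s!Suc j = Red \<and> s!Suc (Suc j) = Black}
   \<comment> \<open>dots slide through black/red crossings\<close>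
 \<union> {[(1, [Dot j, Cr j]), (-1, [Cr j, Dot (Suc j)])] | j.
       Suc j < length s \<and> s!j = Black \<and> s!Suc j = Red}
 \<union> {[(1, [Dot (Suc j), Cr j]), (-1, [Cr j, Dot j])] | j.
       Suc j < length s \<and> s!j = Red \<and> s!Suc j = Black}
   \<comment> \<open>black/red double crossing = one dot on the black strand\<close>
 \<union> {[(1, [Cr j, Cr j]), (-1, [Dot j])] | j.
       Suc j < length s \<and> s!j = Black \<and> s!Suc j = Red}
 \<union> {[(1, [Cr j, Cr j]), (-1, [Dot (Suc j)])] | j.
       Suc j < length s \<and> s!j = Red \<and> s!Suc j = Black}
   \<comment> \<open>nail relations\<close>
 \<union> {[(1, [Dot 0, Nail]), (-1, [Nail, Dot 0])] | _::unit. s \<noteq> [] \<and> s!0 = Black}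
 \<union> {[(1, [Nail, Nail])] | _::unit. s \<noteq> [] \<and> s!0 = Black}
 \<union> {[(1, [Nail, Cr 0, Nail, Cr 0]), (1, [Cr 0, Nail, Cr 0, Nail])] | _::unit.
       1 < length s \<and> s!0 = Black \<and> s!1 = Black}
   \<comment> \<open>graded braid-like isotopy: far-apart generators commute up to sign\<close>
 \<union> {[(1, [g, h]), (- ((-1) ^ (hdeg g * hdeg h)), [h, g])] | g h.
       valid s g \<and> valid s h \<and> supp g \<inter> supp h = {}}
   \<comment> \<open>nail on a black strand immediately right of the first red strand
       moves from below the double braiding to above it\<close>
 \<union> {[(1, [Cr 0, Nail, Cr 0, DB]), (-1, [DB, Cr 0, Nail, Cr 0])] | _::unit.
       1 < length s \<and> s!0 = Red \<and> s!1 = Black}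
   \<comment> \<open>same for a black strand immediately left of the first red strand
       (between blue and the first red strand)\<close>
 \<union> {[(1, [Nail, Cr 0, DB, Cr 0]), (-1, [Cr 0, DB, Cr 0, Nail])] | _::unit.
       1 < length s \<and> s!0 = Black \<and> s!1 = Red}"

definition sandwich :: "color list \<Rightarrow> gen list \<Rightarrow> ('k::comm_ring_1 \<times> gen list) list
    \<Rightarrow> gen list \<Rightarrow> path \<Rightarrow> 'k" where
  "sandwich s0 lo R hi = (\<lambda>p. sum_list (map (\<lambda>(c, g). if p = (s0, lo @ g @ hi) then c else 0) R))"

text \<open>The two-sided ideal of relations in the free path algebra (the free
k-module on composable words), as a set of finitely supported coefficient functions.\<close>
inductive_set relN :: "(path \<Rightarrow> 'k::comm_ring_1) set" where
  zero: "(\<lambda>_. 0) \<in> relN"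
| gen: "\<lbrakk> R \<in> rels s; run s0 lo = Some s; \<forall>(c, g) \<in> set R. run s g = Some t;
          run t hi \<noteq> None \<rbrakk> \<Longrightarrow> sandwich s0 lo R hi \<in> relN"
| add: "\<lbrakk> f \<in> relN; g \<in> relN \<rbrakk> \<Longrightarrow> (\<lambda>p. f p + g p) \<in> relN"
| smult: "f \<in> relN \<Longrightarrow> (\<lambda>p. c * f p) \<in> relN"

text \<open>1_kappa X 1_rho: k-linear combinations of composable words from rho (bottom)
to kappa (top) containing exactly one double braiding (modulo relN).\<close>
definition Xsp :: "color list \<Rightarrow> color list \<Rightarrow> (path \<Rightarrow> 'k::comm_ring_1) set" where
  "Xsp kap rho = {v. finite {p. v p \<noteq> 0} \<and>
     (\<forall>p. v p \<noteq> 0 \<longrightarrow> fst p = rho \<and> run rho (snd p) = Some kap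
                         \<and> length (filter (\<lambda>g. g = DB) (snd p)) = 1)}"

definition lcomb :: "('i \<Rightarrow> 'k::comm_ring_1) \<Rightarrow> ('i \<Rightarrow> 'p \<Rightarrow> 'k) \<Rightarrow> 'p \<Rightarrow> 'k" where
  "lcomb c x = (\<lambda>p. \<Sum>i \<in> {i. c i \<noteq> 0}. c i * x i p)"

definition quot_basis :: "('p \<Rightarrow> 'k::comm_ring_1) set \<Rightarrow> ('p \<Rightarrow> 'k) set \<Rightarrow> 'i set
    \<Rightarrow> ('i \<Rightarrow> 'p \<Rightarrow> 'k) \<Rightarrow> bool" where
  "quot_basis V N I x \<longleftrightarrow>
     (\<forall>i \<in> I. x i \<in> V) \<and>
     (\<forall>c. finite {i. c i \<noteq> 0} \<and> {i. c i \<noteq> 0} \<subseteq> I \<and> lcomb c x \<in> N \<longrightarrow> (\<forall>i. c i = 0)) \<and>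
     (\<forall>v \<in> V. \<exists>c. finite {i. c i \<noteq> 0} \<and> {i. c i \<noteq> 0} \<subseteq> I \<and> (\<lambda>p. v p - lcomb c x p) \<in> N)"

definition comps :: "nat \<Rightarrow> nat \<Rightarrow> nat list set" where
  "comps b r = {c. length c = Suc r \<and> sum_list c = b}"

fun cstate :: "nat list \<Rightarrow> color list" where
  "cstate [] = []"
| "cstate (b0 # bs) = replicate b0 Black @ concat (map (\<lambda>bi. Red # replicate bi Black) bs)"

definition sw :: "nat \<Rightarrow> nat \<Rightarrow> nat" where
  "sw i q = (if q = i then Suc i else if q = Suc i then i else q)"

fun wperm :: "nat list \<Rightarrow> nat \<Rightarrow> nat" where
  "wperm [] = id"
| "wperm (i # ws) = sw i \<circ> wperm ws"

definition words :: "nat \<Rightarrow> nat list set" where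
  "words n = {ws. \<forall>i \<in> set ws. Suc i < n}"

definition reduced :: "nat \<Rightarrow> (nat \<Rightarrow> nat) \<Rightarrow> nat list \<Rightarrow> bool" where
  "reduced n w ws \<longleftrightarrow> ws \<in> words n \<and> wperm ws = w \<and>
     (\<forall>ws' \<in> words n. wperm ws' = w \<longrightarrow> length ws \<le> length ws')"

definition left_adjusted :: "nat \<Rightarrow> (nat \<Rightarrow> nat) \<Rightarrow> nat list \<Rightarrow> bool" where
  "left_adjusted n w ws \<longleftrightarrow> reduced n w ws \<and>
     (\<forall>ws'. reduced n w ws' \<longrightarrow> sum_list ws \<le> sum_list ws')"

text \<open>The diagram of a word sigma_{i1}...sigma_{ik}: top crossing sigma_{i1};
as a bottom-to-top word this is the reversed list.\<close>
definition word_diag :: "nat list \<Rightarrow> gen list" where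
  "word_diag ws = map Cr (rev ws)"

text \<open>kappa S rho: permutations (strand at bottom position q ends at top position w q)
from 1_rho to 1_kappa without red/red crossing in any reduced expression.\<close>
definition Sperm :: "color list \<Rightarrow> color list \<Rightarrow> (nat \<Rightarrow> nat) set" where
  "Sperm kap rho = {w. w permutes {..<length rho} \<and> length kap = length rho \<and>
     (\<forall>ws. reduced (length rho) w ws \<longrightarrow> run rho (word_diag ws) = Some kap)}"

fun mvg :: "gen \<Rightarrow> nat \<Rightarrow> nat" where
  "mvg (Cr j) q = sw j q"
| "mvg _ q = q"

fun traj :: "gen list \<Rightarrow> nat \<Rightarrow> nat list" where
  "traj [] q = [q]"
| "traj (g # gs) q = q # traj gs (mvg g q)"

text \<open>Positions (at heights 0..length gs) of the strand ending at top position t.\<close>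
definition rtraj :: "gen list \<Rightarrow> nat \<Rightarrow> nat list" where
  "rtraj gs t = rev (traj (rev gs) t)"

text \<open>Pull the strand at position p to the blue strand, apply g (nail or double
braiding) there, and pull it back.\<close>
definition pull :: "gen \<Rightarrow> nat \<Rightarrow> gen list" where
  "pull g p = map Cr (rev [0..<p]) @ [g] @ map Cr [0..<p]"

definition ins_left :: "gen \<Rightarrow> nat \<Rightarrow> gen list \<Rightarrow> gen list" where
  "ins_left g t gs = (let tr = rtraj gs t; p = Min (set tr); h = (LEAST h. tr ! h = p)
                      in take h gs @ pull g p @ drop h gs)"

definition bpos :: "color list \<Rightarrow> nat \<Rightarrow> nat" where
  "bpos kap i = filter (\<lambda>j. kap ! j = Black) [0..<length kap] ! i"

definition rpos :: "color list \<Rightarrow> nat" where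
  "rpos kap = hd (filter (\<lambda>j. kap ! j = Red) [0..<length kap])"

definition xel :: "nat \<Rightarrow> ((nat \<Rightarrow> nat) \<Rightarrow> nat list) \<Rightarrow> color list \<Rightarrow> color list
    \<Rightarrow> (nat \<Rightarrow> nat) \<times> nat list \<times> nat list \<Rightarrow> path" where
  "xel b ch kap rho = (\<lambda>(w, l, a).
     (let d0 = word_diag (ch w);
          d1 = foldl (\<lambda>gs i. if l ! i = 1 then ins_left Nail (bpos kap i) gs else gs) d0 [0..<b];
          d2 = d1 @ concat (map (\<lambda>i. replicate (a ! i) (Dot (bpos kap i))) [0..<b]);
          d3 = ins_left DB (rpos kap) d2
      in (rho, d3)))"

definition Idx :: "nat \<Rightarrow> color list \<Rightarrow> color list
    \<Rightarrow> ((nat \<Rightarrow> nat) \<times> nat list \<times> nat list) set" where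
  "Idx b kap rho = {(w, l, a). w \<in> Sperm kap rho \<and> length l = b \<and> set l \<subseteq> {0, 1} \<and> length a = b}"

definition delta :: "path \<Rightarrow> path \<Rightarrow> 'k::comm_ring_1" where
  "delta q p = (if p = q then 1 else 0)"

end

theory Submission
  imports Defs "HOL-Computational_Algebra.Polynomial" "Jordan_Normal_Form.Determinant"
begin

text \<open>Forgetting dots, the crossings together with the nail or double braiding at position 0 behave
like the generators of a Coxeter group of type B: modulo diagrams with fewer such letters every defining
relation is a braid relation of type B, and a repeated letter gives 0 or a dot. A left-adjusted diagram
with its nails and its double braiding is a reduced word of a signed permutation, so a Matsumoto argument,
by induction on the number of letters, shows that the diagrams \<open>x\<close> span.

For independence, strands carry pairwise distinct rational values and nails create fermions
named by these values; crossings act by divided differences and the double braiding acts as the identity.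
For fixed values this gives a square matrix of amplitudes of the undotted \<open>x\<close>. Its rows span everything, because
the \<open>x\<close> span all diagrams and dots can be used to isolate a single path, so the matrix is
invertible and the coefficients, which are polynomials in the values, vanish. This argument works over
the integers; there it yields integral coordinate functionals, which carry the independence
over to an arbitrary commutative ring.\<close>


section \<open>Signed permutations and reduced words\<close>

text \<open>No relation simplifies two consecutive double braidings. None is needed: every diagram
  contains exactly one, and for a reduced word their number can be read off the signed permutation
  as the number of negative red labels, so exchanging reduced words preserves it.

  Left-adjustedness enters through a single inequality. The leftmost position p of a strand is at
  most the number of strands that lie to its left at both ends. Pulling from p to the blue strand
  costs 2p+1 letters, while the type B length grows by twice that number plus one, so no insertion
  can destroy reducedness.

  Divided differences divide by differences of strand values, which a general ground ring does not
  allow; hence the rational values. A word follows many crossing patterns at once, so its row of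
  amplitudes has no evident leading term. Instead of an order on the basis and a triangular matrix,
  each unit row is produced in the row space, and squareness does the rest.\<close>

lemma sw_sw [simp]: "sw j (sw j q) = q"
  by (simp add: sw_def)

lemma sw_o_sw [simp]: "sw j \<circ> sw j = id"
  by (simp add: fun_eq_iff)

lemma bij_sw: "bij (sw j)"
  by (rule o_bij[of "sw j"]) simp_all

lemma sw_permutes: "Suc j < n \<Longrightarrow> sw j permutes {..<n}"
  by (rule bij_imp_permutes[OF bij_betw_byWitness[of _ "sw j"]]) (auto simp: sw_def)

text \<open>In a shortest diagram with given strand labels, the strands labelled \<open>a\<close> and \<open>b\<close> at positions \<open>i < k\<close>
cross once if they are inverted; otherwise they cross twice if the right one has to reach the blue strand.\<close>

definition pair_len :: "int \<Rightarrow> int \<Rightarrow> nat" where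
  "pair_len a b = (if \<bar>b\<bar> < \<bar>a\<bar> then 1 else if b < 0 then 2 else 0)"

definition slen :: "nat \<Rightarrow> (nat \<Rightarrow> int) \<Rightarrow> nat" where
  "slen n L = (\<Sum>(i, k) \<in> {(i, k). i < k \<and> k < n}. pair_len (L i) (L k)) + (\<Sum>q<n. if L q < 0 then 1 else 0)"

text \<open>\<open>Nail\<close> and \<open>DB\<close> flip the same sign. The colour of the strand
  at position 0 tells them apart, so one signed permutation records crossings, nails and double
  braidings. Dots leave no trace.\<close>

fun sstep :: "(nat \<Rightarrow> int) \<Rightarrow> gen \<Rightarrow> nat \<Rightarrow> int" where
  "sstep L (Cr j) = L \<circ> sw j"
| "sstep L (Dot j) = L"
| "sstep L Nail = L(0 := - L 0)"
| "sstep L DB = L(0 := - L 0)"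

abbreviation srun :: "(nat \<Rightarrow> int) \<Rightarrow> gen list \<Rightarrow> nat \<Rightarrow> int" where
  "srun L u \<equiv> foldl sstep L u"

definition id_labels :: "nat \<Rightarrow> int" where
  "id_labels q = int q + 1"

lemma finite_prs: "finite {(i, k). i < k \<and> k < (n::nat)}"
  by (rule finite_subset[of _ "{..<n} \<times> {..<n}"]) auto

lemma sstep_sstep: "(\<And>j. g \<noteq> Dot j) \<Longrightarrow> sstep (sstep L g) g = L"
  by (cases g) (auto simp: fun_eq_iff)

text \<open>\<open>sw j\<close> permutes the pairs of positions other than
  \<open>(j, Suc j)\<close>, so only that pair matters. Its contribution drops from 1 to 0 if the
  right label has the smaller absolute value, and from 2 to 1 otherwise.\<close>

lemma slen_swap:
  assumes "Suc j < n" "\<bar>L j\<bar> \<noteq> \<bar>L (Suc j)\<bar>" "L (Suc j) < L j"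
  shows "slen n L = Suc (slen n (L \<circ> sw j))"
proof -
  let ?P = "{(i, k). i < k \<and> k < n}"
  let ?Q = "?P - {(j, Suc j)}"
  let ?h = "\<lambda>(i, k). (sw j i, sw j k)"
  have P: "?P = insert (j, Suc j) ?Q" using assms by auto
  have bij: "bij_betw ?h ?Q ?Q"
    by (rule bij_betw_byWitness[of _ ?h]) (use assms in \<open>auto simp: sw_def split: if_splits\<close>)
  have s: "(\<Sum>(i, k)\<in>?Q. pair_len ((L \<circ> sw j) i) ((L \<circ> sw j) k)) = (\<Sum>(i, k)\<in>?Q. pair_len (L i) (L k))"
    using sum.reindex_bij_betw[OF bij, of "\<lambda>(i, k). pair_len (L i) (L k)"] by (simp add: case_prod_unfold)
  have f: "finite ?Q" using finite_prs by simp
  have "bij_betw (sw j) {..<n} {..<n}" using sw_permutes[OF assms(1)] by (rule permutes_imp_bij)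
  from sum.reindex_bij_betw[OF this, of "\<lambda>q. if L q < 0 then (1::nat) else 0"]
  have n: "(\<Sum>q<n. if (L \<circ> sw j) q < 0 then 1 else 0) = (\<Sum>q<n. if L q < 0 then (1::nat) else 0)"
    by simp
  have "pair_len (L j) (L (Suc j)) = Suc (pair_len (L (Suc j)) (L j))"
    using assms by (auto simp: pair_len_def)
  moreover have "(\<Sum>(i, k)\<in>?P. pair_len (L i) (L k)) = pair_len (L j) (L (Suc j)) + (\<Sum>(i, k)\<in>?Q. pair_len (L i) (L k))"
    by (subst P, subst sum.insert) (use f in auto)
  moreover have "(\<Sum>(i, k)\<in>?P. pair_len ((L \<circ> sw j) i) ((L \<circ> sw j) k)) = pair_len (L (Suc j)) (L j) + (\<Sum>(i, k)\<in>?Q. pair_len (L i) (L k))"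
    by (subst P, subst sum.insert, use f in auto) (use s in \<open>auto simp: sw_def\<close>)
  ultimately show ?thesis using n unfolding slen_def by simp
qed

text \<open>\<open>pair_len\<close> sees only the absolute value of its left argument, and position
  0 is never the right member of a pair; so only the count of negative labels changes.\<close>

lemma slen_neg_head:
  assumes "0 < n" "L 0 < 0"
  shows "slen n L = Suc (slen n (L(0 := - L 0)))"
proof -
  have "(\<Sum>(i, k) \<in> {(i, k). i < k \<and> k < n}. pair_len ((L(0 := - L 0)) i) ((L(0 := - L 0)) k))
     = (\<Sum>(i, k) \<in> {(i, k). i < k \<and> k < n}. pair_len (L i) (L k))"
    by (rule sum.cong) (auto simp: pair_len_def)
  moreover have "(\<Sum>q<n. if L q < 0 then 1 else 0) = Suc (\<Sum>q<n. if (L(0 := - L 0)) q < 0 then 1 else 0)"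
    using assms by (subst (1 2) sum.remove[of _ 0]) auto
  ultimately show ?thesis unfolding slen_def by simp
qed

section \<open>Admissible labellings, their colours and their descents\<close>

definition origin :: "(nat \<Rightarrow> int) \<Rightarrow> nat \<Rightarrow> nat" where
  "origin L q = nat (\<bar>L q\<bar> - 1)"

text \<open>Label \<open>q + 1\<close> is the strand at bottom position \<open>q\<close>; its sign records nailing, respectively double braiding.
Red strands keep their order, so only the first one can reach the blue strand.\<close>

definition good :: "color list \<Rightarrow> (nat \<Rightarrow> int) \<Rightarrow> bool" where
  "good rho L \<longleftrightarrow> origin L permutes {..<length rho} \<and> (\<forall>q. L q \<noteq> 0) \<and> (\<forall>q\<ge>length rho. 0 < L q) \<and>
     (\<forall>i j. i < j \<and> j < length rho \<and> rho ! origin L i = Red \<and> rho ! origin L j = Red \<longrightarrow> origin L i < origin L j \<and> 0 < L j)"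

definition colours :: "color list \<Rightarrow> (nat \<Rightarrow> int) \<Rightarrow> color list" where
  "colours rho L = map (\<lambda>q. rho ! origin L q) [0..<length rho]"

fun desc :: "color list \<Rightarrow> (nat \<Rightarrow> int) \<Rightarrow> gen \<Rightarrow> bool" where
  "desc rho L (Cr j) = (Suc j < length rho \<and> L (Suc j) < L j)"
| "desc rho L (Dot j) = False"
| "desc rho L Nail = (0 < length rho \<and> L 0 < 0 \<and> rho ! origin L 0 = Black)"
| "desc rho L DB = (0 < length rho \<and> L 0 < 0 \<and> rho ! origin L 0 = Red)"

lemma length_colours [simp]: "length (colours rho L) = length rho"
  by (simp add: colours_def)

lemma colours_Nil_iff [simp]: "colours rho L = [] \<longleftrightarrow> rho = []"
  by (simp add: colours_def)

lemma colours_nth [simp]: "q < length rho \<Longrightarrow> colours rho L ! q = rho ! origin L q"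
  by (simp add: colours_def)

lemma origin_swap: "origin (L \<circ> sw j) = origin L \<circ> sw j"
  by (auto simp: origin_def)

lemma origin_neg [simp]: "origin (L(q := - L q)) = origin L"
  by (auto simp: origin_def)

lemma origin_id_labels [simp]: "origin id_labels = id"
  by (auto simp: origin_def id_labels_def)

lemma colours_id_labels [simp]: "colours rho id_labels = rho"
  by (simp add: colours_def map_nth)

lemma colours_neg [simp]: "colours rho (L(q := - L q)) = colours rho L"
  by (simp add: colours_def)

lemma colours_swap: "Suc j < length rho \<Longrightarrow> colours rho (L \<circ> sw j) = step (colours rho L) (Cr j)"
  by (rule nth_equalityI) (auto simp: origin_swap sw_def nth_list_update)

lemma good_abs_inj: "good rho L \<Longrightarrow> \<bar>L i\<bar> = \<bar>L j\<bar> \<Longrightarrow> i = j"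
  unfolding good_def by (metis origin_def permutes_inj injD)

lemma good_origin_inj: "good rho L \<Longrightarrow> origin L i = origin L j \<Longrightarrow> i = j"
  unfolding good_def by (metis permutes_inj injD)

lemma good_abs: "good rho L \<Longrightarrow> \<bar>L q\<bar> = int (origin L q) + 1"
  unfolding good_def origin_def by (smt (verit) nat_0_le)

lemma good_id_labels: "good rho id_labels"
  by (auto simp: good_def permutes_id) (auto simp: id_labels_def)

lemma good_red: "good rho L \<Longrightarrow> i < j \<Longrightarrow> j < length rho \<Longrightarrow> rho ! origin L i = Red \<Longrightarrow> rho ! origin L j = Red
   \<Longrightarrow> origin L i < origin L j \<and> 0 < L j"
  unfolding good_def by blast

lemma good_swap:
  assumes g: "good rho L" and j: "Suc j < length rho" and c: "\<not> (rho ! origin L j = Red \<and> rho ! origin L (Suc j) = Red)"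
  shows "good rho (L \<circ> sw j)"
  unfolding good_def
proof (intro conjI allI impI)
  show "origin (L \<circ> sw j) permutes {..<length rho}"
    using g sw_permutes[OF j] unfolding good_def origin_swap by (blast intro: permutes_compose)
  show "(L \<circ> sw j) q \<noteq> 0" for q using g by (auto simp: good_def)
  show "0 < (L \<circ> sw j) q" if "length rho \<le> q" for q using g j that by (auto simp: good_def sw_def)
  fix i k assume a: "i < k \<and> k < length rho \<and> rho ! origin (L \<circ> sw j) i = Red \<and> rho ! origin (L \<circ> sw j) k = Red"
  then have "sw j i < sw j k" using c unfolding origin_swap by (auto simp: sw_def split: if_splits)
  moreover have "sw j k < length rho" using a j by (auto simp: sw_def)
  ultimately show "origin (L \<circ> sw j) i < origin (L \<circ> sw j) k" "0 < (L \<circ> sw j) k"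
    using good_red[OF g, of "sw j i" "sw j k"] a unfolding origin_swap by auto
qed

lemma good_neg:
  assumes g: "good rho L" and c: "rho ! origin L q = Black \<or> (\<forall>i<q. rho ! origin L i = Black)" and q: "q < length rho"
  shows "good rho (L(q := - L q))"
  unfolding good_def origin_neg
proof (intro conjI allI impI)
  show "origin L permutes {..<length rho}" using g by (simp add: good_def)
  show "(L(q := - L q)) i \<noteq> 0" for i using g by (auto simp: good_def)
  show "0 < (L(q := - L q)) i" if "length rho \<le> i" for i using g that q by (auto simp: good_def)
  fix i j assume a: "i < j \<and> j < length rho \<and> rho ! origin L i = Red \<and> rho ! origin L j = Red"
  then show "origin L i < origin L j" "0 < (L(q := - L q)) j"
    using good_red[OF g, of i j] c by auto
qed

text \<open>The step that peels a letter off the top: the non-dot letters are involutions on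
  labellings, so \<open>sstep L s\<close> is the labelling just below \<open>s\<close>.\<close>

lemma desc_step:
  assumes g: "good rho L" and d: "desc rho L s"
  shows "good rho (sstep L s)" "valid (colours rho (sstep L s)) s" "step (colours rho (sstep L s)) s = colours rho L"
    "slen (length rho) L = Suc (slen (length rho) (sstep L s))" "sstep (sstep L s) s = L"
proof -
  have "good rho (sstep L s) \<and> valid (colours rho (sstep L s)) s \<and> step (colours rho (sstep L s)) s = colours rho L \<and>
    slen (length rho) L = Suc (slen (length rho) (sstep L s)) \<and> sstep (sstep L s) s = L"
  proof (cases s)
    case (Cr j)
    with d have j: "Suc j < length rho" "L (Suc j) < L j" by auto
    \<comment> \<open>By \<open>good\<close>, two red strands have increasing origins and the right
      label is positive, so they never form a descent.\<close>
    have c: "\<not> (rho ! origin L j = Red \<and> rho ! origin L (Suc j) = Red)"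
      using good_red[OF g, of j "Suc j"] good_abs[OF g, of j] good_abs[OF g, of "Suc j"] j by auto
    moreover have "\<bar>L j\<bar> \<noteq> \<bar>L (Suc j)\<bar>" using good_abs_inj[OF g] by fastforce
    moreover have "step (colours rho (L \<circ> sw j)) (Cr j) = colours rho L"
      using colours_swap[OF j(1), of "L \<circ> sw j"] by (simp add: o_assoc[symmetric])
    ultimately show ?thesis using Cr j good_swap[OF g j(1) c] slen_swap[OF j(1) _ j(2)]
      by (simp add: origin_swap o_assoc[symmetric]) (auto simp: sw_def)
  next
    case Nail
    with d show ?thesis using good_neg[OF g, of 0] slen_neg_head[of "length rho" L]
      by (auto simp: fun_upd_idem)
  next
    case DB
    with d show ?thesis using good_neg[OF g, of 0] slen_neg_head[of "length rho" L]
      by (auto simp: fun_upd_idem)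
  qed (use d in auto)
  then show "good rho (sstep L s)" "valid (colours rho (sstep L s)) s" "step (colours rho (sstep L s)) s = colours rho L"
    "slen (length rho) L = Suc (slen (length rho) (sstep L s))" "sstep (sstep L s) s = L" by auto
qed

lemma valid_step:
  assumes g: "good rho L" and v: "valid (colours rho L) s"
  shows "good rho (sstep L s)" "colours rho (sstep L s) = step (colours rho L) s"
proof -
  have "good rho (sstep L s) \<and> colours rho (sstep L s) = step (colours rho L) s"
  proof (cases s)
    case (Cr j)
    with v show ?thesis using good_swap[OF g, of j] colours_swap[of j rho L] by auto
  qed (use v good_neg[OF g, of 0] g in auto)
  then show "good rho (sstep L s)" "colours rho (sstep L s) = step (colours rho L) s" by auto
qed

lemma slen_id_labels [simp]: "slen n id_labels = 0"
  by (auto simp: slen_def id_labels_def pair_len_def intro!: sum.neutral)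

text \<open>Without descents the label at position 0 is positive and the labels increase strictly,
  so position \<open>q\<close> carries at least \<open>q + 1\<close>. A permutation of an initial
  segment that lowers no element is the identity.\<close>

lemma no_desc_id_labels:
  assumes g: "good rho L" and nd: "\<And>s. \<not> desc rho L s"
  shows "L = id_labels"
proof -
  have asc: "L j < L (Suc j)" if "Suc j < length rho" for j
    using nd[of "Cr j"] that good_abs_inj[OF g, of j "Suc j"] by fastforce
  have h: "0 < L 0" if "0 < length rho"
    using nd[of Nail] nd[of DB] that g unfolding good_def by (cases "rho ! origin L 0") (auto simp: linorder_neq_iff)
  have le: "int q < L q" if "q < length rho" for q
    using that by (induction q) (use h asc in force)+
  have p: "origin L permutes {..<length rho}" using g by (simp add: good_def)
  have "origin L q = q" for q
  proof (cases "q < length rho")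
    case True
    have "\<forall>q\<in>{..<length rho}. q \<le> origin L q" using le unfolding origin_def by force
    then show ?thesis using permutes_natset_ge[OF p] by auto
  qed (use p in \<open>auto simp: permutes_def\<close>)
  moreover have "0 < L q" for q
    using le[of q] g by (cases "q < length rho") (auto simp: good_def)
  ultimately show ?thesis using good_abs[OF g] by (auto simp: id_labels_def fun_eq_iff abs_of_pos)
qed

text \<open>Reducedness is built by adding descents at the top instead of being defined by minimal
  length; this avoids an exchange condition and any comparison with all other words.\<close>

inductive redw :: "color list \<Rightarrow> gen list \<Rightarrow> (nat \<Rightarrow> int) \<Rightarrow> bool" for rho where
  Nil: "redw rho [] id_labels"
| snoc: "redw rho u (sstep L s) \<Longrightarrow> good rho L \<Longrightarrow> desc rho L s \<Longrightarrow> redw rho (u @ [s]) L"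

lemma run_append: "run s (u @ v) = (case run s u of None \<Rightarrow> None | Some t \<Rightarrow> run t v)"
  by (induction u arbitrary: s) auto

lemma redwD:
  assumes "redw rho u L"
  shows "good rho L" "run rho u = Some (colours rho L)" "srun id_labels u = L" "length u = slen (length rho) L"
  using assms by (induction) (auto simp: good_id_labels run_append desc_step)

lemma redw_ex: "good rho L \<Longrightarrow> \<exists>u. redw rho u L"
proof (induction "slen (length rho) L" arbitrary: L rule: less_induct)
  case less
  show ?case
  proof (cases "\<exists>s. desc rho L s")
    case True
    then obtain s where s: "desc rho L s" by blast
    then obtain u where "redw rho u (sstep L s)"
      using less(1)[of "sstep L s"] desc_step[OF less(2) s] by auto
    then show ?thesis using redw.snoc less(2) s by blast
  next
    case False
    then show ?thesis using no_desc_id_labels[OF less(2)] redw.Nil by metis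
  qed
qed

abbreviation ndb :: "gen list \<Rightarrow> nat" where
  "ndb u \<equiv> length (filter (\<lambda>g. g = DB) u)"

lemma run_good:
  "run rho u = Some t \<Longrightarrow> good rho (srun id_labels u) \<and> t = colours rho (srun id_labels u)"
proof (induction u arbitrary: t rule: rev_induct)
  case Nil then show ?case by (auto simp: good_id_labels)
next
  case (snoc s u)
  then obtain t' where t: "run rho u = Some t'" "valid t' s" "t = step t' s"
    by (auto simp: run_append split: option.splits if_splits)
  then show ?case using snoc(1)[of t'] valid_step[of rho "srun id_labels u" s] by auto
qed

text \<open>A letter that is not a descent below becomes one above, so \<open>desc_step\<close>,
  read upwards, gives the length bound.\<close>

lemma step_slen_le:
  assumes g: "good rho L" and v: "valid (colours rho L) s"
  shows "slen (length rho) (sstep L s) \<le> Suc (slen (length rho) L)"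
    "(\<And>j. s \<noteq> Dot j) \<Longrightarrow> \<not> desc rho L s \<Longrightarrow> desc rho (sstep L s) s"
proof -
  have nz: "\<And>q. L q \<noteq> 0" using g by (auto simp: good_def)
  show 2: "desc rho (sstep L s) s" if "\<And>j. s \<noteq> Dot j" "\<not> desc rho L s"
  proof (cases s)
    case (Cr j)
    moreover have "L j \<noteq> L (Suc j)" using good_abs_inj[OF g, of j "Suc j"] by auto
    ultimately show ?thesis using that v by (auto simp: sw_def)
  next
    case Nail with that v nz[of 0] show ?thesis by auto
  next
    case DB with that v nz[of 0] show ?thesis by auto
  qed (use that in auto)
  show "slen (length rho) (sstep L s) \<le> Suc (slen (length rho) L)"
  proof (cases "\<exists>j. s = Dot j")
    case False
    show ?thesis
    proof (cases "desc rho L s")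
      case True
      then show ?thesis using desc_step[OF g] by auto
    next
      case nd: False
      then show ?thesis using 2 False desc_step[OF valid_step(1)[OF g v], of s] sstep_sstep[of s L] by auto
    qed
  qed auto
qed

abbreviation cox :: "gen list \<Rightarrow> bool" where
  "cox u \<equiv> (\<forall>s\<in>set u. \<forall>j. s \<noteq> Dot j)"

text \<open>The substitute for the exchange condition: reading upwards, stop at the first letter
  that is already a descent. The part below it is reduced and may be rewritten so as to end in that
  same letter.\<close>

lemma redw_cases:
  assumes "run rho u = Some t" "cox u"
  shows "redw rho u (srun id_labels u) \<or>
    (\<exists>u1 s u2. u = u1 @ s # u2 \<and> redw rho u1 (srun id_labels u1) \<and> desc rho (srun id_labels u1) s)"
  using assms
proof (induction u arbitrary: t rule: rev_induct)
  case (snoc s u)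
  then obtain t' where t: "run rho u = Some t'" "valid t' s" "t = step t' s"
    by (auto simp: run_append split: option.splits if_splits)
  note gd = run_good[OF t(1)]
  from snoc t(1) consider "redw rho u (srun id_labels u)" |
    u1 s' u2 where "u = u1 @ s' # u2" "redw rho u1 (srun id_labels u1)" "desc rho (srun id_labels u1) s'" by auto
  then show ?case
  proof cases
    case 1
    show ?thesis
    proof (cases "desc rho (srun id_labels u) s")
      case False
      have "\<And>j. s \<noteq> Dot j" using snoc(3) by auto
      then show ?thesis using 1 False step_slen_le(2)[of rho "srun id_labels u" s] gd t valid_step[of rho "srun id_labels u" s]
         sstep_sstep[of s "srun id_labels u"] redw.snoc[of rho u "srun id_labels (u @ [s])" s] by auto
    qed (use 1 in blast)
  qed (metis append_Cons append_assoc)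
qed (auto intro: redw.Nil)

text \<open>Every letter raises \<open>slen\<close> by at most one, and a descent lowers it. A word
  no longer than the length of its labelling therefore never repeats a descent.\<close>

lemma redw_if_short:
  assumes "run rho u = Some t" "cox u" "length u \<le> slen (length rho) (srun id_labels u)"
  shows "redw rho u (srun id_labels u)"
  using redw_cases[OF assms(1,2)]
proof
  assume "\<exists>u1 s u2. u = u1 @ s # u2 \<and> redw rho u1 (srun id_labels u1) \<and> desc rho (srun id_labels u1) s"
  then obtain u1 s u2 where u: "u = u1 @ s # u2" "redw rho u1 (srun id_labels u1)" "desc rho (srun id_labels u1) s" by blast
  have *: "slen (length rho) (srun id_labels (v @ w)) \<le> slen (length rho) (srun id_labels v) + length w"
    if "run rho (v @ w) = Some t" for v w t
    using that
  proof (induction w arbitrary: t rule: rev_induct)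
    case (snoc a w)
    then obtain t' where t: "run rho (v @ w) = Some t'" "valid t' a" "t = step t' a"
      unfolding append_assoc[symmetric] run_append[of rho "v @ w"]
      by (auto split: option.splits if_splits simp del: append_assoc)
    have "slen (length rho) (srun id_labels (v @ w @ [a])) \<le> Suc (slen (length rho) (srun id_labels (v @ w)))"
      using step_slen_le(1)[of rho "srun id_labels (v @ w)" a] run_good[OF t(1)] t by auto
    with snoc(1)[OF t(1)] show ?case by simp
  qed auto
  have "slen (length rho) (srun id_labels u) \<le> slen (length rho) (srun id_labels (u1 @ [s])) + length u2"
    using *[of "u1 @ [s]" u2] assms(1) u(1) by simp
  moreover have "Suc (slen (length rho) (srun id_labels (u1 @ [s]))) = length u1"
    using desc_step(4)[OF _ u(3)] redwD[OF u(2)] by simp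
  ultimately show ?thesis using assms(3) u(1) by simp
qed

section \<open>Braid moves modulo shorter diagrams\<close>

text \<open>By \<open>redw_ndb\<close> this is the number of double braidings in any reduced word
  for \<open>L\<close>. The condition \<open>ndb = 1\<close> thus depends on the labelling
  alone.\<close>

definition neg_reds :: "color list \<Rightarrow> (nat \<Rightarrow> int) \<Rightarrow> nat" where
  "neg_reds rho L = (\<Sum>q<length rho. if L q < 0 \<and> rho ! origin L q = Red then 1 else 0)"

lemma neg_reds_swap:
  assumes "Suc j < length rho"
  shows "neg_reds rho (L \<circ> sw j) = neg_reds rho L"
proof -
  have "bij_betw (sw j) {..<length rho} {..<length rho}" using sw_permutes[OF assms] by (rule permutes_imp_bij)
  from sum.reindex_bij_betw[OF this, of "\<lambda>q. if L q < 0 \<and> rho ! origin L q = Red then (1::nat) else 0"]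
  show ?thesis by (simp add: neg_reds_def origin_swap)
qed

lemma neg_reds_desc:
  assumes "desc rho L s"
  shows "neg_reds rho L = neg_reds rho (sstep L s) + (if s = DB then 1 else 0)"
proof (cases s)
  case (Cr j)
  with assms show ?thesis using neg_reds_swap[of j rho L] by auto
next
  case Nail
  with assms have "neg_reds rho (L(0 := - L 0)) = neg_reds rho L"
    unfolding neg_reds_def origin_neg by (intro sum.cong) auto
  with Nail show ?thesis by simp
next
  case DB
  with assms have "neg_reds rho L = Suc (neg_reds rho (L(0 := - L 0)))"
    unfolding neg_reds_def origin_neg by (subst (1 2) sum.remove[of _ 0]) auto
  with DB show ?thesis by simp
qed (use assms in auto)

lemma redw_ndb: "redw rho u L \<Longrightarrow> ndb u = neg_reds rho L"
proof (induction rule: redw.induct)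
  case Nil then show ?case by (auto simp: neg_reds_def id_labels_def)
next
  case (snoc u L s) then show ?case using neg_reds_desc[of rho L s] by auto
qed

lemma redw_cox: "redw rho u L \<Longrightarrow> cox u"
  by (induction rule: redw.induct) auto

text \<open>The word is read from the top down, whence the \<open>rev\<close> in
  \<open>redw_desc_chain\<close>.\<close>

fun desc_chain :: "color list \<Rightarrow> (nat \<Rightarrow> int) \<Rightarrow> gen list \<Rightarrow> bool" where
  "desc_chain rho L [] = True"
| "desc_chain rho L (s # ss) = (desc rho L s \<and> desc_chain rho (sstep L s) ss)"

lemma redw_desc_chain:
  "good rho L \<Longrightarrow> desc_chain rho L ss \<Longrightarrow> redw rho z (srun L ss) \<Longrightarrow> redw rho (z @ rev ss) L"
proof (induction ss arbitrary: L)
  case (Cons s ss)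
  then have "redw rho (z @ rev ss) (sstep L s)" using desc_step(1)[of rho L s] by auto
  with Cons redw.snoc[of rho "z @ rev ss" L s] show ?case by auto
qed simp

lemma good_desc_chain: "good rho L \<Longrightarrow> desc_chain rho L ss \<Longrightarrow> good rho (srun L ss)"
  by (induction ss arbitrary: L) (auto simp: desc_step)

fun is_cox :: "gen \<Rightarrow> bool" where
  "is_cox (Dot j) = False"
| "is_cox _ = True"

abbreviation clen :: "gen list \<Rightarrow> nat" where
  "clen u \<equiv> length (filter is_cox u)"

lemma is_cox_iff: "is_cox s \<longleftrightarrow> (\<forall>j. s \<noteq> Dot j)"
  by (cases s) auto

lemma cox_clen: "cox u \<Longrightarrow> clen u = length u"
  by (induction u) (auto simp: is_cox_iff)

lemma sandwich_Nil: "sandwich s0 lo [] hi = (\<lambda>_. 0)"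
  by (simp add: sandwich_def)

lemma sandwich_Cons:
  "sandwich s0 lo ((c, g) # R) hi = (\<lambda>p. c * delta (s0, lo @ g @ hi) p + sandwich s0 lo R hi p)"
  by (auto simp: sandwich_def delta_def fun_eq_iff)

lemma run_dots: "\<forall>d\<in>set D. \<not> is_cox d \<Longrightarrow> run t D = Some t' \<Longrightarrow> t' = t"
proof (induction D arbitrary: t)
  case (Cons d D) then show ?case by (cases d) (auto split: if_splits)
qed auto

lemma dots_clen: "\<forall>d\<in>set D. \<not> is_cox d \<Longrightarrow> clen D = 0 \<and> ndb D = 0"
  by (induction D) (auto simp: is_cox_iff)

lemma step_Cr_Cr:
  assumes "Suc j < length s"
  shows "step (step s (Cr j)) (Cr j) = s"
  by (rule nth_equalityI) (use assms Suc_lessD[OF assms] in \<open>auto simp: nth_list_update\<close>)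

text \<open>\<open>B\<close> abstracts what is already under control: relations, their linear
  combinations, and diagrams with one \<open>DB\<close> and fewer than \<open>k\<close> letters
  other than dots. It will be the span of the basis diagrams, with \<open>low\<close> as the
  induction hypothesis.\<close>

locale lower_filtration =
  fixes rho kap :: "color list" and B :: "(path \<Rightarrow> 'k::comm_ring_1) set" and k :: nat
  assumes rel: "f \<in> relN \<Longrightarrow> f \<in> B"
    and add: "f \<in> B \<Longrightarrow> g \<in> B \<Longrightarrow> (\<lambda>p. f p + g p) \<in> B"
    and smult: "f \<in> B \<Longrightarrow> (\<lambda>p. c * f p) \<in> B"
    and low: "run rho p = Some kap \<Longrightarrow> ndb p = 1 \<Longrightarrow> clen p < k \<Longrightarrow> delta (rho, p) \<in> B"
begin

text \<open>Equivalence of membership is weaker than congruence modulo \<open>B\<close>, but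
  membership is all that is asked for, and signs of relations drop out.\<close>

definition sim :: "gen list \<Rightarrow> gen list \<Rightarrow> bool" where
  "sim p q \<longleftrightarrow> (delta (rho, p) \<in> B \<longleftrightarrow> delta (rho, q) \<in> B)"

lemma sim_refl [simp]: "sim p p" by (simp add: sim_def)
lemma sim_sym: "sim p q \<Longrightarrow> sim q p" by (simp add: sim_def)
lemma sim_trans [trans]: "sim p q \<Longrightarrow> sim q r \<Longrightarrow> sim p r" by (simp add: sim_def)

lemma rel_sandwich:
  fixes R :: "('k \<times> gen list) list"
  assumes "R \<in> rels s" "run rho lo = Some s" "\<forall>(c, g) \<in> set R. run s g = Some t" "run t hi = Some kap"
  shows "sandwich rho lo R hi \<in> B"
  by (rule rel, rule relN.gen[OF assms(1-3)]) (use assms in auto)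

text \<open>The second coefficient is its own inverse and the third term lies in \<open>B\<close>,
  so each of the first two terms lies in \<open>B\<close> as soon as the other does.\<close>

lemma sim3:
  assumes "[(1::'k, u), (c, v), (d, w)] \<in> rels s" "c * c = (1::'k)" "run rho lo = Some s"
    "run s u = Some t" "run s v = Some t" "run s w = Some t" "run t hi = Some kap"
    "delta (rho, lo @ w @ hi) \<in> B"
  shows "sim (lo @ u @ hi) (lo @ v @ hi)"
proof -
  let ?d = "\<lambda>w p. delta (rho, lo @ w @ hi) p :: 'k"
  have "sandwich rho lo [(1::'k, u), (c, v), (d, w)] hi \<in> B"
    by (rule rel_sandwich[OF assms(1)]) (use assms in auto)
  from add[OF this smult[OF assms(8), of "- d"]]
  have *: "(\<lambda>p. ?d u p + c * ?d v p) \<in> B"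
    by (simp add: sandwich_Cons sandwich_Nil algebra_simps)
  have "?d u \<in> B" if "?d v \<in> B"
    using add[OF * smult[OF that, of "- c"]] by simp
  moreover have "?d v \<in> B" if "?d u \<in> B"
    using smult[OF add[OF * smult[OF that, of "- 1"]], of c] assms(2) by (simp add: mult.assoc[symmetric])
  ultimately show ?thesis unfolding sim_def by blast
qed

lemma sim2:
  assumes "[(1::'k, u), (c, v)] \<in> rels s" "c * c = (1::'k)" "run rho lo = Some s"
    "run s u = Some t" "run s v = Some t" "run t hi = Some kap"
  shows "sim (lo @ u @ hi) (lo @ v @ hi)"
proof -
  let ?d = "\<lambda>w p. delta (rho, lo @ w @ hi) p :: 'k"
  have "sandwich rho lo [(1::'k, u), (c, v)] hi \<in> B"
    by (rule rel_sandwich[OF assms(1)]) (use assms in auto)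
  then have *: "(\<lambda>p. ?d u p + c * ?d v p) \<in> B"
    by (simp add: sandwich_Cons sandwich_Nil algebra_simps)
  have "?d u \<in> B" if "?d v \<in> B"
    using add[OF * smult[OF that, of "- c"]] by simp
  moreover have "?d v \<in> B" if "?d u \<in> B"
    using smult[OF add[OF * smult[OF that, of "- 1"]], of c] assms(2) by (simp add: mult.assoc[symmetric])
  ultimately show ?thesis unfolding sim_def by blast
qed

lemma rel1:
  assumes "[(1::'k, u)] \<in> rels s" "run rho lo = Some s" "run s u = Some t" "run t hi = Some kap"
  shows "delta (rho, lo @ u @ hi) \<in> B"
proof -
  have "sandwich rho lo [(1::'k, u)] hi \<in> B"
    by (rule rel_sandwich[OF assms(1)]) (use assms in auto)
  then show ?thesis by (simp add: sandwich_Cons sandwich_Nil)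
qed

lemma sim_comm:
  assumes "run rho lo = Some s" "valid s g" "valid s h" "supp g \<inter> supp h = {}"
    "run (step (step s g) h) hi = Some kap"
  shows "sim (lo @ [g, h] @ hi) (lo @ [h, g] @ hi)"
proof -
  \<comment> \<open>Only nails have degree 1, and two nails share the blue strand; letters with
    disjoint supports therefore commute without a sign.\<close>
  have "hdeg g * hdeg h = 0" using assms(4) by (cases g; cases h) auto
  then have "[(1::'k, [g, h]), (- 1, [h, g])] \<in> rels s"
    using assms unfolding rels_def by fastforce
  moreover have "valid (step s g) h" "valid (step s h) g" "step (step s g) h = step (step s h) g"
    using assms(2-4) by (cases g; cases h; auto simp: nth_list_update list_update_swap)+
  ultimately show ?thesis
    by (intro sim2[of _ "- 1" _ s _ "step (step s g) h"]) (use assms in auto)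
qed

text \<open>A correction term occurs only when the middle strand is red. It is the identity, three
  letters shorter, and the bound \<open>clen (lo @ hi) + 3 \<le> k\<close> puts it into
  \<open>B\<close>.\<close>

lemma sim_braid:
  assumes "run rho lo = Some s" "run s [Cr j, Cr (Suc j), Cr j] = Some t" "run t hi = Some kap"
    "ndb (lo @ hi) = 1" "clen (lo @ hi) + 3 \<le> k"
  shows "sim (lo @ [Cr j, Cr (Suc j), Cr j] @ hi) (lo @ [Cr (Suc j), Cr j, Cr (Suc j)] @ hi)"
proof -
  let ?u = "[Cr j, Cr (Suc j), Cr j]" and ?v = "[Cr (Suc j), Cr j, Cr (Suc j)]"
  have l: "Suc (Suc j) < length s" and v: "run s ?v = Some t"
    and c: "\<not> (s ! j = Red \<and> s ! Suc j = Red)" "\<not> (s ! j = Red \<and> s ! Suc (Suc j) = Red)"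
      "\<not> (s ! Suc j = Red \<and> s ! Suc (Suc j) = Red)"
  proof -
    have "step (step (step s (Cr j)) (Cr (Suc j))) (Cr j) = step (step (step s (Cr (Suc j))) (Cr j)) (Cr (Suc j))"
      if "Suc (Suc j) < length s"
      using that by (intro nth_equalityI) (auto simp: nth_list_update)
    then show "Suc (Suc j) < length s" "run s ?v = Some t" "\<not> (s ! j = Red \<and> s ! Suc j = Red)"
      "\<not> (s ! j = Red \<and> s ! Suc (Suc j) = Red)" "\<not> (s ! Suc j = Red \<and> s ! Suc (Suc j) = Red)"
      using assms(2) by (auto simp: nth_list_update split: if_splits)
  qed
  show ?thesis
  proof (cases "s ! Suc j = Red")
    case True
    then have b: "s ! j = Black" "s ! Suc (Suc j) = Black"
      using c by (cases "s ! j"; cases "s ! Suc (Suc j)"; auto)+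
    then have "[(1::'k, ?u), (- 1, ?v), (- 1, [])] \<in> rels s"
      using True l unfolding rels_def by auto
    moreover have "t = s" using assms(2) b l
      by (intro nth_equalityI) (auto simp: nth_list_update split: if_splits)
    ultimately show ?thesis using assms v
      by (intro sim3[where c = "- 1" and w = "[]" and s = s and t = t and d = "- 1"]) (auto simp: run_append intro!: low)
  next
    case False
    then have b: "s ! Suc j = Black" by (cases "s ! Suc j") auto
    then have "[(1::'k, ?u), (- 1, ?v)] \<in> rels s"
      using l c unfolding rels_def by (cases "s ! j"; cases "s ! Suc (Suc j)") auto
    then show ?thesis using assms v by (intro sim2[where c = "- 1" and s = s and t = t]) auto
  qed
qed

text \<open>These are the type B relations of length four: the relation between two nails and the
  two moves of a nail past the double braiding. The pair \<open>(DB, DB)\<close> is absent because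
  red strands do not cross.\<close>

lemma sim_nail4:
  assumes lo: "run rho lo = Some s" and u: "run s [g, Cr 0, h, Cr 0] = Some t" and hi: "run t hi = Some kap"
    and gh: "(g, h) \<in> {(Nail, Nail), (Nail, DB), (DB, Nail)}"
  shows "sim (lo @ [g, Cr 0, h, Cr 0] @ hi) (lo @ [Cr 0, h, Cr 0, g] @ hi)"
proof -
  have st: "step M g = M" "step M h = M" for M using gh by auto
  have l: "Suc 0 < length s" using u st by (simp split: if_splits)
  then have "step (step s (Cr 0)) (Cr 0) = s" by (rule step_Cr_Cr)
  then have t: "t = s" using u st by (simp split: if_splits)
  have vd: "valid s g" "valid (step s (Cr 0)) h" "valid s (Cr 0)" "valid (step s (Cr 0)) (Cr 0)"
    using u st by (simp_all split: if_splits)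
  have v: "run s [Cr 0, h, Cr 0, g] = Some s"
    using vd st \<open>step (step s (Cr 0)) (Cr 0) = s\<close> by simp
  from gh consider "g = Nail" "h = Nail" | "g = Nail" "h = DB" | "g = DB" "h = Nail" by auto
  then show ?thesis
  proof cases
    case 1
    then have "s ! 0 = Black" "s ! 1 = Black" using vd l by simp_all
    then have "[(1::'k, [g, Cr 0, h, Cr 0]), (1, [Cr 0, h, Cr 0, g])] \<in> rels s"
      using l 1 unfolding rels_def by simp
    from sim2[OF this _ lo u] v t hi show ?thesis by simp
  next
    case 2
    then have "s ! 0 = Black" "s ! 1 = Red" using vd l by simp_all
    then have "[(1::'k, [g, Cr 0, h, Cr 0]), (- 1, [Cr 0, h, Cr 0, g])] \<in> rels s"
      using l 2 unfolding rels_def by simp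
    from sim2[OF this _ lo u] v t hi show ?thesis by simp
  next
    case 3
    then have "s ! 0 = Red" "s ! 1 = Black" using vd l by simp_all
    then have "[(1::'k, [Cr 0, h, Cr 0, g]), (- 1, [g, Cr 0, h, Cr 0])] \<in> rels s"
      using l 3 unfolding rels_def by simp
    from sim2[OF this _ lo v] u t hi show ?thesis by (simp add: sim_def)
  qed
qed

text \<open>The local step of Matsumoto's theorem: reduced words for \<open>L\<close> ending in
  \<open>s\<close> and in \<open>t\<close>, with a common beginning \<open>z\<close>, that may be
  exchanged below every continuation \<open>hi\<close>.\<close>

definition diamond :: "(nat \<Rightarrow> int) \<Rightarrow> gen \<Rightarrow> gen \<Rightarrow> bool" where
  "diamond L s t \<longleftrightarrow> (\<exists>z a b. redw rho (z @ a) (sstep L s) \<and> redw rho (z @ b) (sstep L t) \<and>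
     (\<forall>hi. run (colours rho L) hi = Some kap \<longrightarrow> ndb (z @ a @ s # hi) = 1 \<longrightarrow> clen (z @ a @ s # hi) \<le> k \<longrightarrow>
        sim (z @ a @ s # hi) (z @ b @ t # hi)))"

text \<open>\<open>s # ss\<close> and \<open>t # ts\<close> are the two words of a rank two braid
  relation, read downwards. Both lead to the same labelling, and \<open>z\<close> is a reduced word
  for it.\<close>

lemma diamondI:
  assumes g: "good rho L" and ch: "desc_chain rho L (s # ss)" "desc_chain rho L (t # ts)" and e: "srun L (s # ss) = srun L (t # ts)"
    and m: "\<And>z S hi. run rho z = Some S \<Longrightarrow> run S (rev ss @ [s]) = Some (colours rho L) \<Longrightarrow> run S (rev ts @ [t]) = Some (colours rho L) \<Longrightarrow>
      run (colours rho L) hi = Some kap \<Longrightarrow> ndb (z @ rev ss @ [s] @ hi) = 1 \<Longrightarrow> clen (z @ rev ss @ [s] @ hi) \<le> k \<Longrightarrow>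
      sim (z @ (rev ss @ [s]) @ hi) (z @ (rev ts @ [t]) @ hi)"
  shows "diamond L s t"
proof -
  let ?M = "srun L (s # ss)"
  obtain z where z: "redw rho z ?M" using redw_ex good_desc_chain[OF g ch(1)] by blast
  have r: "redw rho (z @ rev ss @ [s]) L" "redw rho (z @ rev ts @ [t]) L"
    using redw_desc_chain[OF g ch(1) z] redw_desc_chain[OF g ch(2)] z e by auto
  have r': "redw rho (z @ rev ss) (sstep L s)" "redw rho (z @ rev ts) (sstep L t)"
    using redw_desc_chain[of rho "sstep L s" ss z] redw_desc_chain[of rho "sstep L t" ts z] z e ch desc_step(1)[OF g] by auto
  have "run (colours rho ?M) (rev ss @ [s]) = Some (colours rho L)" "run (colours rho ?M) (rev ts @ [t]) = Some (colours rho L)"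
    using redwD(2)[OF r(1)] redwD(2)[OF r(2)] redwD(2)[OF z] run_append[of rho z] by auto
  note m' = m[OF redwD(2)[OF z] this]
  show ?thesis unfolding diamond_def
  proof (rule exI[of _ z], rule exI[of _ "rev ss"], rule exI[of _ "rev ts"], intro conjI allI impI)
    fix hi assume "run (colours rho L) hi = Some kap" "ndb (z @ rev ss @ s # hi) = 1" "clen (z @ rev ss @ s # hi) \<le> k"
    then show "sim (z @ rev ss @ s # hi) (z @ rev ts @ t # hi)" using m'[of hi] by simp
  qed (fact r')+
qed

lemma diamond_sym: "diamond L s t \<Longrightarrow> good rho L \<Longrightarrow> desc rho L s \<Longrightarrow> desc rho L t \<Longrightarrow> diamond L t s"
proof -
  assume "diamond L s t" and d: "good rho L" "desc rho L s" "desc rho L t"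
  then obtain z a b where z: "redw rho (z @ a) (sstep L s)" "redw rho (z @ b) (sstep L t)" and
     m: "\<And>hi. run (colours rho L) hi = Some kap \<Longrightarrow> ndb (z @ a @ s # hi) = 1 \<Longrightarrow> clen (z @ a @ s # hi) \<le> k \<Longrightarrow>
        sim (z @ a @ s # hi) (z @ b @ t # hi)" unfolding diamond_def by blast
  have r: "redw rho ((z @ a) @ [s]) L" "redw rho ((z @ b) @ [t]) L"
    using redw.snoc[OF z(1) d(1,2)] redw.snoc[OF z(2) d(1,3)] by auto
  have "ndb ((z @ a) @ [s]) = ndb ((z @ b) @ [t])" "clen ((z @ a) @ [s]) = clen ((z @ b) @ [t])"
    using redw_ndb[OF r(1)] redw_ndb[OF r(2)] cox_clen[OF redw_cox[OF r(1)]] cox_clen[OF redw_cox[OF r(2)]]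
      redwD(4)[OF r(1)] redwD(4)[OF r(2)] by auto
  then have *: "ndb (z @ a @ s # hi) = ndb (z @ b @ t # hi)" "clen (z @ a @ s # hi) = clen (z @ b @ t # hi)" for hi
    by (simp_all split: if_splits)
  show ?thesis unfolding diamond_def
  proof (rule exI[of _ z], rule exI[of _ b], rule exI[of _ a], intro conjI allI impI)
    fix hi assume "run (colours rho L) hi = Some kap" "ndb (z @ b @ t # hi) = 1" "clen (z @ b @ t # hi) \<le> k"
    then show "sim (z @ b @ t # hi) (z @ a @ s # hi)" by (intro sim_sym[OF m]) (simp_all only: *)
  qed (fact z)+
qed

lemma diamond_comm:
  assumes g: "good rho L" and d: "desc rho L s" "desc rho L t" and c: "supp s \<inter> supp t = {}"
  shows "diamond L s t"
proof (rule diamondI[OF g, of _ "[t]" _ "[s]"])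
  have x: "sstep (sstep L s) t = sstep (sstep L t) s \<and> desc rho (sstep L s) t \<and> desc rho (sstep L t) s"
    using d c by (cases s; cases t; auto simp: fun_eq_iff sw_def origin_def)
  then show "desc_chain rho L [s, t]" "desc_chain rho L [t, s]" "srun L [s, t] = srun L [t, s]" using d by auto
  fix z S hi assume a: "run rho z = Some S" "run S (rev [t] @ [s]) = Some (colours rho L)"
    "run S (rev [s] @ [t]) = Some (colours rho L)" "run (colours rho L) hi = Some kap"
  then show "sim (z @ (rev [t] @ [s]) @ hi) (z @ (rev [s] @ [t]) @ hi)"
    using sim_comm[OF a(1), of t s hi] c by (auto split: if_splits)
qed

lemma diamond_braid:
  assumes g: "good rho L" and d: "desc rho L (Cr j)" "desc rho L (Cr (Suc j))"
  shows "diamond L (Cr j) (Cr (Suc j))"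
proof (rule diamondI[OF g, of _ "[Cr (Suc j), Cr j]" _ "[Cr j, Cr (Suc j)]"])
  show "desc_chain rho L [Cr j, Cr (Suc j), Cr j]" "desc_chain rho L [Cr (Suc j), Cr j, Cr (Suc j)]"
    using d by (auto simp: sw_def)
  show "srun L [Cr j, Cr (Suc j), Cr j] = srun L [Cr (Suc j), Cr j, Cr (Suc j)]"
    by (auto simp: fun_eq_iff sw_def)
  fix z S hi assume a: "run rho z = Some S" "run S (rev [Cr (Suc j), Cr j] @ [Cr j]) = Some (colours rho L)"
    "run S (rev [Cr j, Cr (Suc j)] @ [Cr (Suc j)]) = Some (colours rho L)" "run (colours rho L) hi = Some kap"
    "ndb (z @ rev [Cr (Suc j), Cr j] @ [Cr j] @ hi) = 1" "clen (z @ rev [Cr (Suc j), Cr j] @ [Cr j] @ hi) \<le> k"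
  then show "sim (z @ (rev [Cr (Suc j), Cr j] @ [Cr j]) @ hi) (z @ (rev [Cr j, Cr (Suc j)] @ [Cr (Suc j)]) @ hi)"
    using sim_braid[OF a(1), of j "colours rho L" hi] by auto
qed

lemma diamond_nail:
  assumes g: "good rho L" and d: "desc rho L s" "desc rho L (Cr 0)" and s: "s = Nail \<or> s = DB"
  shows "diamond L s (Cr 0)"
proof -
  \<comment> \<open>\<open>h\<close> is the letter that negates the strand now at position 1 once
    that strand has been brought next to the blue one; its colour decides which letter this
    is.\<close>
  define h where "h = (if rho ! origin L 1 = Black then Nail else DB)"
  have ab: "L 0 < 0" "L 1 < L 0" "1 < length rho" using d s by auto
  \<comment> \<open>Two red strands are impossible: \<open>good\<close> would make the right label
    positive, whereas both labels are negative here.\<close>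
  have nr: "\<not> (rho ! origin L 0 = Red \<and> rho ! origin L 1 = Red)"
    using good_red[OF g, of 0 1] ab by auto
  have h: "h = Nail \<or> h = DB" by (auto simp: h_def)
  have st: "sstep M h = M(0 := - M 0)" "sstep M s = M(0 := - M 0)" for M using h s by auto
  have dh: "desc rho M h \<longleftrightarrow> 0 < length rho \<and> M 0 < 0 \<and> rho ! origin M 0 = rho ! origin L 1" for M
    unfolding h_def by (cases "rho ! origin L 1") auto
  have ds: "desc rho M s \<longleftrightarrow> 0 < length rho \<and> M 0 < 0 \<and> rho ! origin M 0 = rho ! origin L 0" for M
    using s d by auto
  have hs: "(s, h) \<in> {(Nail, Nail), (Nail, DB), (DB, Nail)}"
    using s d nr unfolding h_def by (auto; cases "rho ! origin L 1"; auto)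
  show ?thesis
  proof (rule diamondI[OF g, of _ "[Cr 0, h, Cr 0]" _ "[h, Cr 0, s]"])
    show "desc_chain rho L [s, Cr 0, h, Cr 0]"
      using ab by (simp add: st dh ds) (auto simp: sw_def origin_def)
    show "desc_chain rho L [Cr 0, h, Cr 0, s]"
      using ab by (simp add: st dh ds) (auto simp: sw_def origin_def)
    show "srun L [s, Cr 0, h, Cr 0] = srun L [Cr 0, h, Cr 0, s]"
      by (simp add: st) (auto simp: fun_eq_iff sw_def)
    fix z S hi assume a: "run rho z = Some S" "run S (rev [Cr 0, h, Cr 0] @ [s]) = Some (colours rho L)"
      "run S (rev [h, Cr 0, s] @ [Cr 0]) = Some (colours rho L)" "run (colours rho L) hi = Some kap"
    show "sim (z @ (rev [Cr 0, h, Cr 0] @ [s]) @ hi) (z @ (rev [h, Cr 0, s] @ [Cr 0]) @ hi)"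
      using sim_sym[OF sim_nail4[OF a(1) _ a(4) hs]] a by auto
  qed
qed

lemma diamond:
  assumes g: "good rho L" and d: "desc rho L s" "desc rho L t" and ne: "s \<noteq> t"
  shows "diamond L s t"
proof -
  have main: "diamond L s t \<or> diamond L t s"
  proof (cases "supp s \<inter> supp t = {}")
    case True then show ?thesis using diamond_comm[OF g d] by auto
  next
    case False
    then consider j where "s = Cr j" "t = Cr (Suc j)" | j where "t = Cr j" "s = Cr (Suc j)" |
      "s \<in> {Nail, DB}" "t = Cr 0" | "t \<in> {Nail, DB}" "s = Cr 0"
      using d ne by (cases s; cases t; auto)
    then show ?thesis
    proof cases
      case 1 then show ?thesis using diamond_braid[OF g] d by blast
    next
      case 2 then show ?thesis using diamond_braid[OF g] d by blast
    next
      case 3 then show ?thesis using diamond_nail[OF g d(1)] d(2) by blast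
    next
      case 4 then show ?thesis using diamond_nail[OF g d(2)] d(1) by blast
    qed
  qed
  then show ?thesis using diamond_sym g d by blast
qed

text \<open>Tits' argument by length. Equal top letters are absorbed into the continuation
  \<open>hi\<close>, leaving shorter words. Different top letters are bridged by the two words of
  \<open>diamond\<close>, each of which shares its last letter with one of the given words.\<close>

theorem matsumoto:
  "redw rho u L \<Longrightarrow> redw rho u' L \<Longrightarrow> run (colours rho L) hi = Some kap \<Longrightarrow> ndb (u @ hi) = 1 \<Longrightarrow>
   clen (u @ hi) \<le> k \<Longrightarrow> sim (u @ hi) (u' @ hi)"
proof (induction "length u" arbitrary: u u' L hi)
  case 0
  then show ?case using redwD(4)[OF 0(2)] redwD(4)[OF 0(3)] by auto
next
  case (Suc m)
  have lu: "length u = length u'" using redwD(4)[OF Suc(3)] redwD(4)[OF Suc(4)] by simp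
  from Suc(3,2) obtain v s where v: "u = v @ [s]" "redw rho v (sstep L s)" "good rho L" "desc rho L s"
    by (cases rule: redw.cases) auto
  from Suc(4,2) lu obtain v' s' where v': "u' = v' @ [s']" "redw rho v' (sstep L s')" "desc rho L s'"
    by (cases rule: redw.cases) auto
  have r1: "run (colours rho (sstep L s)) ([s] @ hi) = Some kap" if "desc rho L s" for s
    using desc_step[OF v(3) that] Suc(5) by auto
  have cn: "ndb w = ndb w' \<and> clen w = clen w'" if "redw rho w M" "redw rho w' M" for w w' M
    using redw_ndb[OF that(1)] redw_ndb[OF that(2)] cox_clen[OF redw_cox[OF that(1)]] cox_clen[OF redw_cox[OF that(2)]]
      redwD(4)[OF that(1)] redwD(4)[OF that(2)] by auto
  show ?case
  proof (cases "s = s'")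
    case True
    then show ?thesis using Suc(1)[of v "sstep L s" v' "[s] @ hi"] v v' r1 Suc(2,6,7) by auto
  next
    case False
    then obtain z a b where z: "redw rho (z @ a) (sstep L s)" "redw rho (z @ b) (sstep L s')" and
     mm: "ndb (z @ a @ s # hi) = 1 \<Longrightarrow> clen (z @ a @ s # hi) \<le> k \<Longrightarrow>
        sim (z @ a @ s # hi) (z @ b @ s' # hi)"
      using diamond[OF v(3,4) v'(3)] Suc(5) unfolding diamond_def by blast
    have 1: "sim (v @ [s] @ hi) ((z @ a) @ [s] @ hi)"
      using Suc(1)[of v "sstep L s" "z @ a" "[s] @ hi"] v z r1 Suc(2,6,7) by auto
    have 2: "sim ((z @ a) @ [s] @ hi) ((z @ b) @ [s'] @ hi)"
      using mm cn[OF v(2) z(1)] Suc(6,7) v(1) by auto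
    have 3: "sim (v' @ [s'] @ hi) ((z @ b) @ [s'] @ hi)"
    proof (rule Suc(1)[of v' "sstep L s'" "z @ b"])
      have "ndb (u @ hi) = ndb (u' @ hi)" "clen (u @ hi) = clen (u' @ hi)" using cn[OF Suc(3,4)] by auto
      then show "ndb (v' @ [s'] @ hi) = 1" "clen (v' @ [s'] @ hi) \<le> k" using Suc(6,7) v'(1) by auto
      show "m = length v'" using lu Suc(2) v'(1) by simp
    qed (use v' z r1 in auto)
    show ?thesis using 1 2 3 v(1) v'(1) by (simp add: sim_def)
  qed
qed

text \<open>Where a descent \<open>s\<close> is repeated after \<open>u1\<close>,
  \<open>matsumoto\<close> replaces \<open>u1\<close> by a reduced word ending in \<open>s\<close>.
  The resulting factor \<open>[s, s]\<close> is zero or a single dot, and the dot leaves a diagram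
  with two letters fewer.\<close>

lemma nonreduced:
  assumes r: "run rho (u @ hi) = Some kap" and c: "cox u" and n: "\<not> redw rho u (srun id_labels u)"
    and d: "ndb (u @ hi) = 1" "clen (u @ hi) \<le> k"
  shows "delta (rho, u @ hi) \<in> B"
proof -
  obtain t where "run rho u = Some t" using r by (auto simp: run_append split: option.splits)
  from redw_cases[OF this c] n obtain u1 s u2 where u: "u = u1 @ s # u2" "redw rho u1 (srun id_labels u1)"
     "desc rho (srun id_labels u1) s" by auto
  define L where "L = srun id_labels u1"
  have L: "redw rho u1 L" "desc rho L s" using u(2,3) by (simp_all add: L_def)
  have gL: "good rho L" using redwD(1)[OF L(1)] .
  from desc_step(1)[OF gL L(2)] redw_ex obtain z where z: "redw rho z (sstep L s)" by blast
  have zs: "redw rho (z @ [s]) L" using redw.snoc[OF z gL L(2)] .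
  let ?hi = "s # u2 @ hi"
  have rh: "run (colours rho L) ?hi = Some kap"
    using r redwD(2)[OF L(1)] unfolding u(1) by (simp add: run_append)
  have cn: "ndb (z @ [s]) = ndb u1" "clen (z @ [s]) = clen u1"
    using redw_ndb[OF zs] redw_ndb[OF L(1)] cox_clen[OF redw_cox[OF zs]] cox_clen[OF redw_cox[OF L(1)]]
      redwD(4)[OF zs] redwD(4)[OF L(1)] by auto
  have s: "sim (u1 @ ?hi) ((z @ [s]) @ ?hi)"
    using matsumoto[OF L(1) zs rh] d unfolding u(1) by simp
  obtain S T where rz: "run rho z = Some S" and vS: "valid S s" and T: "step S s = T" and
    rT: "valid T s" "run (step T s) (u2 @ hi) = Some kap"
    using redwD(2)[OF z] desc_step(2,3)[OF gL L(2)] rh by (simp split: if_splits)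
  have rss: "run S [s, s] = Some (step T s)" using vS T rT(1) by simp
  have nz: "ndb (z @ [s, s] @ u2 @ hi) = 1 + (if s = DB then 1 else 0)" "clen z + 2 + clen (u2 @ hi) \<le> k"
    if "is_cox s"
    using cn d u(1) that by (simp_all split: if_splits)
  have isc: "is_cox s" using L(2) by (cases s) simp_all
  have "delta (rho, z @ [s, s] @ (u2 @ hi)) \<in> B"
  proof (cases s)
    case (Cr j)
    have ST: "step T s = S" unfolding T[symmetric] Cr by (rule step_Cr_Cr) (use vS Cr in simp)
    have lw: "delta (rho, z @ [Dot i] @ (u2 @ hi)) \<in> B" if "valid S (Dot i)" for i
    proof (rule low)
      show "run rho (z @ [Dot i] @ u2 @ hi) = Some kap" using that rz rT(2) ST by (simp add: run_append)
      show "ndb (z @ [Dot i] @ u2 @ hi) = 1" using nz(1)[OF isc] Cr by simp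
      show "clen (z @ [Dot i] @ u2 @ hi) < k" using nz(2)[OF isc] by simp
    qed
    have rel: "sim (z @ [s, s] @ (u2 @ hi)) (z @ [Dot i] @ (u2 @ hi))"
      if "[(1::'k, [s, s]), (- 1, [Dot i])] \<in> rels S" "valid S (Dot i)" for i
      by (rule sim2[OF that(1) _ rz rss _ rT(2)]) (use that(2) ST in simp_all)
    have v: "Suc j < length S" "\<not> (S ! j = Red \<and> S ! Suc j = Red)" using vS Cr by simp_all
    consider "S ! j = Black" "S ! Suc j = Black" | "S ! j = Black" "S ! Suc j = Red"
      | "S ! j = Red" "S ! Suc j = Black"
      using v(2) by (cases "S ! j"; cases "S ! Suc j") simp_all
    then show ?thesis
    proof cases
      case 1
      then have "[(1::'k, [s, s])] \<in> rels S" using v(1) unfolding rels_def Cr by simp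
      from rel1[OF this rz rss rT(2)] show ?thesis .
    next
      case 2
      then have "[(1::'k, [s, s]), (- 1, [Dot j])] \<in> rels S" using v(1) unfolding rels_def Cr by simp
      from rel[OF this] lw[of j] 2 v(1) show ?thesis by (simp add: sim_def)
    next
      case 3
      then have "[(1::'k, [s, s]), (- 1, [Dot (Suc j)])] \<in> rels S" using v(1) unfolding rels_def Cr by simp
      from rel[OF this] lw[of "Suc j"] 3 v(1) show ?thesis by (simp add: sim_def)
    qed
  next
    case Nail
    then have "[(1::'k, [s, s])] \<in> rels S" using vS unfolding rels_def by simp
    from rel1[OF this rz rss rT(2)] show ?thesis .
  next
    case DB
    \<comment> \<open>\<open>z @ [DB]\<close> and \<open>u1\<close> contain equally many double
      braidings, so \<open>u1 @ [DB]\<close> would contain two; the case is void.\<close>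
    then show ?thesis using nz(1)[OF isc] cn(1) d(1) u(1) by simp
  qed (use isc in simp)
  then have "delta (rho, (z @ [s]) @ ?hi) \<in> B" by simp
  with s have "delta (rho, u1 @ ?hi) \<in> B" unfolding sim_def by blast
  with u(1) show ?thesis by simp
qed

section \<open>Moving dots to the top of a diagram\<close>

text \<open>Only black/black crossings leave a correction, in which the crossing is gone and which
  is thus lower. The witness \<open>i'\<close> is chosen before \<open>lo\<close> and
  \<open>hi\<close>, so that it does not depend on the surrounding diagram.\<close>

lemma dot_up1:
  assumes "valid t (Dot i)" "valid t s" "is_cox s"
  shows "\<exists>i'. valid (step t s) (Dot i') \<and> (\<forall>lo hi. run rho lo = Some t \<longrightarrow> run (step t s) hi = Some kap \<longrightarrow>
    ndb (lo @ s # hi) = 1 \<longrightarrow> clen (lo @ s # hi) \<le> k \<longrightarrow> sim (lo @ [Dot i, s] @ hi) (lo @ [s, Dot i'] @ hi))"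
proof -
  have far: ?thesis if "supp (Dot i) \<inter> supp s = {}"
  proof (intro exI conjI allI impI)
    show v: "valid (step t s) (Dot i)" using that assms by (cases s) (auto simp: nth_list_update)
    fix lo hi assume "run rho lo = Some t" "run (step t s) hi = Some kap"
    then show "sim (lo @ [Dot i, s] @ hi) (lo @ [s, Dot i] @ hi)"
      using sim_comm[of lo t "Dot i" s hi] that assms by auto
  qed
  have near: ?thesis if v: "valid (step t s) (Dot i')" and r: "[(1::'k, [Dot i, s]), (- 1, [s, Dot i'])] \<in> rels t" for i'
  proof (intro exI conjI allI impI)
    fix lo hi assume "run rho lo = Some t" "run (step t s) hi = Some kap"
    then show "sim (lo @ [Dot i, s] @ hi) (lo @ [s, Dot i'] @ hi)"
      using sim2[OF r, of lo "step t s" hi] assms v by auto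
  qed (rule v)
  show ?thesis
  proof (cases s)
    case (Cr j)
    consider "i \<noteq> j" "i \<noteq> Suc j" | "i = j" | "i = Suc j" by blast
    then show ?thesis
    proof cases
      case 1 then show ?thesis using far Cr by auto
    next
      case 2
      show ?thesis
      proof (cases "t ! Suc j")
        case Red
        with 2 Cr assms have "[(1::'k, [Dot i, s]), (- 1, [s, Dot (Suc j)])] \<in> rels t" unfolding rels_def by auto
        moreover have "valid (step t s) (Dot (Suc j))" using 2 Cr assms by auto
        ultimately show ?thesis by (rule near[rotated])
      next
        case Black
        then have r: "[(1::'k, [Dot j, Cr j]), (-1, [Cr j, Dot (Suc j)]), (-1, [])] \<in> rels t"
          using 2 Cr assms unfolding rels_def by auto
        have st: "step t s = t" using Black 2 Cr assms by (auto simp: nth_list_update intro!: nth_equalityI)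
        show ?thesis
        proof (intro exI[of _ "Suc j"] conjI allI impI)
          show v: "valid (step t s) (Dot (Suc j))" using 2 Cr assms by auto
          fix lo hi assume a: "run rho lo = Some t" "run (step t s) hi = Some kap" "ndb (lo @ s # hi) = 1" "clen (lo @ s # hi) \<le> k"
          have "delta (rho, lo @ [] @ hi) \<in> B" using a Cr st by (intro low) (auto simp: run_append)
          from sim3[OF r _ a(1) _ _ _ _ this, of t] show "sim (lo @ [Dot i, s] @ hi) (lo @ [s, Dot (Suc j)] @ hi)"
            using a Cr 2 st v assms by auto
        qed
      qed
    next
      case 3
      show ?thesis
      proof (cases "t ! j")
        case Red
        with 3 Cr assms have "[(1::'k, [Dot i, s]), (- 1, [s, Dot j])] \<in> rels t" unfolding rels_def by auto
        moreover have "valid (step t s) (Dot j)" using 3 Cr assms by auto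
        ultimately show ?thesis by (rule near[rotated])
      next
        case Black
        then have r: "[(1::'k, [Cr j, Dot j]), (-1, [Dot (Suc j), Cr j]), (-1, [])] \<in> rels t"
          using 3 Cr assms unfolding rels_def by auto
        have st: "step t s = t" using Black 3 Cr assms by (auto simp: nth_list_update intro!: nth_equalityI)
        show ?thesis
        proof (intro exI[of _ j] conjI allI impI)
          show v: "valid (step t s) (Dot j)" using 3 Cr assms by auto
          fix lo hi assume a: "run rho lo = Some t" "run (step t s) hi = Some kap" "ndb (lo @ s # hi) = 1" "clen (lo @ s # hi) \<le> k"
          have "delta (rho, lo @ [] @ hi) \<in> B" using a Cr st by (intro low) (auto simp: run_append)
          from sim_sym[OF sim3[OF r _ a(1) _ _ _ _ this, of t]] show "sim (lo @ [Dot i, s] @ hi) (lo @ [s, Dot j] @ hi)"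
            using a Cr 3 st v assms by auto
        qed
      qed
    qed
  next
    case Nail
    show ?thesis
    proof (cases "i = 0")
      case True
      with Nail assms have "[(1::'k, [Dot i, s]), (- 1, [s, Dot 0])] \<in> rels t" unfolding rels_def by auto
      moreover have "valid (step t s) (Dot 0)" using True Nail assms by auto
      ultimately show ?thesis by (rule near[rotated])
    qed (use far Nail in auto)
  next
    case DB
    \<comment> \<open>The strand at position 0 is red and carries no dot, so the dot is disjoint
      from the double braiding.\<close>
    then show ?thesis using far assms by (cases i) auto
  qed (use assms in auto)
qed

lemma dots_up:
  assumes "\<forall>d\<in>set D. \<not> is_cox d" "run t D = Some t" "valid t s" "is_cox s"
  shows "\<exists>D'. (\<forall>d\<in>set D'. \<not> is_cox d) \<and> run (step t s) D' = Some (step t s) \<and>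
    (\<forall>lo hi. run rho lo = Some t \<longrightarrow> run (step t s) hi = Some kap \<longrightarrow>
    ndb (lo @ s # hi) = 1 \<longrightarrow> clen (lo @ s # hi) \<le> k \<longrightarrow> sim (lo @ D @ s # hi) (lo @ s # D' @ hi))"
  using assms
proof (induction D rule: rev_induct)
  case Nil
  then show ?case by (intro exI[of _ "[]"]) auto
next
  case (snoc d D)
  then obtain i where d: "d = Dot i" by (cases d) auto
  obtain t' where "run t D = Some t'" using snoc by (auto simp: run_append split: option.splits)
  then have tD: "run t D = Some t" using run_dots[of D t t'] snoc by auto
  then have v: "valid t (Dot i)" using snoc d by (auto simp: run_append split: if_splits)
  from dot_up1[OF v snoc(4,5)] obtain i' where i': "valid (step t s) (Dot i')" and
    m: "\<And>lo hi. run rho lo = Some t \<Longrightarrow> run (step t s) hi = Some kap \<Longrightarrow>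
    ndb (lo @ s # hi) = 1 \<Longrightarrow> clen (lo @ s # hi) \<le> k \<Longrightarrow> sim (lo @ [Dot i, s] @ hi) (lo @ [s, Dot i'] @ hi)" by blast
  from snoc(1)[OF _ tD snoc(4,5)] snoc(2) obtain D' where D': "\<forall>d\<in>set D'. \<not> is_cox d" "run (step t s) D' = Some (step t s)"
    and m': "\<And>lo hi. run rho lo = Some t \<Longrightarrow> run (step t s) hi = Some kap \<Longrightarrow>
    ndb (lo @ s # hi) = 1 \<Longrightarrow> clen (lo @ s # hi) \<le> k \<Longrightarrow> sim (lo @ D @ s # hi) (lo @ s # D' @ hi)" by auto
  show ?case
  proof (intro exI[of _ "D' @ [Dot i']"] conjI allI impI)
    show "\<forall>d\<in>set (D' @ [Dot i']). \<not> is_cox d" "run (step t s) (D' @ [Dot i']) = Some (step t s)"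
      using D' i' by (auto simp: run_append)
    fix lo hi assume a: "run rho lo = Some t" "run (step t s) hi = Some kap" "ndb (lo @ s # hi) = 1" "clen (lo @ s # hi) \<le> k"
    note dc = dots_clen[OF D'(1)] dots_clen[of D] snoc(2)
    have "sim ((lo @ D) @ [Dot i, s] @ hi) ((lo @ D) @ [s, Dot i'] @ hi)"
      by (rule m) (use a tD dc in \<open>auto simp: run_append\<close>)
    also have "sim ((lo @ D) @ [s, Dot i'] @ hi) (lo @ s # D' @ ([Dot i'] @ hi))"
    proof -
      have "ndb (lo @ s # [Dot i'] @ hi) = ndb (lo @ s # hi)" "clen (lo @ s # [Dot i'] @ hi) = clen (lo @ s # hi)"
        by simp_all
      then have "sim (lo @ D @ s # [Dot i'] @ hi) (lo @ s # D' @ ([Dot i'] @ hi))"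
        by (intro m') (use a i' in simp_all)
      then show ?thesis by simp
    qed
    finally show "sim (lo @ (D @ [d]) @ s # hi) (lo @ s # (D' @ [Dot i']) @ hi)" using d by simp
  qed
qed

text \<open>Dots are not counted by \<open>clen\<close>, so any number of them may be passed while
  the bound \<open>k\<close> stays the same.\<close>

lemma separate_dots:
  assumes "run rho p = Some t"
  shows "\<exists>u D. cox u \<and> (\<forall>d\<in>set D. \<not> is_cox d) \<and> run rho u = Some t \<and> run t D = Some t \<and> ndb u = ndb p \<and> clen u = clen p \<and>
    (\<forall>hi. run t hi = Some kap \<longrightarrow> ndb (p @ hi) = 1 \<longrightarrow> clen (p @ hi) \<le> k \<longrightarrow> sim (p @ hi) (u @ D @ hi))"
  using assms
proof (induction p arbitrary: t rule: rev_induct)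
  case Nil
  show ?case
  proof (rule exI[of _ "[]"], rule exI[of _ "[]"], intro conjI allI impI)
    show "sim ([] @ hi) ([] @ [] @ hi)" for hi by simp
  qed (use Nil in auto)
next
  case (snoc s p)
  then obtain t' where t: "run rho p = Some t'" "valid t' s" "t = step t' s"
    by (auto simp: run_append split: option.splits if_splits)
  from snoc(1)[OF t(1)] obtain u D where u: "cox u" "\<forall>d\<in>set D. \<not> is_cox d" "run rho u = Some t'" "run t' D = Some t'"
     "ndb u = ndb p" "clen u = clen p" and
    m: "\<And>hi. run t' hi = Some kap \<Longrightarrow> ndb (p @ hi) = 1 \<Longrightarrow> clen (p @ hi) \<le> k \<Longrightarrow> sim (p @ hi) (u @ D @ hi)" by blast
  show ?case
  proof (cases "is_cox s")
    case False
    then obtain i where s: "s = Dot i" by (cases s) auto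
    show ?thesis
    proof (rule exI[of _ u], rule exI[of _ "D @ [s]"], intro conjI allI impI)
      fix hi assume "run t hi = Some kap" "ndb ((p @ [s]) @ hi) = 1" "clen ((p @ [s]) @ hi) \<le> k"
      then show "sim ((p @ [s]) @ hi) (u @ (D @ [s]) @ hi)" using m[of "s # hi"] t s by auto
    qed (use u s t in \<open>auto simp: run_append\<close>)
  next
    case True
    from dots_up[OF u(2,4) t(2) True] obtain D' where D': "\<forall>d\<in>set D'. \<not> is_cox d" "run t D' = Some t"
     and m': "\<And>lo hi. run rho lo = Some t' \<Longrightarrow> run t hi = Some kap \<Longrightarrow>
    ndb (lo @ s # hi) = 1 \<Longrightarrow> clen (lo @ s # hi) \<le> k \<Longrightarrow> sim (lo @ D @ s # hi) (lo @ s # D' @ hi)" using t(3) by blast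
    show ?thesis
    proof (rule exI[of _ "u @ [s]"], rule exI[of _ "D'"], intro conjI allI impI)
      fix hi assume a: "run t hi = Some kap" "ndb ((p @ [s]) @ hi) = 1" "clen ((p @ [s]) @ hi) \<le> k"
      have "sim (p @ (s # hi)) (u @ D @ (s # hi))" using m[of "s # hi"] t a by auto
      also have "sim (u @ D @ (s # hi)) (u @ s # D' @ hi)" using m'[OF u(3), of hi] a u by auto
      finally show "sim ((p @ [s]) @ hi) ((u @ [s]) @ D' @ hi)" by simp
    qed (use u D' t True True[unfolded is_cox_iff] in \<open>auto simp: run_append\<close>)
  qed
qed

text \<open>Dots on different strands commute, and dots on one strand are equal letters; so only the
  multiset of dots matters.\<close>

lemma dots_perm:
  assumes "\<forall>d\<in>set D. \<not> is_cox d" "run kap D = Some kap" "mset D = mset D'" "run rho u = Some kap"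
  shows "sim (u @ D) (u @ D')"
  using assms
proof (induction D arbitrary: D' u)
  case Nil then show ?case by simp
next
  case (Cons d D)
  then obtain i where d: "d = Dot i" by (cases d) auto
  have sD: "set D' = set (d # D)" using Cons(4) by (metis set_mset_mset)
  then obtain A C where D': "D' = A @ d # C" using split_list[of d D'] by auto
  have rv: "\<forall>d\<in>set D. \<exists>i. d = Dot i \<and> valid t d" if "\<forall>d\<in>set D. \<not> is_cox d" "run t D = Some t" for D t
    using that
  proof (induction D)
    case (Cons d D) then show ?case by (cases d) (auto split: if_splits)
  qed auto
  have rv': "run t D = Some t" if "\<forall>d\<in>set D. \<exists>i. d = Dot i \<and> valid t d" for D t
    using that by (induction D) auto
  have v: "\<forall>d\<in>set (d # D). \<exists>i. d = Dot i \<and> valid kap d" using rv[OF Cons(2,3)] .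
  have front: "sim (u @ A @ d # C) (u @ d # A @ C)" if "set A \<subseteq> set (d # D)" "set C \<subseteq> set (d # D)"
    using that
  proof (induction A arbitrary: C rule: rev_induct)
    case (snoc a A)
    then obtain j where a: "a = Dot j" "valid kap a" using v by auto
    have "sim ((u @ A) @ [a, d] @ C) ((u @ A) @ [d, a] @ C)"
    proof (cases "a = d")
      case False
      have rA: "run kap A = Some kap" by (rule rv') (use v snoc(2) in auto)
      have rC: "run kap C = Some kap" by (rule rv') (use v snoc(3) in auto)
      show ?thesis
      proof (rule sim_comm[of _ kap])
        show "run rho (u @ A) = Some kap" using Cons(5) rA by (simp add: run_append)
        show "valid kap a" "valid kap d" using a v by auto
        show "supp a \<inter> supp d = {}" using a d False by auto
        show "run (step (step kap a) d) C = Some kap" using a d rC by simp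
      qed
    qed simp
    also have "sim ((u @ A) @ [d, a] @ C) (u @ d # A @ a # C)"
      using snoc(1)[of "a # C"] snoc(2,3) by auto
    finally show ?case by simp
  qed simp
  have "sim ((u @ [d]) @ D) ((u @ [d]) @ (A @ C))"
  proof (rule Cons(1))
    show "\<forall>d\<in>set D. \<not> is_cox d" using Cons(2) by simp
    show "run kap D = Some kap" by (rule rv') (use v in auto)
    show "mset D = mset (A @ C)" using Cons(4) D' by simp
    show "run rho (u @ [d]) = Some kap" using Cons(5) v d by (simp add: run_append)
  qed
  moreover have "sim (u @ A @ d # C) (u @ d # A @ C)" by (rule front) (use sD D' in auto)
  ultimately show ?case using D' by (auto simp: sim_def)
qed

end

section \<open>Left-adjusted words\<close>

lemma wperm_append: "wperm (u @ v) = wperm u \<circ> wperm v"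
  by (induction u) (auto simp: o_assoc)

lemma words_append [simp]: "u @ v \<in> words n \<longleftrightarrow> u \<in> words n \<and> v \<in> words n"
  by (auto simp: words_def)

lemma words_Cons [simp]: "i # v \<in> words n \<longleftrightarrow> Suc i < n \<and> v \<in> words n"
  by (auto simp: words_def)

lemma words_Nil [simp]: "[] \<in> words n"
  by (simp add: words_def)

lemma words_filter: "v \<in> words n \<Longrightarrow> filter P v \<in> words n"
  by (auto simp: words_def)

lemma sw_comm: "Suc x < y \<Longrightarrow> sw y (sw x q) = sw x (sw y q)"
  by (auto simp: sw_def)

lemma sw_braid: "sw m (sw (Suc m) (sw m q)) = sw (Suc m) (sw m (sw (Suc m) q))"
  by (auto simp: sw_def)

lemma wperm_Cons_apply [simp]: "wperm (i # ws) q = sw i (wperm ws q)"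
  by simp

lemma wperm_append_apply [simp]: "wperm (u @ v) q = wperm u (wperm v q)"
  by (simp add: wperm_append)

declare wperm.simps(2) [simp del]

lemma wperm_comm_high: "\<forall>y\<in>set H. Suc x < y \<Longrightarrow> sw x (wperm H q) = wperm H (sw x q)"
  by (induction H) (auto simp: sw_comm[symmetric])

lemma wperm_comm_low: "\<forall>y\<in>set H. Suc y < x \<Longrightarrow> sw x (wperm H q) = wperm H (sw x q)"
  by (induction H) (auto simp: sw_comm)

text \<open>Letters below \<open>m\<close> and letters above \<open>Suc m\<close> differ by at least
  two, hence commute, and the high ones can be collected in front.\<close>

lemma wperm_split:
  "\<forall>x\<in>set v. x < m \<or> Suc m < x \<Longrightarrow>
    wperm v q = wperm (filter (\<lambda>x. Suc m < x) v) (wperm (filter (\<lambda>x. x < m) v) q)"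
proof (induction v)
  case (Cons x v)
  have "sw x (wperm (filter (\<lambda>x. Suc m < x) v) p) = wperm (filter (\<lambda>x. Suc m < x) v) (sw x p)" if "x < m" for p
    using that by (intro wperm_comm_high) auto
  with Cons show ?case by auto
qed simp

text \<open>Minimal length and minimal sum are local conditions: a factor may be replaced by any
  word for the same permutation, so none of these can beat it.\<close>

lemma left_adjusted_factor:
  assumes la: "left_adjusted n w (A @ F @ C)" and p: "wperm F' = wperm F" and F': "F' \<in> words n"
  shows "length F \<le> length F'"
    "length F' = length F \<Longrightarrow> sum_list F \<le> sum_list F'"
    "length F' = length F \<Longrightarrow> sum_list F = sum_list F' \<Longrightarrow> left_adjusted n w (A @ F' @ C)"
proof -
  have w: "A @ F' @ C \<in> words n" "wperm (A @ F' @ C) = w"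
    using la F' p by (auto simp: left_adjusted_def reduced_def wperm_append)
  with la show "length F \<le> length F'" unfolding left_adjusted_def reduced_def by fastforce
  assume l: "length F' = length F"
  have r: "reduced n w (A @ F' @ C)"
    using la w l unfolding left_adjusted_def reduced_def by auto
  with la show "sum_list F \<le> sum_list F'" unfolding left_adjusted_def by fastforce
  assume "sum_list F = sum_list F'"
  with la r show "left_adjusted n w (A @ F' @ C)" unfolding left_adjusted_def by auto
qed

text \<open>The crossings \<open>m v m\<close> either cancel or can be moved to the left by a braid relation.\<close>

lemma left_adjusted_no_factor:
  assumes "left_adjusted n w (A @ (m # v @ [m]) @ C)" "m \<notin> set v" "Suc m \<notin> set v"
  shows False
  using assms
proof (induction m arbitrary: A v C)
  case (0 A v C)
  then have "\<forall>x\<in>set v. Suc 0 < x" by (metis less_Suc0 linorder_neqE_nat not_less_eq)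
  then have "wperm (0 # v @ [0]) = wperm v"
    using wperm_comm_high[of v 0] by (simp add: fun_eq_iff)
  moreover have "v \<in> words n" using 0(1) by (auto simp: left_adjusted_def reduced_def)
  ultimately show ?case using left_adjusted_factor(1)[OF 0(1), of v] by simp
next
  case (Suc m' A v C)
  let ?m = "Suc m'"
  let ?H = "filter (\<lambda>x. Suc ?m < x) v" and ?L = "filter (\<lambda>x. x < ?m) v"
  have wv: "v \<in> words n" "Suc ?m < n" using Suc(2) by (auto simp: left_adjusted_def reduced_def)
  have sp: "\<forall>x\<in>set v. x < ?m \<or> Suc ?m < x" using Suc(3,4) by (metis linorder_neqE_nat not_less_eq)
  have origin: "sw ?m (wperm ?H q) = wperm ?H (sw ?m q)" for q by (rule wperm_comm_high) auto
  have p: "wperm (?H @ ?m # ?L @ [?m]) = wperm (?m # v @ [?m])"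
    by (simp add: fun_eq_iff origin wperm_split[OF sp])
  have len: "length ?H + length ?L = length v \<and> sum_list ?H + sum_list ?L = sum_list v"
    using sp by (induction v) auto
  \<comment> \<open>Once the letters above \<open>Suc ?m\<close> are moved to the front, only
    letters below \<open>?m\<close> remain between the two copies of \<open>?m\<close>.\<close>
  have "left_adjusted n w (A @ (?H @ ?m # ?L @ [?m]) @ C)"
    by (rule left_adjusted_factor(3)[OF Suc(2) p]) (use len wv words_filter in auto)
  then have la: "left_adjusted n w ((A @ ?H) @ (?m # ?L @ [?m]) @ C)" by simp
  show ?case
  proof (cases "m' \<in> set ?L")
    case False
    then have "\<forall>x\<in>set ?L. Suc x < ?m" by (auto simp: less_Suc_eq)
    then have "wperm (?m # ?L @ [?m]) = wperm ?L"
      using wperm_comm_low[of ?L ?m] by (simp add: fun_eq_iff)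
    then show False using left_adjusted_factor(1)[OF la, of ?L] wv words_filter by simp
  next
    case True
    then obtain P Q where PQ: "?L = P @ m' # Q" "m' \<notin> set Q" using split_list_last by metis
    have lt: "\<forall>x\<in>set P \<union> set Q. x < ?m"
    proof
      fix x assume "x \<in> set P \<union> set Q"
      then have "x \<in> set ?L" unfolding PQ(1) by auto
      then show "x < ?m" by auto
    qed
    show False
    proof (cases "m' \<in> set P")
      case True
      then obtain P1 P2 where P: "P = P1 @ m' # P2" "m' \<notin> set P2" using split_list_last by metis
      \<comment> \<open>Between two consecutive copies of \<open>m'\<close> there is neither
        \<open>m'\<close> nor \<open>?m\<close>, so the induction hypothesis applies to
        them.\<close>
      have "left_adjusted n w ((A @ ?H @ ?m # P1) @ (m' # P2 @ [m']) @ (Q @ ?m # C))"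
        using la PQ(1) P(1) by simp
      moreover have "?m \<notin> set P2" using lt P(1) by auto
      ultimately show False using Suc(1) P(2) by blast
    next
      case False
      have l: "\<forall>x\<in>set P. Suc x < ?m" "\<forall>x\<in>set Q. Suc x < ?m"
        using lt False PQ(2) by (metis Suc_less_eq UnCI less_antisym)+
      \<comment> \<open>With a single \<open>m'\<close> the letters \<open>?m m' ?m\<close> can be
        brought together. Replacing them by \<open>m' ?m m'\<close> keeps the length and lowers the
        sum by one.\<close>
      have e: "wperm (P @ [m', ?m, m'] @ Q) = wperm (?m # ?L @ [?m])"
        unfolding PQ(1) using wperm_comm_low[OF l(1)] wperm_comm_low[OF l(2), symmetric]
        by (simp add: fun_eq_iff sw_braid)
      have "?L \<in> words n" using wv words_filter by blast
      then have "P @ [m', ?m, m'] @ Q \<in> words n" using wv unfolding PQ(1) by simp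
      from left_adjusted_factor(2)[OF la e this] show False unfolding PQ(1) by simp
    qed
  qed
qed

section \<open>Trajectories of strands in a diagram\<close>

text \<open>Letters act on positions by involutions, so folding from the top letter down leads from
  the top position \<open>t\<close> of a strand to its bottom position.\<close>

abbreviation fpos :: "gen list \<Rightarrow> nat \<Rightarrow> nat" where
  "fpos gs t \<equiv> foldr mvg gs t"

lemma mvg_mvg [simp]: "mvg g (mvg g q) = q"
  by (cases g) auto

lemma bij_mvg: "bij (mvg g)"
  by (rule o_bij[of "mvg g"]) (simp_all add: fun_eq_iff)

lemma bij_fpos: "bij (fpos gs)"
proof (induction gs)
  case (Cons g gs)
  from bij_comp[OF this bij_mvg] show ?case by (simp add: comp_def)
qed (simp add: bij_id[unfolded id_def])

lemma origin_srun: "origin (srun L gs) t = origin L (fpos gs t)"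
proof (induction gs arbitrary: L)
  case (Cons g gs)
  then show ?case by (cases g) (auto simp: origin_def)
qed simp

text \<open>One letter reverses the order of two strands only if they cross each other, and then the
  right one moves left.\<close>

lemma mvg_less: "x < y \<Longrightarrow> y \<le> mvg g y \<Longrightarrow> mvg g x < mvg g y"
  by (cases g) (auto simp: sw_def split: if_splits)

lemma fpos_drop: "i < length gs \<Longrightarrow> fpos (drop i gs) t = mvg (gs ! i) (fpos (drop (Suc i) gs) t)"
  by (simp add: Cons_nth_drop_Suc[symmetric])

lemma traj_ne: "traj xs t \<noteq> []"
  by (cases xs) simp_all

lemma traj_snoc: "traj (xs @ [g]) t = traj xs t @ [mvg g (last (traj xs t))]"
  by (induction xs arbitrary: t) (simp_all add: traj_ne)

lemma rtraj_Nil [simp]: "rtraj [] t = [t]"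
  by (simp add: rtraj_def)

lemma rtraj_ne: "rtraj gs t \<noteq> []"
  by (simp add: rtraj_def traj_ne)

lemma rtraj_Cons: "rtraj (g # gs) t = mvg g (hd (rtraj gs t)) # rtraj gs t"
  using rtraj_ne[of gs t] by (simp add: rtraj_def traj_snoc hd_rev)

lemma hd_rtraj [simp]: "hd (rtraj gs t) = fpos gs t"
  by (induction gs) (auto simp: rtraj_Cons)

lemma length_rtraj [simp]: "length (rtraj gs t) = Suc (length gs)"
  by (induction gs) (auto simp: rtraj_Cons)

lemma rtraj_nth: "h \<le> length gs \<Longrightarrow> rtraj gs t ! h = fpos (drop h gs) t"
  by (induction gs arbitrary: h) (auto simp: rtraj_Cons nth_Cons split: nat.split)

lemma rtraj_append_set: "set (rtraj (xs @ ys) t) = set (rtraj xs (fpos ys t)) \<union> set (rtraj ys t)"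
proof (induction xs)
  case Nil
  have "fpos ys t \<in> set (rtraj ys t)" using rtraj_ne hd_rtraj hd_in_set by metis
  then show ?case by auto
qed (auto simp: rtraj_Cons)

lemma upt_split2:
  assumes "i < i'" "i' < k"
  shows "[0..<k] = [0..<i] @ i # [Suc i..<i'] @ i' # [Suc i'..<k]"
proof -
  have "[0..<k] = [0..<i'] @ [i'..<k]" using upt_add_eq_append[of 0 i' "k - i'"] assms by simp
  also have "[i'..<k] = i' # [Suc i'..<k]" using assms by (simp add: upt_conv_Cons)
  also have "[0..<i'] = [0..<i] @ [i..<i']" using upt_add_eq_append[of 0 i "i' - i"] assms by simp
  also have "[i..<i'] = i # [Suc i..<i']" using assms by (simp add: upt_conv_Cons)
  finally show ?thesis by simp
qed

lemma sw_inc: "q < sw j q \<Longrightarrow> sw j q = Suc j"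
  by (simp add: sw_def split: if_splits)

lemma sw_dec: "sw j q < q \<Longrightarrow> q = Suc j"
  by (simp add: sw_def split: if_splits)

lemma sw_fix:
  assumes "sw j q = q"
  shows "j \<noteq> q \<and> Suc j \<noteq> q"
proof
  show "j \<noteq> q" using assms by (metis n_not_Suc_n sw_def)
  show "Suc j \<noteq> q" using assms by (metis n_not_Suc_n sw_def)
qed

text \<open>In a left-adjusted diagram no strand moves to the right before it moves to the left, so at
its leftmost position it has to its left only strands that it never crosses.\<close>

lemma left_adjusted_Min:
  assumes la: "left_adjusted n w ws"
  defines "gs \<equiv> word_diag ws"
  shows "Min (set (rtraj gs t)) \<le> card {u. u < t \<and> fpos gs u < fpos gs t}"
proof -
  define k where "k = length gs"
  \<comment> \<open>\<open>U i s\<close> is the position at height \<open>i\<close> of the strand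
    that ends at top position \<open>s\<close>. Below, \<open>?R i\<close> and \<open>?L i\<close>
    say that letter \<open>i\<close> moves the strand of \<open>t\<close> to the right or to the
    left.\<close>
  define U where "U i s = fpos (drop i gs) s" for i s
  have gsn: "gs ! i = Cr (rev ws ! i)" if "i < k" for i
    using that unfolding k_def gs_def word_diag_def by (simp del: rev_map)
  have kw: "k = length ws" by (simp add: k_def gs_def word_diag_def)
  have Ui: "U i s = mvg (gs ! i) (U (Suc i) s)" "U (Suc i) s = mvg (gs ! i) (U i s)" if "i < k" for i s
    using that fpos_drop[of i gs s] unfolding U_def k_def by auto
  let ?R = "\<lambda>i. i < k \<and> U i t < U (Suc i) t" and ?L = "\<lambda>i. i < k \<and> U (Suc i) t < U i t"
  have nobad: False if bad: "?R i0" "?L i1" "i0 < i1" for i0 i1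
  proof -
    let ?Q = "\<lambda>i'. ?L i' \<and> (\<exists>i<i'. ?R i)"
    \<comment> \<open>The lowest left move with a right move below it is paired with the last such
      right move. In between the strand rests at \<open>Suc j\<close>, and both moves are the
      crossing \<open>j\<close>: this is the factor excluded by
      \<open>left_adjusted_no_factor\<close>.\<close>
    define i' where "i' = (LEAST i'. ?Q i')"
    have Q: "?Q i'" unfolding i'_def by (rule LeastI[of ?Q i1]) (use bad in auto)
    define S where "S = {i. i < i' \<and> ?R i}"
    have S: "finite S" "S \<noteq> {}" using Q by (auto simp: S_def)
    define i where "i = Max S"
    have i: "i < i'" "?R i" using Max_in[OF S] by (auto simp: S_def i_def)
    have noL: "\<not> ?L m" if "i < m" "m < i'" for m
      using not_less_Least[of m ?Q] that i unfolding i'_def[symmetric] by blast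
    have noR: "\<not> ?R m" if "i < m" "m < i'" for m
      using Max_ge[OF S(1), of m] that unfolding i_def[symmetric] by (auto simp: S_def)
    have i'k: "i' < k" using Q by auto
    have const: "U m t = U (Suc i) t" if "i < m" "m \<le> i'" for m
      using that
    proof (induction m)
      case (Suc m)
      show ?case
      proof (cases "i < m")
        case True
        then have "U (Suc m) t = U m t" using noL[of m] noR[of m] Suc i'k by auto
        with Suc True show ?thesis by auto
      qed (use Suc in \<open>auto simp: less_Suc_eq\<close>)
    qed simp
    define j where "j = rev ws ! i"
    have Us: "U (Suc m) t = sw (rev ws ! m) (U m t)" if "m < k" for m
      using Ui(2)[OF that, of t] gsn[OF that] by simp
    have "U (Suc i) t = Suc j"
    proof -
      have "U (Suc i) t = sw j (U i t)" using Us[of i] i(2) unfolding j_def by blast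
      moreover have "U i t < U (Suc i) t" using i(2) by blast
      ultimately show ?thesis using sw_inc[of "U i t" j] by metis
    qed
    then have Uj: "U m t = Suc j" if "i < m" "m \<le> i'" for m using const[OF that] by simp
    have jj: "rev ws ! i' = j"
    proof -
      have "U (Suc i') t < U i' t" using Q by blast
      then have "U i' t = Suc (rev ws ! i')" unfolding Us[OF i'k] by (rule sw_dec)
      with Uj[of i'] i(1) show ?thesis by simp
    qed
    have btw: "rev ws ! m \<noteq> j \<and> rev ws ! m \<noteq> Suc j" if m: "i < m" "m < i'" for m
    proof -
      have "U (Suc m) t = Suc j" "U m t = Suc j" using Uj m by simp_all
      with Us[of m] m i'k have "sw (rev ws ! m) (Suc j) = Suc j" by (metis order.strict_trans)
      from sw_fix[OF this] show ?thesis by simp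
    qed
    define V where "V = map (\<lambda>m. rev ws ! m) [Suc i..<i']"
    have len: "length (rev ws) = k" by (simp add: kw)
    define X where "X = map ((!) (rev ws)) [0..<i]"
    define Y where "Y = map ((!) (rev ws)) [Suc i'..<k]"
    have ii: "rev ws ! i = j" "rev ws ! i' = j" using jj by (simp_all add: j_def)
    have "map ((!) (rev ws)) [0..<k] = X @ j # V @ j # Y"
      unfolding V_def X_def Y_def by (subst upt_split2[of i i' k]) (use i i'k ii in auto)
    then have "rev ws = X @ j # V @ j # Y" using map_nth[of "rev ws"] len by metis
    from arg_cong[OF this, of rev] have "ws = rev Y @ (j # rev V @ [j]) @ rev X" by simp
    moreover have "j \<notin> set (rev V)" "Suc j \<notin> set (rev V)" using btw unfolding V_def by (fastforce simp: Suc_le_eq)+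
    ultimately show False using left_adjusted_no_factor la by metis
  qed
  \<comment> \<open>The turning point: no right move below it and no left move above it. A strand
    that never moves right is leftmost at the top, whence the default \<open>k\<close>.\<close>
  define h where "h = (if \<exists>i. ?R i then LEAST i. ?R i else k)"
  have hR: "\<not> ?R i" if "i < h" for i
    using that not_less_Least[of i ?R] unfolding h_def by (auto split: if_splits)
  have hk: "h \<le> k" unfolding h_def using LeastI_ex[of ?R] by (auto intro: less_imp_le)
  have hL: "\<not> ?L i" if "h \<le> i" for i
  proof
    assume L: "?L i"
    then have "h < k" using that by auto
    then have "?R h" unfolding h_def using LeastI_ex[of ?R] by (auto split: if_splits)
    then show False using nobad[of h i] L that by (cases "h = i") auto
  qed
  have up: "U i s < U i t" if s: "U h s < U h t" and i: "h \<le> i" "i \<le> k" for i s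
    using i
  proof (induction i)
    case (Suc i)
    show ?case
    proof (cases "h \<le> i")
      case True
      then have "U i s < U i t" "U i t \<le> U (Suc i) t" using Suc hL[of i] by auto
      then show ?thesis using mvg_less[of "U i s" "U i t" "gs ! i"] Ui(2)[of i] Suc by auto
    qed (use Suc s in \<open>auto simp: le_Suc_eq\<close>)
  qed (use s in auto)
  have down: "U i s < U i t" if s: "U h s < U h t" and i: "i \<le> h" for i s
    using i
  proof (induction rule: inc_induct)
    case (step i)
    then have "U (Suc i) s < U (Suc i) t" "U (Suc i) t \<le> U i t" using hR[of i] hk by auto
    then show ?case using mvg_less[of "U (Suc i) s" "U (Suc i) t" "gs ! i"] Ui(1)[of i] step hk by auto
  qed (use s in auto)
  \<comment> \<open>Away from height \<open>h\<close>, upwards as well as downwards, the strand of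
    \<open>t\<close> never moves left. By \<open>mvg_less\<close> everything to its left at
    \<open>h\<close> stays there up to both ends.\<close>
  have sub: "{s. U h s < U h t} \<subseteq> {u. u < t \<and> fpos gs u < fpos gs t}"
    using up[of _ k] down[of _ 0] hk by (auto simp: U_def k_def)
  have "bij (U h)" unfolding U_def by (rule bij_fpos)
  then have inj: "inj_on (U h) A" and surj: "\<exists>s. q = U h s" for A q
    unfolding bij_def by (auto simp: surj_def intro: inj_on_subset)
  have "U h ` {s. U h s < U h t} = {..<U h t}"
  proof (intro equalityI subsetI)
    fix q assume "q \<in> {..<U h t}"
    then show "q \<in> U h ` {s. U h s < U h t}" using surj[of q] by auto
  qed auto
  with card_image[OF inj, of "{s. U h s < U h t}"]
  have "U h t = card {s. U h s < U h t}" by simp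
  also have "\<dots> \<le> card {u. u < t \<and> fpos gs u < fpos gs t}"
    by (rule card_mono[OF _ sub]) auto
  finally have "U h t \<le> card {u. u < t \<and> fpos gs u < fpos gs t}" .
  moreover have "U h t \<in> set (rtraj gs t)"
    using rtraj_nth[of h gs t] hk nth_mem[of h "rtraj gs t"] unfolding U_def k_def by auto
  then have "Min (set (rtraj gs t)) \<le> U h t" by simp
  ultimately show ?thesis by simp
qed

lemma sw_eq_iff [simp]: "sw j x = sw j q \<longleftrightarrow> x = q"
  by (metis sw_sw)

section \<open>The basis diagrams are reduced\<close>

text \<open>Only pairs with right member \<open>t\<close> change: strands on the left with label of
  smaller absolute value must now be crossed twice instead of not at all. If there are
  \<open>p\<close> of them, the gain is the length of \<open>pull g p\<close>.\<close>

lemma slen_neg: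
  assumes t: "t < n" "0 < L t" and inj: "\<And>i. i \<noteq> t \<Longrightarrow> \<bar>L i\<bar> \<noteq> \<bar>L t\<bar>"
  shows "slen n (L(t := - L t)) = slen n L + 2 * card {u. u < t \<and> \<bar>L u\<bar> < \<bar>L t\<bar>} + 1"
proof -
  let ?P = "{(i, k). i < k \<and> k < n}" and ?M = "L(t := - L t)"
  let ?C = "{u. u < t \<and> \<bar>L u\<bar> < \<bar>L t\<bar>}"
  let ?e = "\<lambda>x. if snd x = t \<and> \<bar>L (fst x)\<bar> < \<bar>L t\<bar> then 2 else (0::nat)"
  have "(\<Sum>(i, k)\<in>?P. pair_len (?M i) (?M k)) = (\<Sum>x\<in>?P. (case x of (i, k) \<Rightarrow> pair_len (L i) (L k)) + ?e x)"
  proof (rule sum.cong[OF refl], clarify)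
    fix i k :: nat assume ik: "i < k"
    show "pair_len (?M i) (?M k) = pair_len (L i) (L k) + ?e (i, k)"
    proof (cases "k = t")
      case True
      with ik inj[of i] have "\<bar>L i\<bar> \<noteq> \<bar>L t\<bar>" "i \<noteq> t" by auto
      then show ?thesis using True t(2) by (simp add: pair_len_def)
    next
      case False
      then show ?thesis by (cases "i = t") (simp_all add: pair_len_def)
    qed
  qed
  also have "\<dots> = (\<Sum>(i, k)\<in>?P. pair_len (L i) (L k)) + (\<Sum>x\<in>?P. ?e x)"
    by (rule sum.distrib)
  also have "(\<Sum>x\<in>?P. ?e x) = (\<Sum>x\<in>{x\<in>?P. snd x = t \<and> \<bar>L (fst x)\<bar> < \<bar>L t\<bar>}. 2)"
    by (rule sum.inter_filter[symmetric]) (rule finite_prs)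
  also have "{x\<in>?P. snd x = t \<and> \<bar>L (fst x)\<bar> < \<bar>L t\<bar>} = (\<lambda>u. (u, t)) ` ?C"
    using t by auto
  also have "(\<Sum>x\<in>(\<lambda>u. (u, t)) ` ?C. 2) = 2 * card ?C"
    by (subst sum.reindex) (auto simp: inj_on_def)
  finally have 1: "(\<Sum>(i, k)\<in>?P. pair_len (?M i) (?M k)) = (\<Sum>(i, k)\<in>?P. pair_len (L i) (L k)) + 2 * card ?C" .
  have "(\<Sum>q<n. if ?M q < 0 then 1 else 0) = Suc (\<Sum>q<n. if L q < 0 then 1 else 0)"
    using t by (subst (1 2) sum.remove[of _ t]) auto
  with 1 show ?thesis unfolding slen_def by simp
qed

lemma pull_0: "pull g 0 = [g]"
  by (simp add: pull_def)

lemma pull_Suc: "pull g (Suc p) = Cr p # pull g p @ [Cr p]"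
  by (simp add: pull_def)

lemma srun_pull: "g \<in> {Nail, DB} \<Longrightarrow> srun M (pull g p) = M(p := - M p)"
proof (induction p arbitrary: M)
  case 0 then show ?case by (auto simp: pull_0)
next
  case (Suc p)
  then show ?case by (auto simp: pull_Suc fun_eq_iff sw_def)
qed

lemma fpos_pull: "g \<in> {Nail, DB} \<Longrightarrow> fpos (pull g p) q = q"
  by (induction p arbitrary: q) (auto simp: pull_0 pull_Suc)

lemma length_pull: "length (pull g p) = 2 * p + 1"
  by (simp add: pull_def)

lemma run_pull:
  assumes "p < length s"
    "g = Nail \<and> s ! p = Black \<or> g = DB \<and> s ! p = Red \<and> (\<forall>i<p. s ! i = Black)"
  shows "run s (pull g p) = Some s"
  using assms
proof (induction p arbitrary: s)
  case 0 then show ?case by (auto simp: pull_0)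
next
  case (Suc p)
  let ?s = "step s (Cr p)"
  have "run ?s (pull g p) = Some ?s" by (rule Suc(1)) (use Suc(2,3) in auto)
  moreover have "valid s (Cr p)" "valid ?s (Cr p)" using Suc(2,3) by (auto simp: nth_list_update)
  moreover have "step ?s (Cr p) = s" by (rule step_Cr_Cr[OF Suc(2)])
  ultimately show ?case by (simp add: pull_Suc run_append)
qed

text \<open>A sign travels with its strand, so an insertion at any height amounts to a sign change
  at the top.\<close>

lemma srun_neg:
  "srun (M(fpos ds t := - M (fpos ds t))) ds = (srun M ds)(t := - srun M ds t)"
proof (induction ds arbitrary: M)
  case (Cons d ds)
  have *: "sstep (M(mvg d q := - M (mvg d q))) d = (sstep M d)(q := - sstep M d q)" for q
    by (cases d) (auto simp: fun_eq_iff)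
  show ?case unfolding foldl_Cons foldr_Cons comp_apply * by (rule Cons)
qed simp

lemma ins_leftE:
  obtains h where "h \<le> length gs" "fpos (drop h gs) t = Min (set (rtraj gs t))"
    "ins_left g t gs = take h gs @ pull g (Min (set (rtraj gs t))) @ drop h gs"
proof -
  let ?tr = "rtraj gs t"
  let ?p = "Min (set ?tr)"
  have "?p \<in> set ?tr" using rtraj_ne[of gs t] by (intro Min_in) auto
  then obtain k where k: "k < length ?tr" "?tr ! k = ?p" by (auto simp: in_set_conv_nth)
  define h where "h = (LEAST h. ?tr ! h = ?p)"
  have "?tr ! h = ?p" unfolding h_def by (rule LeastI[of _ k]) (rule k(2))
  moreover have "h \<le> k" unfolding h_def by (rule Least_le) (rule k(2))
  ultimately show thesis
    using that[of h] k(1) rtraj_nth[of h gs t] by (simp add: ins_left_def Let_def h_def)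
qed

lemma fpos_dots: "\<forall>d\<in>set D. \<not> is_cox d \<Longrightarrow> fpos D t = t"
proof (induction D)
  case (Cons d D) then show ?case by (cases d) auto
qed simp

lemma rtraj_dots: "\<forall>d\<in>set D. \<not> is_cox d \<Longrightarrow> rtraj (gs @ D) t = rtraj gs t @ replicate (length D) t"
proof (induction gs)
  case Nil
  then show ?case
  proof (induction D)
    case (Cons d D)
    then show ?case using fpos_dots[of "d # D" t] by (cases d) (auto simp: rtraj_Cons)
  qed simp
next
  case (Cons g gs)
  then show ?case by (simp add: rtraj_Cons fpos_dots rtraj_ne hd_append)
qed

text \<open>\<open>xel\<close> inserts the double braiding after the dots have been added. Dots only
  append copies of the end point to a trajectory, so neither its minimum nor the first height where
  it is attained changes.\<close>

lemma ins_left_dots: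
  assumes "\<forall>d\<in>set D. \<not> is_cox d"
  shows "ins_left g t (gs @ D) = ins_left g t gs @ D"
proof -
  let ?tr = "rtraj gs t"
  let ?p = "Min (set ?tr)"
  have "\<exists>xs. ?tr = xs @ [t]" by (induction gs) (auto simp: rtraj_Cons)
  then have "t \<in> set ?tr" by auto
  then have s: "set (rtraj (gs @ D) t) = set ?tr" by (auto simp: rtraj_dots[OF assms])
  have "?p \<in> set ?tr" using rtraj_ne[of gs t] by (intro Min_in) auto
  then obtain k where k: "k < length ?tr" "?tr ! k = ?p" by (auto simp: in_set_conv_nth)
  let ?h = "LEAST h. ?tr ! h = ?p"
  have h: "?tr ! ?h = ?p" "?h \<le> k" using LeastI[of "\<lambda>h. ?tr ! h = ?p" k] Least_le[of "\<lambda>h. ?tr ! h = ?p" k] k by auto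
  have "(LEAST h. rtraj (gs @ D) t ! h = ?p) = ?h"
  proof (rule Least_equality)
    show "rtraj (gs @ D) t ! ?h = ?p" using h k by (simp add: rtraj_dots[OF assms] nth_append)
    fix y assume "rtraj (gs @ D) t ! y = ?p"
    then show "?h \<le> y"
      using h k Least_le[of "\<lambda>h. ?tr ! h = ?p" y] by (cases "y < length ?tr") (auto simp: rtraj_dots[OF assms] nth_append)
  qed
  then show ?thesis using s h k by (simp add: ins_left_def Let_def)
qed

text \<open>The insertion costs two letters per unit of leftmost position plus one, and
  \<open>slen\<close> grows by twice the cardinality in \<open>m\<close> plus one, so
  \<open>m\<close> preserves \<open>len\<close>. The last two conclusions keep \<open>m\<close>
  available for later insertions: end points stay and trajectories only gain positions.\<close>

lemma ins_left_step:
  assumes run: "run rho gs = Some kap" and cox: "cox gs" and t: "t < length rho" and pos: "0 < srun id_labels gs t"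
    and col: "g = Nail \<and> kap ! t = Black \<or> g = DB \<and> kap ! t = Red \<and> (\<forall>i<t. kap ! i = Black)"
    and m: "Min (set (rtraj gs t)) \<le> card {u. u < t \<and> fpos gs u < fpos gs t}"
    and len: "length gs \<le> slen (length rho) (srun id_labels gs)"
  defines "gs' \<equiv> ins_left g t gs"
  shows "run rho gs' = Some kap" "cox gs'" "srun id_labels gs' = (srun id_labels gs)(t := - srun id_labels gs t)"
    "length gs' \<le> slen (length rho) (srun id_labels gs')" "fpos gs' = fpos gs"
    "set (rtraj gs s) \<subseteq> set (rtraj gs' s)"
proof -
  define p where "p = Min (set (rtraj gs t))"
  obtain h where h: "h \<le> length gs" "fpos (drop h gs) t = p" "gs' = take h gs @ pull g p @ drop h gs"
    unfolding gs'_def p_def by (rule ins_leftE)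
  have gs: "gs = take h gs @ drop h gs" by simp
  have g: "g \<in> {Nail, DB}" using col by auto
  let ?L1 = "srun id_labels (take h gs)" and ?L = "srun id_labels gs"
  have L: "?L = srun ?L1 (drop h gs)" by (metis foldl_append append_take_drop_id)
  obtain S where S: "run rho (take h gs) = Some S" "run S (drop h gs) = Some kap"
    using run by (subst (asm) gs, subst (asm) run_append) (auto split: option.splits)
  have g1: "good rho ?L1" "S = colours rho ?L1" using run_good[OF S(1)] by auto
  have g2: "good rho ?L" "kap = colours rho ?L" using run_good[OF run] by auto
  have pmL: "origin ?L s = origin ?L1 (fpos (drop h gs) s)" for s unfolding L by (rule origin_srun)
  have perm1: "origin ?L1 permutes {..<length rho}" and perm2: "origin ?L permutes {..<length rho}"
    using g1 g2 unfolding good_def by blast+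
  have pn: "p < length rho"
    using permutes_in_image[OF perm2, of t] permutes_in_image[OF perm1, of p] pmL[of t] h(2) t by simp
  have Sp: "S ! p = kap ! t" using pn t pmL[of t] h(2) g1 g2 by simp
  \<comment> \<open>Red strands keep their order, so a red strand left of \<open>p\<close> at height
    \<open>h\<close> would end to the left of \<open>t\<close>, where all strands are black.\<close>
  have Sq: "S ! q = Black" if q: "q < p" and gd: "g = DB" for q
  proof (rule ccontr)
    assume "S ! q \<noteq> Black"
    then have red: "rho ! origin ?L1 q = Red" using q pn g1 by (cases "S ! q") auto
    have redp: "rho ! origin ?L1 p = Red" using col gd Sp pn g1 by auto
    obtain s where s: "origin ?L s = origin ?L1 q" using permutes_surj[OF perm2] by (metis surjD)
    have sn: "s < length rho" using permutes_in_image[OF perm2, of s] permutes_in_image[OF perm1, of q] s q pn by simp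
    have lt: "origin ?L s < origin ?L t" using good_red[OF g1(1) q pn red redp] s pmL[of t] h(2) by simp
    have rs: "rho ! origin ?L s = Red" "rho ! origin ?L t = Red" using red redp s pmL[of t] h(2) by auto
    have "\<not> t < s" using good_red[OF g2(1) _ sn rs(2,1)] lt by auto
    moreover have "kap ! s = Red" using rs sn g2 by simp
    then have "\<not> s < t" using col gd by auto
    ultimately show False using lt by auto
  qed
  have "run S (pull g p) = Some S"
    by (rule run_pull) (use pn g1 col Sp Sq in auto)
  then show "run rho gs' = Some kap" using S unfolding h(3) by (simp add: run_append)
  have "set (take h gs) \<subseteq> set gs" "set (drop h gs) \<subseteq> set gs" by (rule set_take_subset, rule set_drop_subset)
  moreover have "cox (pull g p)" using g by (auto simp: pull_def)
  ultimately show "cox gs'" using cox unfolding h(3) set_append by blast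
  have "srun id_labels gs' = srun (?L1(p := - ?L1 p)) (drop h gs)"
    unfolding h(3) by (simp add: srun_pull[OF g])
  also have "\<dots> = ?L(t := - ?L t)"
    unfolding L using srun_neg[of ?L1 "drop h gs" t] h(2) by simp
  finally show sr: "srun id_labels gs' = ?L(t := - ?L t)" .
  have "\<bar>?L u\<bar> = int (fpos gs u) + 1" for u
    using good_abs[OF g2(1), of u] origin_srun[of id_labels gs u] by simp
  then have ab: "{u. u < t \<and> \<bar>?L u\<bar> < \<bar>?L t\<bar>} = {u. u < t \<and> fpos gs u < fpos gs t}" by auto
  have "slen (length rho) (srun id_labels gs') = slen (length rho) ?L + 2 * card {u. u < t \<and> \<bar>?L u\<bar> < \<bar>?L t\<bar>} + 1"
    unfolding sr using good_abs_inj[OF g2(1)] by (intro slen_neg t pos) blast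
  moreover have "length gs' = length gs + (2 * p + 1)"
    unfolding h(3) using h(1) by (simp add: length_pull)
  ultimately show "length gs' \<le> slen (length rho) (srun id_labels gs')"
    using len m unfolding p_def[symmetric] ab by simp
  show "fpos gs' = fpos gs"
  proof
    fix q
    have "fpos gs' q = fpos (take h gs) (fpos (drop h gs) q)" unfolding h(3) using fpos_pull[OF g] by simp
    also have "\<dots> = fpos (take h gs @ drop h gs) q" by (simp del: append_take_drop_id)
    finally show "fpos gs' q = fpos gs q" by simp
  qed
  have "set (rtraj (take h gs @ drop h gs) s) \<subseteq> set (rtraj gs' s)"
    unfolding h(3) rtraj_append_set using fpos_pull[OF g] by (auto simp del: append_take_drop_id)
  then show "set (rtraj gs s) \<subseteq> set (rtraj gs' s)" by simp
qed

lemma word_diag_Cons: "word_diag (i # ws) = word_diag ws @ [Cr i]"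
  by (simp add: word_diag_def)

lemma word_diag_Nil [simp]: "word_diag [] = []"
  by (simp add: word_diag_def)

lemma fpos_word_diag: "fpos (word_diag ws) (wperm ws q) = q"
  by (induction ws) (auto simp: word_diag_Cons)

lemma bij_wperm: "bij (wperm ws)"
proof (induction ws)
  case (Cons i ws)
  from bij_comp[OF this bij_sw[of i]] show ?case by (simp add: wperm.simps(2) comp_def)
qed (simp add: bij_id[unfolded id_def])

lemma fpos_word_diag_inv: "fpos (word_diag ws) = inv_into UNIV (wperm ws)"
proof
  fix t
  obtain q where "t = wperm ws q" using bij_wperm[of ws] by (metis bij_pointE)
  then show "fpos (word_diag ws) t = inv_into UNIV (wperm ws) t"
    by (simp add: fpos_word_diag inv_f_f bij_is_inj bij_wperm)
qed

lemma srun_word_diag: "srun id_labels (word_diag ws) t = int (fpos (word_diag ws) t) + 1"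
proof -
  have "srun L (word_diag ws) = L \<circ> fpos (word_diag ws)" for L
    by (induction ws arbitrary: L) (auto simp: word_diag_Cons fun_eq_iff)
  then show ?thesis by (simp add: id_labels_def)
qed

lemma redw_pos: "redw rho z L \<Longrightarrow> \<forall>q. 0 < L q \<Longrightarrow> \<exists>ws\<in>words (length rho). z = word_diag ws"
proof (induction rule: redw.induct)
  case Nil then show ?case by (intro bexI[of _ "[]"]) auto
next
  case (snoc u L s)
  have "\<not> L 0 < 0" using spec[OF snoc.prems, of 0] by linarith
  with snoc.hyps obtain j where j: "s = Cr j" "Suc j < length rho" by (cases s) auto
  then obtain ws where "ws \<in> words (length rho)" "u = word_diag ws" using snoc by auto
  with j show ?case by (intro bexI[of _ "j # ws"]) (auto simp: word_diag_Cons)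
qed

text \<open>\<open>reduced\<close> minimises over all words for \<open>w\<close>. A
  \<open>redw\<close> word for positive labels consists of crossings only, so it is one of the
  competitors.\<close>

lemma reduced_length_le:
  assumes r: "reduced (length rho) w ws" and g: "good rho L" "\<forall>q. 0 < L q" "origin L = inv_into UNIV w"
  shows "length ws \<le> slen (length rho) L"
proof -
  obtain z where z: "redw rho z L" using redw_ex g by blast
  then obtain ws' where ws': "ws' \<in> words (length rho)" "z = word_diag ws'" using redw_pos g by blast
  have "inv_into UNIV (wperm ws') = inv_into UNIV w"
  proof
    fix t show "inv_into UNIV (wperm ws') t = inv_into UNIV w t"
      using origin_srun[of id_labels z t] redwD(3)[OF z] g ws' fpos_word_diag_inv[of ws'] by simp
  qed
  moreover have "bij w" "bij (wperm ws')" using r bij_wperm unfolding reduced_def by auto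
  ultimately have "wperm ws' = w" by (metis inv_inv_eq)
  then have "length ws \<le> length ws'" using r ws' unfolding reduced_def by blast
  also have "\<dots> = slen (length rho) L" using redwD(4)[OF z] ws' by (simp add: word_diag_def)
  finally show ?thesis .
qed

lemma srun_word_diag_inj: "i \<noteq> j \<Longrightarrow> \<bar>srun id_labels (word_diag ws) i\<bar> \<noteq> \<bar>srun id_labels (word_diag ws) j\<bar>"
  using bij_is_inj[OF bij_fpos[of "word_diag ws"]] by (auto simp: srun_word_diag inj_eq)

lemma slen_word_diag_le: "ws \<in> words n \<Longrightarrow> slen n (srun id_labels (word_diag ws)) \<le> length ws"
proof (induction ws)
  case (Cons i ws)
  let ?M = "srun id_labels (word_diag ws)"
  have i: "Suc i < n" using Cons by simp
  have ne: "\<bar>?M i\<bar> \<noteq> \<bar>?M (Suc i)\<bar>" by (rule srun_word_diag_inj) simp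
  have "slen n (?M \<circ> sw i) \<le> Suc (slen n ?M)"
  proof (cases "?M (Suc i) < ?M i")
    case True
    then show ?thesis using slen_swap[OF i ne] by simp
  next
    case False
    with ne have "(?M \<circ> sw i) (Suc i) < (?M \<circ> sw i) i" by (auto simp: sw_def)
    moreover have "\<bar>(?M \<circ> sw i) i\<bar> \<noteq> \<bar>(?M \<circ> sw i) (Suc i)\<bar>" using ne by (auto simp: sw_def)
    ultimately show ?thesis using slen_swap[OF i, of "?M \<circ> sw i"] by (simp add: o_assoc[symmetric])
  qed
  with Cons show ?case by (simp add: word_diag_Cons comp_def)
qed simp

text \<open>In contrast to \<open>redw_if_short\<close>, composability is a conclusion here; this is
  what \<open>Sperm\<close> asks of every reduced expression.\<close>

lemma redw_word_diag:
  "ws \<in> words (length rho) \<Longrightarrow> good rho (srun id_labels (word_diag ws)) \<Longrightarrow>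
    length ws \<le> slen (length rho) (srun id_labels (word_diag ws)) \<Longrightarrow> redw rho (word_diag ws) (srun id_labels (word_diag ws))"
proof (induction ws)
  case Nil then show ?case by (simp add: redw.Nil)
next
  case (Cons i ws)
  let ?M = "srun id_labels (word_diag ws)" and ?L = "srun id_labels (word_diag (i # ws))"
  have i: "Suc i < length rho" "ws \<in> words (length rho)" using Cons(2) by simp_all
  have L: "?L = ?M \<circ> sw i" by (simp add: word_diag_Cons comp_def)
  have M: "sstep ?L (Cr i) = ?M" unfolding L by (simp add: fun_eq_iff)
  have le: "slen (length rho) ?M \<le> length ws" by (rule slen_word_diag_le[OF i(2)])
  have d: "desc rho ?L (Cr i)"
  proof (rule ccontr)
    assume nd: "\<not> desc rho ?L (Cr i)"
    have ne: "\<bar>?M i\<bar> \<noteq> \<bar>?M (Suc i)\<bar>" by (rule srun_word_diag_inj) simp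
    have "?M (Suc i) < ?M i" using nd i ne unfolding L by (auto simp: sw_def)
    from slen_swap[OF i(1) ne this] show False using le Cons(4)[unfolded L] by (simp add: comp_def)
  qed
  from desc_step(1,4)[OF Cons(3) d] have "good rho ?M" "slen (length rho) ?L = Suc (slen (length rho) ?M)"
    unfolding M by simp_all
  with Cons i have "redw rho (word_diag ws) ?M" by simp
  then have "redw rho (word_diag ws) (sstep ?L (Cr i))" unfolding M .
  from redw.snoc[OF this Cons(3) d] show ?case by (simp only: word_diag_Cons)
qed

section \<open>The signed permutations of the basis diagrams\<close>

lemma bpos_props:
  assumes "i < length (filter (\<lambda>j. kap ! j = Black) [0..<length kap])"
  shows "bpos kap i < length kap" "kap ! bpos kap i = Black"
  using nth_mem[OF assms] unfolding bpos_def by auto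

lemma bpos_inj:
  assumes "i < length (filter (\<lambda>j. kap ! j = Black) [0..<length kap])"
    "k < length (filter (\<lambda>j. kap ! j = Black) [0..<length kap])" "bpos kap i = bpos kap k"
  shows "i = k"
  using assms nth_eq_iff_index_eq[of "filter (\<lambda>j. kap ! j = Black) [0..<length kap]" i k] unfolding bpos_def by simp

lemma bpos_surj:
  assumes "j < length kap" "kap ! j = Black"
  shows "\<exists>i < length (filter (\<lambda>j. kap ! j = Black) [0..<length kap]). j = bpos kap i"
proof -
  have "j \<in> set (filter (\<lambda>j. kap ! j = Black) [0..<length kap])" using assms by simp
  then show ?thesis unfolding bpos_def in_set_conv_nth by metis
qed

lemma rpos_props:
  assumes "j < length kap" "kap ! j = Red"
  shows "rpos kap < length kap" "kap ! rpos kap = Red" "rpos kap \<le> j"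
proof -
  let ?xs = "filter (\<lambda>j. kap ! j = Red) [0..<length kap]"
  have j: "j \<in> set ?xs" using assms by simp
  have ne: "?xs \<noteq> []" using length_pos_if_in_set[OF j] by (rule length_greater_0_conv[THEN iffD1])
  show "rpos kap < length kap" "kap ! rpos kap = Red"
    using hd_in_set[OF ne] unfolding rpos_def by auto
  have "sorted ?xs" by (rule sorted_wrt_filter) simp
  then show "rpos kap \<le> j" using j ne unfolding rpos_def by (cases ?xs) auto
qed

definition negated :: "color list \<Rightarrow> nat \<Rightarrow> nat list \<Rightarrow> nat \<Rightarrow> bool" where
  "negated kap b l t \<longleftrightarrow> t = rpos kap \<or> (\<exists>i<b. l ! i = 1 \<and> t = bpos kap i)"

definition basis_labels :: "color list \<Rightarrow> nat \<Rightarrow> (nat \<Rightarrow> nat) \<Rightarrow> nat list \<Rightarrow> nat \<Rightarrow> int" where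
  "basis_labels kap b w l t = (if negated kap b l t then - 1 else 1) * (int (inv_into UNIV w t) + 1)"

text \<open>The undotted part of \<open>xel\<close>; by \<open>ins_left_dots\<close> the double
  braiding may be inserted before the dots.\<close>

definition basis_word :: "nat \<Rightarrow> ((nat \<Rightarrow> nat) \<Rightarrow> nat list) \<Rightarrow> color list \<Rightarrow> (nat \<Rightarrow> nat) \<Rightarrow> nat list \<Rightarrow> gen list" where
  "basis_word b ch kap w l = ins_left DB (rpos kap)
     (foldl (\<lambda>gs i. if l ! i = 1 then ins_left Nail (bpos kap i) gs else gs) (word_diag (ch w)) [0..<b])"

definition basis_dots :: "nat \<Rightarrow> color list \<Rightarrow> nat list \<Rightarrow> gen list" where
  "basis_dots b kap a = concat (map (\<lambda>i. replicate (a ! i) (Dot (bpos kap i))) [0..<b])"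

lemma basis_dots_dots: "\<forall>d\<in>set (basis_dots b kap a). \<not> is_cox d"
  by (auto simp: basis_dots_def)

lemma xel_eq: "xel b ch kap rho (w, l, a) = (rho, basis_word b ch kap w l @ basis_dots b kap a)"
  using ins_left_dots[OF basis_dots_dots] by (simp add: xel_def basis_word_def Let_def basis_dots_def)

locale basis_setting =
  fixes rho kap :: "color list" and b :: nat and ch :: "(nat \<Rightarrow> nat) \<Rightarrow> nat list"
  assumes len: "length kap = length rho"
    and nb: "length (filter (\<lambda>j. kap ! j = Black) [0..<length kap]) = b"
    and red: "\<exists>j<length kap. kap ! j = Red"
    and la: "w \<in> Sperm kap rho \<Longrightarrow> left_adjusted (length rho) w (ch w)"
begin

text \<open>The length is controlled insertion by insertion. \<open>left_adjusted_Min\<close> bounds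
  leftmost positions in the permutation diagram, and the bound survives the nails because
  trajectories only grow.\<close>

lemma basis_word_redw:
  assumes w: "w \<in> Sperm kap rho"
  shows "redw rho (basis_word b ch kap w l) (basis_labels kap b w l)"
proof -
  let ?d0 = "word_diag (ch w)"
  let ?F = "\<lambda>k. foldl (\<lambda>gs i. if l ! i = 1 then ins_left Nail (bpos kap i) gs else gs) ?d0 [0..<k]"
  let ?S = "\<lambda>k t. (if \<exists>i<k. l ! i = 1 \<and> t = bpos kap i then - 1 else 1) * (int (inv_into UNIV w t) + 1)"
  have rd: "reduced (length rho) w (ch w)" using la[OF w] by (simp add: left_adjusted_def)
  then have wp: "wperm (ch w) = w" by (simp add: reduced_def)
  have run0: "run rho ?d0 = Some kap" using w rd unfolding Sperm_def by blast
  have f0: "fpos ?d0 = inv_into UNIV w" using fpos_word_diag_inv[of "ch w"] wp by simp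
  have s0: "srun id_labels ?d0 t = int (inv_into UNIV w t) + 1" for t unfolding srun_word_diag f0 ..
  have g0: "good rho (srun id_labels ?d0)" using run_good[OF run0] by simp
  have l0: "length ?d0 \<le> slen (length rho) (srun id_labels ?d0)"
  proof -
    have "length (ch w) \<le> slen (length rho) (srun id_labels ?d0)"
      by (rule reduced_length_le[OF rd g0]) (use s0 in \<open>auto simp: origin_def fun_eq_iff\<close>)
    then show ?thesis by (simp add: word_diag_def)
  qed
  have mn: "Min (set (rtraj gs t)) \<le> card {u. u < t \<and> fpos gs u < fpos gs t}"
    if "fpos gs = fpos ?d0" "set (rtraj ?d0 t) \<subseteq> set (rtraj gs t)" for gs t
  proof -
    have "Min (set (rtraj gs t)) \<le> Min (set (rtraj ?d0 t))"
      by (rule Min_antimono[OF that(2)]) (use rtraj_ne in auto)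
    also have "\<dots> \<le> card {u. u < t \<and> fpos ?d0 u < fpos ?d0 t}" by (rule left_adjusted_Min[OF la[OF w]])
    finally show ?thesis unfolding that(1) .
  qed
  \<comment> \<open>In \<open>?F k\<close> the first \<open>k\<close> black strands have been
    treated. End points and trajectories belong to the invariant because \<open>mn\<close> needs
    them for the next insertion.\<close>
  have main: "run rho (?F k) = Some kap \<and> cox (?F k) \<and> (\<forall>t. srun id_labels (?F k) t = ?S k t) \<and>
      length (?F k) \<le> slen (length rho) (srun id_labels (?F k)) \<and> fpos (?F k) = fpos ?d0 \<and>
      (\<forall>t. set (rtraj ?d0 t) \<subseteq> set (rtraj (?F k) t))" if "k \<le> b" for k
    using that
  proof (induction k)
    case 0
    have F: "?F 0 = ?d0" by simp
    have "cox ?d0" by (auto simp: word_diag_def)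
    moreover have "srun id_labels ?d0 t = ?S 0 t" for t unfolding s0 by simp
    ultimately show ?case unfolding F using run0 l0 by blast
  next
    case (Suc k)
    have IH: "run rho (?F k) = Some kap" "cox (?F k)" "\<And>t. srun id_labels (?F k) t = ?S k t"
      "length (?F k) \<le> slen (length rho) (srun id_labels (?F k))" "fpos (?F k) = fpos ?d0"
      "\<And>t. set (rtraj ?d0 t) \<subseteq> set (rtraj (?F k) t)"
      using Suc.IH Suc_leD[OF Suc.prems] by blast+
    have kb: "k < length (filter (\<lambda>j. kap ! j = Black) [0..<length kap])" using Suc nb by simp
    note bp = bpos_props[OF kb]
    have fresh: "\<not> (\<exists>i<k. l ! i = 1 \<and> bpos kap k = bpos kap i)"
      using bpos_inj[OF kb] kb by (metis less_trans nat_neq_iff)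
    show ?case
    proof (cases "l ! k = 1")
      case True
      then have F: "?F (Suc k) = ins_left Nail (bpos kap k) (?F k)" by simp
      have p: "0 < srun id_labels (?F k) (bpos kap k)" unfolding IH(3) using fresh by simp
      have c: "Nail = Nail \<and> kap ! bpos kap k = Black \<or> Nail = DB \<and> kap ! bpos kap k = Red \<and> (\<forall>i<bpos kap k. kap ! i = Black)"
        using bp by simp
      have t: "bpos kap k < length rho" using bp len by simp
      note st = ins_left_step[OF IH(1,2) t p c mn[OF IH(5,6)] IH(4)]
      have S: "srun id_labels (?F (Suc k)) t = ?S (Suc k) t" for t
        unfolding F st(3) fun_upd_apply IH(3) using fresh True by (auto simp: less_Suc_eq)
      have T: "set (rtraj ?d0 t) \<subseteq> set (rtraj (?F (Suc k)) t)" for t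
        unfolding F using IH(6)[of t] st(6)[of t] by (rule subset_trans)
      have "fpos (?F (Suc k)) = fpos ?d0" unfolding F st(5) by (rule IH(5))
      with S T st(1,2,4)[folded F] show ?thesis by (intro conjI allI)
    next
      case False
      then have F: "?F (Suc k) = ?F k" by simp
      have "(\<exists>i<Suc k. l ! i = 1 \<and> t = bpos kap i) \<longleftrightarrow> (\<exists>i<k. l ! i = 1 \<and> t = bpos kap i)" for t
        using False less_Suc_eq by blast
      then have "srun id_labels (?F (Suc k)) t = ?S (Suc k) t" for t
        unfolding F IH(3) by simp
      with IH(1,2,4-6)[folded F] show ?thesis by (intro conjI allI)
    qed
  qed
  note M = main[OF le_refl]
  have MS: "srun id_labels (?F b) t = ?S b t" for t using M by blast
  obtain j where j: "j < length kap" "kap ! j = Red" using red by blast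
  note rp = rpos_props[OF j]
  have rb: "\<forall>i<rpos kap. kap ! i = Black"
  proof (intro allI impI)
    fix i assume "i < rpos kap"
    then show "kap ! i = Black" using rpos_props(1,3)[of i kap] rp(1) by (cases "kap ! i") auto
  qed
  have nr: "\<not> (\<exists>i<b. l ! i = 1 \<and> rpos kap = bpos kap i)"
    using bpos_props(2)[of _ kap] nb rp(2) by (metis color.distinct(1))
  have p: "0 < srun id_labels (?F b) (rpos kap)" unfolding MS using nr by simp
  have t: "rpos kap < length rho" using rp len by simp
  have c: "DB = Nail \<and> kap ! rpos kap = Black \<or> DB = DB \<and> kap ! rpos kap = Red \<and> (\<forall>i<rpos kap. kap ! i = Black)"
    using rp rb by simp
  have M': "run rho (?F b) = Some kap" "cox (?F b)" "length (?F b) \<le> slen (length rho) (srun id_labels (?F b))"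
     "fpos (?F b) = fpos ?d0" "set (rtraj ?d0 (rpos kap)) \<subseteq> set (rtraj (?F b) (rpos kap))" using M by blast+
  note st = ins_left_step[OF M'(1,2) t p c mn[OF M'(4,5)] M'(3)]
  have "srun id_labels (basis_word b ch kap w l) = basis_labels kap b w l"
  proof
    fix t show "srun id_labels (basis_word b ch kap w l) t = basis_labels kap b w l t"
      unfolding basis_word_def st(3) fun_upd_apply MS basis_labels_def negated_def using nr by auto
  qed
  then show ?thesis using redw_if_short[OF st(1,2,4)] unfolding basis_word_def by simp
qed

text \<open>Signs are forgotten: \<open>P\<close> has the same strands with positive labels. A
  shortest word for its permutation is short enough to be \<open>redw\<close>, hence composes and
  ends in the right colours.\<close>

lemma Sperm_inv:
  assumes g: "good rho L" and k: "colours rho L = kap"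
  shows "inv_into UNIV (origin L) \<in> Sperm kap rho"
proof -
  let ?w = "inv_into UNIV (origin L)"
  have p: "origin L permutes {..<length rho}" using g by (simp add: good_def)
  have ii: "inv_into UNIV ?w = origin L" by (rule inv_inv_eq[OF permutes_bij[OF p]])
  define P where "P t = int (origin L t) + 1" for t
  have pmP: "origin P = origin L" by (auto simp: origin_def P_def)
  have gP: "good rho P" using g unfolding good_def pmP by (auto simp: P_def)
  have kP: "colours rho P = kap" using k by (simp add: colours_def pmP)
  have "run rho (word_diag ws) = Some kap" if r: "reduced (length rho) ?w ws" for ws
  proof -
    have sP: "srun id_labels (word_diag ws) = P"
    proof
      have "wperm ws = ?w" using r unfolding reduced_def by blast
      then have "fpos (word_diag ws) = origin L" unfolding fpos_word_diag_inv by (simp only: ii)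
      then show "srun id_labels (word_diag ws) t = P t" for t unfolding srun_word_diag P_def by (rule arg_cong)
    qed
    have le: "length ws \<le> slen (length rho) P"
      by (rule reduced_length_le[OF r gP]) (auto simp: pmP ii, simp add: P_def)
    have "redw rho (word_diag ws) P" using redw_word_diag[of ws rho] r gP le sP unfolding reduced_def by simp
    then show ?thesis using redwD(2) kP by metis
  qed
  then show ?thesis unfolding Sperm_def using permutes_inv[OF p] len by simp
qed

text \<open>\<open>good\<close> makes every red label after the first positive, so
  \<open>neg_reds rho L = 1\<close> forces the first red strand to be the negative one. The signs of
  the black strands are a free choice of nails.\<close>

lemma good_is_basis_labels:
  assumes g: "good rho L" and k: "colours rho L = kap" and n: "neg_reds rho L = 1"
  obtains l where "length l = b" "set l \<subseteq> {0, 1}" "L = basis_labels kap b (inv_into UNIV (origin L)) l"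
proof
  define l where "l = map (\<lambda>i. if L (bpos kap i) < 0 then 1 else (0::nat)) [0..<b]"
  show "length l = b" "set l \<subseteq> {0, 1}" by (auto simp: l_def)
  have p: "origin L permutes {..<length rho}" using g by (simp add: good_def)
  have ii: "inv_into UNIV (inv_into UNIV (origin L)) = origin L" by (rule inv_inv_eq[OF permutes_bij[OF p]])
  have col: "rho ! origin L t = kap ! t" if "t < length rho" for t using k that colours_nth by metis
  obtain j where j: "j < length kap" "kap ! j = Red" using red by blast
  note rp = rpos_props[OF j]
  have pos: "0 < L t" if "t < length rho" "kap ! t = Red" "t \<noteq> rpos kap" for t
    using good_red[OF g, of "rpos kap" t] rpos_props[of t kap] that col len by auto
  have neg: "L (rpos kap) < 0"
  proof (rule ccontr)
    assume c: "\<not> L (rpos kap) < 0"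
    have "neg_reds rho L = 0" unfolding neg_reds_def
    proof (rule sum.neutral, rule ballI)
      fix q assume q: "q \<in> {..<length rho}"
      show "(if L q < 0 \<and> rho ! origin L q = Red then 1 else 0) = (0::nat)"
        using pos[of q] q c col[of q] by (cases "q = rpos kap") auto
    qed
    then show False using n by simp
  qed
  have sg: "L t < 0 \<longleftrightarrow> negated kap b l t" for t
  proof
    assume t: "L t < 0"
    have tn: "t < length rho" using t g unfolding good_def by (metis not_le order.asym)
    show "negated kap b l t"
    proof (cases "kap ! t")
      case Red then show ?thesis using pos[OF tn Red] t unfolding negated_def by force
    next
      case Black
      then obtain i where "i < b" "t = bpos kap i" using bpos_surj[of t kap] tn len nb by auto
      then show ?thesis using t unfolding negated_def l_def by auto
    qed
  next
    assume "negated kap b l t"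
    then show "L t < 0" using neg unfolding negated_def l_def by (auto split: if_splits)
  qed
  show "L = basis_labels kap b (inv_into UNIV (origin L)) l"
  proof
    fix t
    have "\<bar>L t\<bar> = int (origin L t) + 1" by (rule good_abs[OF g])
    then show "L t = basis_labels kap b (inv_into UNIV (origin L)) l t"
      unfolding basis_labels_def ii using sg[of t] by auto
  qed
qed

end

section \<open>Spanning\<close>

lemma lcomb_sum:
  assumes "finite A" "{i. c i \<noteq> 0} \<subseteq> A"
  shows "lcomb c x p = (\<Sum>i\<in>A. c i * x i p)"
  unfolding lcomb_def by (rule sum.mono_neutral_left) (use assms in auto)

lemma relN_diff: "f \<in> relN \<Longrightarrow> g \<in> relN \<Longrightarrow> (\<lambda>p. f p - g p) \<in> relN"
  using relN.add[OF _ relN.smult[of g "- 1"], of f] by simp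

definition spanned :: "'i set \<Rightarrow> ('i \<Rightarrow> path \<Rightarrow> 'k::comm_ring_1) \<Rightarrow> (path \<Rightarrow> 'k) set" where
  "spanned I x = {f. \<exists>c. finite {i. c i \<noteq> 0} \<and> {i. c i \<noteq> 0} \<subseteq> I \<and> (\<lambda>p. f p - lcomb c x p) \<in> relN}"

lemma spannedI:
  "finite A \<Longrightarrow> A \<subseteq> I \<Longrightarrow> {i. c i \<noteq> 0} \<subseteq> A \<Longrightarrow> (\<lambda>p. f p - lcomb c x p) \<in> relN \<Longrightarrow> f \<in> spanned I x"
  unfolding spanned_def using finite_subset by blast

lemma spanned_rel: "f \<in> relN \<Longrightarrow> f \<in> spanned I x"
  by (rule spannedI[of "{}" _ "\<lambda>_. 0"]) (auto simp: lcomb_def)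

lemma spanned_add:
  assumes "f \<in> spanned I x" "g \<in> spanned I x"
  shows "(\<lambda>p. f p + g p) \<in> spanned I x"
proof -
  obtain c where c: "finite {i. c i \<noteq> 0}" "{i. c i \<noteq> 0} \<subseteq> I" "(\<lambda>p. f p - lcomb c x p) \<in> relN"
    using assms(1) unfolding spanned_def by blast
  obtain d where d: "finite {i. d i \<noteq> 0}" "{i. d i \<noteq> 0} \<subseteq> I" "(\<lambda>p. g p - lcomb d x p) \<in> relN"
    using assms(2) unfolding spanned_def by blast
  let ?A = "{i. c i \<noteq> 0} \<union> {i. d i \<noteq> 0}"
  have "lcomb (\<lambda>i. c i + d i) x p = lcomb c x p + lcomb d x p" for p
    using c(1) d(1) by (subst (1 2 3) lcomb_sum[of ?A]) (auto simp: sum.distrib algebra_simps)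
  with relN.add[OF c(3) d(3)] have "(\<lambda>p. f p + g p - lcomb (\<lambda>i. c i + d i) x p) \<in> relN"
    by (simp add: algebra_simps)
  then show ?thesis by (intro spannedI[of ?A]) (use c d in auto)
qed

lemma spanned_smult:
  assumes "f \<in> spanned I x"
  shows "(\<lambda>p. a * f p) \<in> spanned I x"
proof -
  obtain c where c: "finite {i. c i \<noteq> 0}" "{i. c i \<noteq> 0} \<subseteq> I" "(\<lambda>p. f p - lcomb c x p) \<in> relN"
    using assms(1) unfolding spanned_def by blast
  let ?A = "{i. c i \<noteq> 0}"
  have "lcomb (\<lambda>i. a * c i) x p = a * lcomb c x p" for p
    using c(1) by (subst (1 2) lcomb_sum[of ?A]) (auto simp: sum_distrib_left algebra_simps)
  with relN.smult[OF c(3), of a] have "(\<lambda>p. a * f p - lcomb (\<lambda>i. a * c i) x p) \<in> relN"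
    by (simp add: algebra_simps)
  then show ?thesis by (intro spannedI[of ?A]) (use c in auto)
qed

lemma spanned_basis: "i \<in> I \<Longrightarrow> x i \<in> spanned I x"
  by (rule spannedI[of "{i}" _ "\<lambda>k. if k = i then 1 else 0"])
    (auto simp: lcomb_sum[of "{i}"] relN.zero)

lemma spanned_sum:
  "finite S \<Longrightarrow> (\<And>q. q \<in> S \<Longrightarrow> f q \<in> spanned I x) \<Longrightarrow> (\<lambda>p. \<Sum>q\<in>S. a q * f q p) \<in> spanned I x"
proof (induction S rule: finite_induct)
  case empty then show ?case using spanned_rel[OF relN.zero] by simp
next
  case (insert q S)
  have "(\<lambda>p. a q * f q p + (\<Sum>q\<in>S. a q * f q p)) \<in> spanned I x"
    by (rule spanned_add[OF spanned_smult]) (use insert in auto)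
  then show ?case using insert by simp
qed

lemma mset_concat_upt: "mset (concat (map f [0..<n])) = (\<Sum>i<n. mset (f i))"
  by (induction n) (auto simp: add.commute)

context basis_setting begin

abbreviation basis_path :: "(nat \<Rightarrow> nat) \<times> nat list \<times> nat list \<Rightarrow> path \<Rightarrow> 'k::comm_ring_1" where
  "basis_path i \<equiv> delta (xel b ch kap rho i)"

lemma dots_basis_dots:
  assumes D: "\<forall>d\<in>set D. \<not> is_cox d" "run kap D = Some kap"
  obtains a where "length a = b" "mset D = mset (basis_dots b kap a)"
proof
  define a where "a = map (\<lambda>i. count (mset D) (Dot (bpos kap i))) [0..<b]"
  show "length a = b" by (simp add: a_def)
  have bp: "\<And>i k. i < b \<Longrightarrow> k < b \<Longrightarrow> bpos kap i = bpos kap k \<Longrightarrow> i = k"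
    using bpos_inj[of _ kap] nb by simp
  have dv: "\<exists>i<b. d = Dot (bpos kap i)" if "d \<in> set D" for d
    using D that
  proof (induction D)
    case (Cons e D)
    then obtain j where e: "e = Dot j" by (cases e) auto
    with Cons(3) have v: "j < length kap" "kap ! j = Black" "run kap D = Some kap" by (auto split: if_splits)
    from bpos_surj[OF v(1,2)] nb have "\<exists>i<b. e = Dot (bpos kap i)" using e by auto
    with Cons v show ?case by auto
  qed simp
  have cx: "mset (basis_dots b kap a) = (\<Sum>i<b. replicate_mset (a ! i) (Dot (bpos kap i)))"
    unfolding basis_dots_def mset_concat_upt by simp
  show "mset D = mset (basis_dots b kap a)"
  proof (rule multiset_eqI)
    fix d
    have e: "count (mset (basis_dots b kap a)) d = (\<Sum>i<b. if d = Dot (bpos kap i) then a ! i else 0)"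
      unfolding cx count_sum by (rule sum.cong) auto
    show "count (mset D) d = count (mset (basis_dots b kap a)) d"
    proof (cases "\<exists>k<b. d = Dot (bpos kap k)")
      case True
      then obtain k where k: "k < b" "d = Dot (bpos kap k)" by blast
      have "(\<Sum>i<b. if d = Dot (bpos kap i) then a ! i else 0) = (\<Sum>i<b. if i = k then a ! i else 0)"
        by (rule sum.cong) (use k bp in auto)
      then show ?thesis unfolding e using k by (simp add: a_def)
    next
      case False
      then have "d \<notin> set D" using dv by blast
      moreover have "(\<Sum>i<b. if d = Dot (bpos kap i) then a ! i else 0) = 0"
        by (rule sum.neutral) (use False in auto)
      ultimately show ?thesis unfolding e using not_in_iff by fastforce
    qed
  qed
qed

text \<open>Induction on the number of letters other than dots. By the induction hypothesis the span
  itself may serve as \<open>B\<close>. After the dots have been moved up, the undotted part either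
  lies in the span or is exchanged for the basis word with the same labelling.\<close>

theorem spanning_path:
  assumes "run rho p = Some kap" "ndb p = 1"
  shows "(delta (rho, p) :: path \<Rightarrow> 'k::comm_ring_1) \<in> spanned (Idx b kap rho) basis_path"
  using assms
proof (induction "clen p" arbitrary: p rule: less_induct)
  case less
  let ?B = "spanned (Idx b kap rho) basis_path :: (path \<Rightarrow> 'k) set"
  interpret F: lower_filtration rho kap ?B "clen p"
    by unfold_locales (rule spanned_rel spanned_add spanned_smult less(1); assumption)+
  from F.separate_dots[OF less(2)] obtain u D where u: "cox u" "\<forall>d\<in>set D. \<not> is_cox d" "run rho u = Some kap"
      "run kap D = Some kap" "ndb u = ndb p" "clen u = clen p" and
    s: "\<And>hi. run kap hi = Some kap \<Longrightarrow> ndb (p @ hi) = 1 \<Longrightarrow> clen (p @ hi) \<le> clen p \<Longrightarrow> F.sim (p @ hi) (u @ D @ hi)"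
    by blast
  have s1: "F.sim p (u @ D)" using s[of "[]"] less(3) by simp
  have n1: "ndb (u @ D) = 1" "clen (u @ D) \<le> clen p" using u dots_clen[OF u(2)] less(3) by simp_all
  show ?case
  proof (cases "redw rho u (srun id_labels u)")
    case False
    have "run rho (u @ D) = Some kap" using u by (simp add: run_append)
    from F.nonreduced[OF this u(1) False n1] s1 show ?thesis by (simp add: F.sim_def)
  next
    case True
    define L where "L = srun id_labels u"
    have r: "redw rho u L" using True by (simp add: L_def)
    have g: "good rho L" "colours rho L = kap" using redwD(1,2)[OF r] u(3) by simp_all
    have "neg_reds rho L = 1" using redw_ndb[OF r] u(5) less(3) by simp
    from good_is_basis_labels[OF g this] obtain l where l: "length l = b" "set l \<subseteq> {0, 1}" "L = basis_labels kap b (inv_into UNIV (origin L)) l" .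
    define w where "w = inv_into UNIV (origin L)"
    have w: "w \<in> Sperm kap rho" unfolding w_def by (rule Sperm_inv[OF g])
    have rx: "redw rho (basis_word b ch kap w l) L" using basis_word_redw[OF w, of l] l(3) unfolding w_def by simp
    have s2: "F.sim (u @ D) (basis_word b ch kap w l @ D)"
      by (rule F.matsumoto[OF r rx]) (use g u n1 in simp_all)
    obtain a where a: "length a = b" "mset D = mset (basis_dots b kap a)" using dots_basis_dots[OF u(2,4)] .
    have "run rho (basis_word b ch kap w l) = Some kap" using redwD(2)[OF rx] g by simp
    from F.dots_perm[OF u(2,4) a(2) this]
    have s3: "F.sim (basis_word b ch kap w l @ D) (basis_word b ch kap w l @ basis_dots b kap a)" .
    have "(w, l, a) \<in> Idx b kap rho" using w l a unfolding Idx_def by simp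
    from spanned_basis[OF this] have "delta (rho, basis_word b ch kap w l @ basis_dots b kap a) \<in> ?B"
      using xel_eq[of b ch kap rho w l a] by metis
    with s1 s2 s3 show ?thesis by (simp add: F.sim_def)
  qed
qed

lemma run_basis_dots: "run kap (basis_dots b kap a) = Some kap"
proof -
  have "run kap D = Some kap" if "\<forall>d\<in>set D. \<exists>i<b. d = Dot (bpos kap i)" for D
    using that
  proof (induction D)
    case (Cons d D)
    then obtain i where i: "i < b" "d = Dot (bpos kap i)" by auto
    then show ?case using Cons bpos_props[of i kap] nb by simp
  qed simp
  moreover have "\<forall>d\<in>set (basis_dots b kap a). \<exists>i<b. d = Dot (bpos kap i)" by (auto simp: basis_dots_def)
  ultimately show ?thesis by blast
qed

lemma xel_run:
  assumes "w \<in> Sperm kap rho"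
  shows "run rho (basis_word b ch kap w l @ basis_dots b kap a) = Some kap" "ndb (basis_word b ch kap w l @ basis_dots b kap a) = 1"
proof -
  let ?L = "basis_labels kap b w l"
  have r: "redw rho (basis_word b ch kap w l) ?L" by (rule basis_word_redw[OF assms])
  have pmL: "origin ?L = inv_into UNIV w" by (auto simp: origin_def basis_labels_def)
  obtain ws where rd: "reduced (length rho) w ws" using la[OF assms] unfolding left_adjusted_def by blast
  have rr: "run rho (word_diag ws) = Some kap" using rd assms unfolding Sperm_def by blast
  have "wperm ws = w" using rd unfolding reduced_def by blast
  then have "fpos (word_diag ws) = inv_into UNIV w" by (simp only: fpos_word_diag_inv)
  then have "origin (srun id_labels (word_diag ws)) = inv_into UNIV w" unfolding fun_eq_iff origin_srun by simp
  then have c: "colours rho ?L = kap" using run_good[OF rr] pmL by (simp add: colours_def)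
  then show "run rho (basis_word b ch kap w l @ basis_dots b kap a) = Some kap"
    using redwD(2)[OF r] run_basis_dots by (simp add: run_append)
  obtain j where j: "j < length kap" "kap ! j = Red" using red by blast
  note rp = rpos_props[OF j]
  have col: "rho ! origin ?L t = kap ! t" if "t < length rho" for t using c that colours_nth by metis
  have "neg_reds rho ?L = (\<Sum>q<length rho. if q = rpos kap then 1 else 0)"
    unfolding neg_reds_def
  proof (rule sum.cong[OF refl])
    fix q assume q: "q \<in> {..<length rho}"
    show "(if ?L q < 0 \<and> rho ! origin ?L q = Red then 1 else 0) = (if q = rpos kap then 1 else (0::nat))"
    proof (cases "q = rpos kap")
      case True
      then show ?thesis using rp col[of q] q by (simp add: basis_labels_def negated_def)
    next
      case False
      have "\<not> ?L q < 0" if "kap ! q = Red"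
        using bpos_props(2)[of _ kap] nb that False by (auto simp: basis_labels_def negated_def)
      with False show ?thesis using col[of q] q by auto
    qed
  qed
  then have "neg_reds rho ?L = 1" using rp len by simp
  then show "ndb (basis_word b ch kap w l @ basis_dots b kap a) = 1"
    using redw_ndb[OF r] dots_clen[OF basis_dots_dots] by simp
qed

end

section \<open>A representation by divided differences\<close>

text \<open>The Jordan-Wigner sign; the order of the rational values orders the fermions.\<close>

definition fsign :: "rat set \<Rightarrow> rat \<Rightarrow> rat" where
  "fsign S x = (- 1) ^ card {y \<in> S. y < x}"

text \<open>\<open>L j\<close> is the value carried by the strand at position \<open>j\<close>, and \<open>S\<close> is the set of values of the nailed strands.
The relations only hold for injective \<open>L\<close>, where no division by zero occurs.\<close>

type_synonym amp = "(nat \<Rightarrow> rat) \<Rightarrow> rat set \<Rightarrow> rat"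

text \<open>Amplitudes are functions of the state reached so far at the top. Of the two mixed
  crossings only one carries a factor, the value of the black strand; this makes the mixed double
  crossing a dot, and its divided difference is the correction in the braid relation with red in the
  middle.\<close>

fun act :: "color list \<Rightarrow> gen \<Rightarrow> amp \<Rightarrow> amp" where
  "act s (Dot j) f = (\<lambda>L S. L j * f L S)"
| "act s (Cr j) f = (\<lambda>L S. if s ! j = Black \<and> s ! Suc j = Black
     then (f L S - f (L \<circ> sw j) S) / (L j - L (Suc j))
     else (if s ! j = Red then L j else 1) * f (L \<circ> sw j) S)"
| "act s Nail f = (\<lambda>L S. if L 0 \<in> S then fsign S (L 0) * f L (S - {L 0}) else 0)"
| "act s DB f = f"

fun actw :: "color list \<Rightarrow> gen list \<Rightarrow> amp \<Rightarrow> amp" where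
  "actw s [] f = f"
| "actw s (g # gs) f = actw (step s g) gs (act s g f)"

lemma actw_append: "run s u = Some t \<Longrightarrow> actw s (u @ v) f = actw t v (actw s u f)"
  by (induction u arbitrary: s f) (auto split: if_splits)

lemma act_add: "act s g (\<lambda>L S. c * f L S + d * h L S) = (\<lambda>L S. c * act s g f L S + d * act s g h L S)"
  by (cases g) (auto simp: fun_eq_iff algebra_simps diff_divide_distrib add_divide_distrib)

lemma actw_add: "actw s gs (\<lambda>L S. c * f L S + d * h L S) = (\<lambda>L S. c * actw s gs f L S + d * actw s gs h L S)"
  by (induction gs arbitrary: s f h) (auto simp: act_add)

text \<open>The relations hold up to functions of this class. It is stable under \<open>act\<close>,
  as crossings permute the values and nails only remove elements of \<open>S\<close>.\<close>

definition vanish :: "amp \<Rightarrow> bool" where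
  "vanish f \<longleftrightarrow> (\<forall>L S. inj L \<longrightarrow> finite S \<longrightarrow> f L S = 0)"

lemma inj_sw: "inj L \<Longrightarrow> inj (L \<circ> sw j)"
  using bij_is_inj[OF bij_sw[of j]] by (simp add: inj_compose)

lemma vanish_act: "vanish f \<Longrightarrow> vanish (act s g f)"
  using inj_sw by (cases g) (auto simp: vanish_def)

lemma vanish_actw: "vanish f \<Longrightarrow> vanish (actw s gs f)"
  by (induction gs arbitrary: s f) (auto simp: vanish_act)

lemma sw_j [simp]: "sw j j = Suc j" and sw_Sj [simp]: "sw j (Suc j) = j"
  and sw_SSj [simp]: "sw j (Suc (Suc j)) = Suc (Suc j)" and sw_S_j [simp]: "sw (Suc j) j = j"
  by (simp_all add: sw_def)

lemma sw_far: "q \<noteq> j \<Longrightarrow> q \<noteq> Suc j \<Longrightarrow> sw j q = q"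
  by (simp add: sw_def)

lemma comp_sw_sw [simp]: "L \<circ> sw j \<circ> sw j = L"
  by (simp add: fun_eq_iff)

lemma comp_sw_braid: "L \<circ> sw j \<circ> sw (Suc j) \<circ> sw j = L \<circ> sw (Suc j) \<circ> sw j \<circ> sw (Suc j)"
  by (simp add: fun_eq_iff sw_braid)

lemma comp_sw_far: "Suc j < k \<Longrightarrow> L \<circ> sw k \<circ> sw j = L \<circ> sw j \<circ> sw k"
  by (simp add: fun_eq_iff sw_comm)

text \<open>Removing the smaller value first changes the parity seen by the larger one; removing the
  larger first changes nothing for the smaller.\<close>

lemma fsign_anticomm:
  assumes "finite S" "a \<in> S" "b \<in> S" "a \<noteq> b"
  shows "fsign S a * fsign (S - {a}) b = - (fsign S b * fsign (S - {b}) a)"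
proof -
  have *: "fsign (S - {a}) b * fsign S a = - (fsign S b * fsign (S - {b}) a)" if "a \<in> S" "a < b" for a b
  proof -
    have "{y \<in> S. y < b} = insert a {y \<in> S - {a}. y < b}" using that by auto
    then have "card {y \<in> S. y < b} = Suc (card {y \<in> S - {a}. y < b})"
      using assms(1) by simp
    moreover have "{y \<in> S - {b}. y < a} = {y \<in> S. y < a}" using that by auto
    ultimately show ?thesis by (simp add: fsign_def)
  qed
  show ?thesis
  proof (cases "a < b")
    case True then show ?thesis using *[of a b] assms by (simp add: mult.commute)
  next
    case False
    then have "fsign (S - {b}) a * fsign S b = - (fsign S a * fsign (S - {a}) b)" using *[of b a] assms by simp
    then show ?thesis by (simp add: mult.commute)
  qed
qed

definition divdiff :: "nat \<Rightarrow> amp \<Rightarrow> amp" where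
  "divdiff j f = (\<lambda>L S. (f L S - f (L \<circ> sw j) S) / (L j - L (Suc j)))"

definition nail_op :: "amp \<Rightarrow> amp" where
  "nail_op f = (\<lambda>L S. if L 0 \<in> S then fsign S (L 0) * f L (S - {L 0}) else 0)"

lemma act_BB: "s ! j = Black \<Longrightarrow> s ! Suc j = Black \<Longrightarrow> act s (Cr j) f = divdiff j f"
  by (simp add: divdiff_def)

lemma act_BR: "s ! j = Black \<Longrightarrow> s ! Suc j = Red \<Longrightarrow> act s (Cr j) f = (\<lambda>L S. f (L \<circ> sw j) S)"
  by simp

lemma act_RB: "s ! j = Red \<Longrightarrow> s ! Suc j = Black \<Longrightarrow> act s (Cr j) f = (\<lambda>L S. L j * f (L \<circ> sw j) S)"
  by simp

lemma step_eq: "s ! j = s ! Suc j \<Longrightarrow> step s (Cr j) = s"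
  by simp (metis list_update_id)

lemma step_nth: "Suc j < length s \<Longrightarrow> step s (Cr j) ! q = (if q = j then s ! Suc j else if q = Suc j then s ! j else s ! q)"
  by (auto simp: nth_list_update)

text \<open>Both sides are the alternating sum over the six arrangements of three strands, divided
  by the Vandermonde product \<open>a * b * c\<close>; \<open>c = a + b\<close> since these are
  differences of three values.\<close>

lemma braid_rat:
  fixes a b c :: rat
  assumes "a \<noteq> 0" "b \<noteq> 0" "c \<noteq> 0" "c = a + b"
  shows "(((p - q) / a - (r - t) / c) / b - ((p - q) / a - (u - v) / b) / c) / a =
    (((p - r) / b - (q - u) / c) / a - ((p - r) / b - (t - v) / a) / c) / b"
proof -
  have "(((p - q) / a - (r - t) / c) / b - ((p - q) / a - (u - v) / b) / c) / a = (p - q - r + t + u - v) / (a * b * c)"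
    using assms(1-3) by (simp add: field_simps) (simp add: assms(4) algebra_simps)
  moreover have "(((p - r) / b - (q - u) / c) / a - ((p - r) / b - (t - v) / a) / c) / b = (p - q - r + t + u - v) / (a * b * c)"
    using assms(1-3) by (simp add: field_simps) (simp add: assms(4) algebra_simps)
  ultimately show ?thesis by simp
qed

lemma div_flip: "(q - p) / (y - x) = (p - q) / (x - (y::rat))"
  by (metis minus_diff_eq minus_divide_divide)

lemma divdiff_braid:
  assumes "inj L"
  shows "divdiff j (divdiff (Suc j) (divdiff j f)) L S = divdiff (Suc j) (divdiff j (divdiff (Suc j) f)) L S"
proof -
  define x y z where "x = L j" "y = L (Suc j)" "z = L (Suc (Suc j))"
  have ne: "x - y \<noteq> 0" "y - z \<noteq> 0" "x - z \<noteq> 0" using assms by (auto simp: inj_eq x_y_z_def)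
  have *: "x - z = (x - y) + (y - z)" by simp
  show ?thesis unfolding divdiff_def
    using braid_rat[OF ne *, of "f L S" "f (L \<circ> sw j) S" "f (L \<circ> sw (Suc j)) S" "f (L \<circ> sw (Suc j) \<circ> sw j) S"
       "f (L \<circ> sw j \<circ> sw (Suc j)) S" "f (L \<circ> sw (Suc j) \<circ> sw j \<circ> sw (Suc j)) S"]
    by (simp add: comp_sw_braid x_y_z_def[symmetric] div_flip[of _ _ y x] div_flip[of _ _ z y])
qed

text \<open>Two nails never remove the same value, so everything vanishes unless both values lie in
  \<open>S\<close>. In that case the two orders of nailing carry the opposite signs \<open>e\<close>
  and \<open>- e\<close>.\<close>

lemma divdiff_nail:
  assumes "inj L" "finite S"
  shows "divdiff 0 (nail_op (divdiff 0 (nail_op f))) L S = - nail_op (divdiff 0 (nail_op (divdiff 0 f))) L S"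
proof -
  define a b where "a = L 0" "b = L (Suc 0)"
  have ne: "a \<noteq> b" "a - b \<noteq> 0" using assms by (auto simp: inj_eq a_b_def)
  define d where "d = a - b"
  have S: "S - {b} - {a} = S - {a} - {b}" by auto
  have L0: "(L \<circ> sw 0) 0 = b" "(L \<circ> sw 0) (Suc 0) = a" "L 0 = a" "L (Suc 0) = b"
    by (simp_all add: a_b_def)
  show ?thesis
  proof (cases "a \<in> S \<and> b \<in> S")
    case True
    define e where "e = fsign S a * fsign (S - {a}) b"
    have e: "fsign S a * fsign (S - {a}) b = e" "fsign S b * fsign (S - {b}) a = - e"
      using fsign_anticomm[of S a b] True ne assms unfolding e_def by auto
    have e': "fsign S a * (fsign (S - {a}) b * r) = e * r" "fsign S b * (fsign (S - {b}) a * r) = - e * r" for r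
      using e by (simp_all add: mult.assoc[symmetric])
    show ?thesis unfolding divdiff_def nail_op_def comp_sw_sw L0 using True ne
      by (simp add: S e' div_flip[of _ _ b a] right_diff_distrib d_def[symmetric]) (simp add: e' field_simps, simp add: d_def algebra_simps)
  next
    case False
    then show ?thesis unfolding divdiff_def nail_op_def comp_sw_sw L0 using ne by auto
  qed
qed

definition eval_rel :: "(int \<times> gen list) list \<Rightarrow> (gen list \<Rightarrow> rat) \<Rightarrow> rat" where
  "eval_rel R F = (\<Sum>(c, g)\<leftarrow>R. of_int c * F g)"

lemma eval_rel_simps [simp]:
  "eval_rel [] F = 0" "eval_rel ((c, g) # R) F = of_int c * F g + eval_rel R F"
  by (simp_all add: eval_rel_def)

lemma act_comm:
  assumes "valid s g" "valid s h" "supp g \<inter> supp h = {}"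
  shows "act (step s g) h (act s g f) L S = act (step s h) g (act s h f) L S"
proof -
  have far: "act (step s (Cr j)) (Cr k) (act s (Cr j) f) L S = act (step s (Cr k)) (Cr j) (act s (Cr k) f) L S"
    if jk: "Suc j < k" and l: "Suc k < length s" for j k
  proof -
    \<comment> \<open>Every crossing is a combination of the identity and the swap. For distant
      crossings neither pair of coefficients notices the other swap.\<close>
    define A where "A m L = (if s ! m = Black \<and> s ! Suc m = Black then 1 / (L m - L (Suc m)) else (0::rat))" for m L
    define C where "C m L = (if s ! m = Black \<and> s ! Suc m = Black then - (1 / (L m - L (Suc m)))
      else if s ! m = Red then L m else (1::rat))" for m L
    have "Suc j < length s" using jk l by simp
    note stn = step_nth[OF this] step_nth[OF l]
    have a: "act s (Cr m) f = (\<lambda>L S. A m L * f L S + C m L * f (L \<circ> sw m) S)" for m f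
      by (auto simp: A_def C_def fun_eq_iff diff_divide_distrib)
    have 1: "act (step s (Cr j)) (Cr k) = act s (Cr k)" "act (step s (Cr k)) (Cr j) = act s (Cr j)"
      using jk by (auto simp: fun_eq_iff stn simp del: step.simps)
    have 2: "A k (L \<circ> sw j) = A k L" "C k (L \<circ> sw j) = C k L" "A j (L \<circ> sw k) = A j L" "C j (L \<circ> sw k) = C j L" for L
      using jk by (simp_all add: A_def C_def sw_far)
    show ?thesis unfolding 1 a using 2 by (simp add: comp_sw_far[OF jk] algebra_simps)
  qed
  show ?thesis
  proof (cases g)
    case (Cr j)
    show ?thesis
    proof (cases h)
      case h: (Cr k)
      have l: "Suc j < length s" "Suc k < length s" using Cr h assms(1,2) by simp_all
      from assms(3) Cr h have "Suc j < k \<or> Suc k < j" by auto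
      then show ?thesis
      proof
        assume "Suc j < k"
        from far[OF this l(2)] show ?thesis unfolding Cr h .
      next
        assume "Suc k < j"
        from far[OF this l(1)] show ?thesis unfolding Cr h by (rule HOL.sym)
      qed
    next
      case h: (Dot i)
      then show ?thesis using Cr assms by (auto simp: sw_far right_diff_distrib)
    next
      case h: Nail
      then show ?thesis using Cr assms by (cases j) (auto simp: sw_far nth_list_update right_diff_distrib)
    qed (use Cr assms in auto)
  next
    case (Dot i)
    show ?thesis
    proof (cases h)
      case h: (Cr k)
      then show ?thesis using Dot assms by (auto simp: sw_far right_diff_distrib)
    qed (use Dot assms in auto)
  next
    case Nail
    show ?thesis
    proof (cases h)
      case h: (Cr k)
      then show ?thesis using Nail assms by (cases k) (auto simp: sw_far nth_list_update right_diff_distrib)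
    qed (use Nail assms in auto)
  next
    case DB
    show ?thesis
      by (cases h) (use DB assms in auto)
  qed
qed

lemma rels_vanish:
  assumes R: "R \<in> rels s" and L: "inj L" "finite S"
  shows "eval_rel R (\<lambda>g. actw s g f L S) = 0"
proof -
  have ne: "L i \<noteq> L j" if "i \<noteq> j" for i j using L that by (simp add: inj_eq)
  note bs = step_eq act_BB
  show ?thesis using R unfolding rels_def
  proof (elim UnE CollectE exE conjE)
    fix j assume a: "R = [(1, [Cr j, Cr j])]" "Suc j < length s" "s ! j = Black" "s ! Suc j = Black"
    have "divdiff j (divdiff j f) L S = 0" by (simp add: divdiff_def div_flip[of _ _ "L (Suc j)"])
    with a show ?thesis by (simp add: bs del: act.simps step.simps)
  next
    fix j assume a: "R = [(1, [Dot j, Cr j]), (-1, [Cr j, Dot (Suc j)]), (-1, [])]" "Suc j < length s" "s ! j = Black" "s ! Suc j = Black"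
    show ?thesis using a(3,4) ne[of j "Suc j"] unfolding a(1) by (simp add: step_eq del: step.simps(1)) (simp add: field_simps)
  next
    fix j assume a: "R = [(1, [Cr j, Dot j]), (-1, [Dot (Suc j), Cr j]), (-1, [])]" "Suc j < length s" "s ! j = Black" "s ! Suc j = Black"
    show ?thesis using a(3,4) ne[of j "Suc j"] unfolding a(1) by (simp add: step_eq del: step.simps(1)) (simp add: field_simps)
  next
    fix j assume a: "R = [(1, [Cr j, Cr (Suc j), Cr j]), (-1, [Cr (Suc j), Cr j, Cr (Suc j)])]"
      "Suc (Suc j) < length s" "s ! Suc j = Black" "s ! j = Black \<and> s ! Suc (Suc j) = Black \<or>
       s ! j = Red \<and> s ! Suc (Suc j) = Black \<or> s ! j = Black \<and> s ! Suc (Suc j) = Red"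
    from a(4) show ?thesis
    proof (elim disjE conjE)
      assume b: "s ! j = Black" "s ! Suc (Suc j) = Black"
      then show ?thesis using divdiff_braid[OF L(1), of j f S] a(3) unfolding a(1) by (simp add: bs del: act.simps step.simps)
    next
      assume b: "s ! j = Red" "s ! Suc (Suc j) = Black"
      show ?thesis using a(2,3) b unfolding a(1)
        by (simp add: nth_list_update comp_sw_braid sw_far) (simp add: algebra_simps)
    next
      assume b: "s ! j = Black" "s ! Suc (Suc j) = Red"
      show ?thesis using a(2,3) b unfolding a(1)
        by (simp add: nth_list_update comp_sw_braid sw_far) (simp add: add_divide_distrib[symmetric])
    qed
  next
    fix j assume a: "R = [(1, [Cr j, Cr (Suc j), Cr j]), (-1, [Cr (Suc j), Cr j, Cr (Suc j)]), (-1, [])]"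
      "Suc (Suc j) < length s" "s ! j = Black" "s ! Suc j = Red" "s ! Suc (Suc j) = Black"
    show ?thesis using a(2-) ne[of j "Suc (Suc j)"] unfolding a(1)
      by (simp add: nth_list_update comp_sw_braid sw_far) (simp add: field_simps)
  next
    fix j assume a: "R = [(1, [Dot j, Cr j]), (-1, [Cr j, Dot (Suc j)])]" "Suc j < length s" "s ! j = Black" "s ! Suc j = Red"
    show ?thesis using a(2-) unfolding a(1) by simp
  next
    fix j assume a: "R = [(1, [Dot (Suc j), Cr j]), (-1, [Cr j, Dot j])]" "Suc j < length s" "s ! j = Red" "s ! Suc j = Black"
    show ?thesis using a(2-) unfolding a(1) by simp
  next
    fix j assume a: "R = [(1, [Cr j, Cr j]), (-1, [Dot j])]" "Suc j < length s" "s ! j = Black" "s ! Suc j = Red"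
    show ?thesis using a(2-) unfolding a(1) by (simp add: nth_list_update)
  next
    fix j assume a: "R = [(1, [Cr j, Cr j]), (-1, [Dot (Suc j)])]" "Suc j < length s" "s ! j = Red" "s ! Suc j = Black"
    show ?thesis using a(2-) unfolding a(1) by (simp add: nth_list_update)
  next
    assume a: "R = [(1, [Dot 0, Nail]), (-1, [Nail, Dot 0])]"
    show ?thesis unfolding a(1) by simp
  next
    assume a: "R = [(1, [Nail, Nail])]"
    show ?thesis unfolding a(1) by simp
  next
    assume a: "R = [(1, [Nail, Cr 0, Nail, Cr 0]), (1, [Cr 0, Nail, Cr 0, Nail])]" "1 < length s" "s ! 0 = Black" "s ! 1 = Black"
    have n: "act t Nail h = nail_op h" "step t Nail = t" for t h by (simp_all add: nail_op_def)
    show ?thesis using divdiff_nail[OF L, of f] a(3,4) unfolding a(1) by (simp add: bs n del: act.simps step.simps(1))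
  next
    fix g h assume a: "R = [(1, [g, h]), (- ((-1) ^ (hdeg g * hdeg h)), [h, g])]" "valid s g" "valid s h" "supp g \<inter> supp h = {}"
    have "hdeg g * hdeg h = 0" using a(4) by (cases g; cases h) auto
    then have "(- 1 :: int) ^ (hdeg g * hdeg h) = 1" by (simp only: power_0)
    then show ?thesis using act_comm[OF a(2-4), of f L S] unfolding a(1) by simp
  next
    assume a: "R = [(1, [Cr 0, Nail, Cr 0, DB]), (-1, [DB, Cr 0, Nail, Cr 0])]"
    show ?thesis unfolding a(1) by simp
  next
    assume a: "R = [(1, [Nail, Cr 0, DB, Cr 0]), (-1, [Cr 0, DB, Cr 0, Nail])]" "1 < length s" "s ! 0 = Black" "s ! 1 = Red"
    have "s \<noteq> []" using a(2) by auto
    then show ?thesis using a(2-) unfolding a(1) by (simp add: nth_list_update)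
  qed
qed

section \<open>Independence\<close>

text \<open>The linear extension of a function on words. The coefficient map \<open>h\<close> has
  two uses: integers into rationals for the representation, and the identity for the final
  functional over the ground ring.\<close>

definition eval_lin :: "('k::comm_ring_1 \<Rightarrow> 'r::comm_ring_1) \<Rightarrow> (path \<Rightarrow> 'r) \<Rightarrow> (path \<Rightarrow> 'k) \<Rightarrow> 'r" where
  "eval_lin h \<Phi> f = (\<Sum>p\<in>{p. f p \<noteq> 0}. h (f p) * \<Phi> p)"

locale ring_hom0 =
  fixes h :: "'k::comm_ring_1 \<Rightarrow> 'r::comm_ring_1"
  assumes h0: "h 0 = 0" and hadd: "h (x + y) = h x + h y" and hmult: "h (x * y) = h x * h y" and h1: "h 1 = 1"
begin

lemma eval_lin_sup: "finite A \<Longrightarrow> {p. f p \<noteq> 0} \<subseteq> A \<Longrightarrow> eval_lin h \<Phi> f = (\<Sum>p\<in>A. h (f p) * \<Phi> p)"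
  unfolding eval_lin_def by (rule sum.mono_neutral_left) (auto simp: h0)

lemma eval_lin_add:
  assumes "finite {p. f p \<noteq> 0}" "finite {p. g p \<noteq> 0}"
  shows "eval_lin h \<Phi> (\<lambda>p. f p + g p) = eval_lin h \<Phi> f + eval_lin h \<Phi> g"
proof -
  let ?A = "{p. f p \<noteq> 0} \<union> {p. g p \<noteq> 0}"
  show ?thesis
    by (subst (1 2 3) eval_lin_sup[of ?A]) (use assms in \<open>auto simp: hadd algebra_simps sum.distrib\<close>)
qed

lemma eval_lin_smult:
  assumes "finite {p. f p \<noteq> 0}"
  shows "eval_lin h \<Phi> (\<lambda>p. c * f p) = h c * eval_lin h \<Phi> f"
  by (subst (1 2) eval_lin_sup[of "{p. f p \<noteq> 0}"]) (use assms in \<open>auto simp: hmult algebra_simps sum_distrib_left\<close>)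

lemma eval_lin_delta: "eval_lin h \<Phi> (delta q) = \<Phi> q"
  by (subst eval_lin_sup[of "{q}"]) (auto simp: delta_def h1)

lemma finite_delta: "finite {p. (delta q :: path \<Rightarrow> 'k) p \<noteq> 0}"
  by (rule finite_subset[of _ "{q}"]) (auto simp: delta_def)

lemma finite_smult_supp: "finite {p. f p \<noteq> 0} \<Longrightarrow> finite {p. (c::'k) * f p \<noteq> 0}"
  by (rule finite_subset[of _ "{p. f p \<noteq> 0}"]) auto

lemma finite_add_supp: "finite {p. f p \<noteq> (0::'k)} \<Longrightarrow> finite {p. g p \<noteq> 0} \<Longrightarrow> finite {p. f p + g p \<noteq> 0}"
  by (rule finite_subset[of _ "{p. f p \<noteq> 0} \<union> {p. g p \<noteq> 0}"]) auto

lemma eval_lin_sandwich: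
  "finite {p. (sandwich s0 lo R hi :: path \<Rightarrow> 'k) p \<noteq> 0} \<and>
   eval_lin h \<Phi> (sandwich s0 lo R hi) = (\<Sum>(c, g)\<leftarrow>R. h c * \<Phi> (s0, lo @ g @ hi))"
proof (induction R)
  case Nil then show ?case by (simp add: sandwich_Nil eval_lin_def)
next
  case (Cons cg R)
  obtain c g where cg: "cg = (c, g)" by force
  have f: "finite {p. c * (delta (s0, lo @ g @ hi) :: path \<Rightarrow> 'k) p \<noteq> 0}"
    by (rule finite_smult_supp[OF finite_delta])
  show ?case unfolding cg sandwich_Cons
    using Cons finite_add_supp[OF f, of "sandwich s0 lo R hi"] eval_lin_add[OF f, of "sandwich s0 lo R hi" \<Phi>]
      eval_lin_smult[OF finite_delta, of \<Phi> c "(s0, lo @ g @ hi)"] by (simp add: eval_lin_delta)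
qed

text \<open>Finite support is proved along with the vanishing, because additivity of
  \<open>eval_lin\<close> is available only for finite supports.\<close>

lemma eval_lin_relN:
  assumes kill: "\<And>R s s0 lo hi t. R \<in> rels s \<Longrightarrow> run s0 lo = Some s \<Longrightarrow> \<forall>(c, g) \<in> set R. run s g = Some t \<Longrightarrow>
      run t hi \<noteq> None \<Longrightarrow> (\<Sum>(c, g)\<leftarrow>R. h c * \<Phi> (s0, lo @ g @ hi)) = 0"
    and f: "f \<in> relN"
  shows "finite {p. f p \<noteq> 0} \<and> eval_lin h \<Phi> f = 0"
  using f
proof induction
  case zero then show ?case by (simp add: eval_lin_def)
next
  case (gen R s s0 lo t hi)
  then show ?case using eval_lin_sandwich[of s0 lo R hi \<Phi>] kill[of R s s0 lo t hi] by simp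
next
  case (add f g)
  then show ?case using finite_add_supp eval_lin_add by auto
next
  case (smult f c)
  then show ?case using finite_smult_supp eval_lin_smult by auto
qed

lemma eval_lin_lcomb:
  assumes "finite {i. c i \<noteq> 0}"
  shows "eval_lin h \<Phi> (lcomb c (\<lambda>i. delta (x i))) = (\<Sum>i\<in>{i. c i \<noteq> 0}. h (c i) * \<Phi> (x i)) \<and>
    finite {p. lcomb c (\<lambda>i. delta (x i)) p \<noteq> 0}"
proof -
  have "eval_lin h \<Phi> (\<lambda>p. \<Sum>i\<in>A. c i * delta (x i) p) = (\<Sum>i\<in>A. h (c i) * \<Phi> (x i)) \<and>
     finite {p. (\<Sum>i\<in>A. c i * delta (x i) p) \<noteq> 0}" if "finite A" for A
    using that
  proof (induction A rule: finite_induct)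
    case empty then show ?case by (simp add: eval_lin_def)
  next
    case (insert i A)
    have f: "finite {p. c i * (delta (x i) :: path \<Rightarrow> 'k) p \<noteq> 0}" by (rule finite_smult_supp[OF finite_delta])
    show ?case using insert eval_lin_add[OF f, of "\<lambda>p. \<Sum>i\<in>A. c i * delta (x i) p" \<Phi>] finite_add_supp[OF f]
       eval_lin_smult[OF finite_delta, of \<Phi> "c i" "x i"] by (simp add: eval_lin_delta)
  qed
  from this[OF assms] show ?thesis unfolding lcomb_def .
qed

end

lemma ring_hom0_of_int: "ring_hom0 (of_int :: int \<Rightarrow> 'r::comm_ring_1)"
  by unfold_locales auto

lemma ring_hom0_id: "ring_hom0 (\<lambda>x. x :: 'r::comm_ring_1)"
  by unfold_locales auto

lemma actw_zero: "actw s gs (\<lambda>L S. 0) = (\<lambda>L S. 0)"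
  using actw_add[of s gs 0 "\<lambda>L S. 0" 0 "\<lambda>L S. 0"] by simp

lemma actw_eval_rel: "actw s gs (\<lambda>L S. eval_rel R (\<lambda>g. G g L S)) = (\<lambda>L S. eval_rel R (\<lambda>g. actw s gs (G g) L S))"
proof (induction R)
  case (Cons cg R)
  obtain c g where cg: "cg = (c, g)" by force
  have "actw s gs (\<lambda>L S. of_int c * G g L S + 1 * eval_rel R (\<lambda>g. G g L S)) =
     (\<lambda>L S. of_int c * actw s gs (G g) L S + 1 * actw s gs (\<lambda>L S. eval_rel R (\<lambda>g. G g L S)) L S)"
    by (rule actw_add)
  then show ?case unfolding cg eval_rel_simps Cons by simp
qed (simp add: actw_zero)

lemma actw_kill:
  assumes R: "(R :: (int \<times> gen list) list) \<in> rels s" and lo: "run s0 lo = Some s" and g: "\<forall>(c, g) \<in> set R. run s g = Some t"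
    and L: "inj L" "finite S"
  shows "(\<Sum>(c, g)\<leftarrow>R. of_int c * actw s0 (lo @ g @ hi) f L S) = 0"
proof -
  let ?F = "actw s0 lo f"
  have "(\<Sum>(c, g)\<leftarrow>R. of_int c * actw s0 (lo @ g @ hi) f L S) = eval_rel R (\<lambda>g. actw t hi (actw s g ?F) L S)"
    unfolding eval_rel_def
    by (rule arg_cong[of _ _ sum_list], rule map_cong) (use g lo in \<open>auto simp: actw_append\<close>)
  also have "\<dots> = actw t hi (\<lambda>L S. eval_rel R (\<lambda>g. actw s g ?F L S)) L S" by (simp add: actw_eval_rel)
  also have "\<dots> = 0"
    using vanish_actw[of "\<lambda>L S. eval_rel R (\<lambda>g. actw s g ?F L S)" t hi] rels_vanish[OF R] L
    unfolding vanish_def by blast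
  finally show ?thesis .
qed

definition vac :: "(nat \<Rightarrow> rat) \<Rightarrow> amp" where
  "vac y = (\<lambda>L S. if L = y \<and> S = {} then 1 else 0)"

lemma actw_basis_dots: "actw s (basis_dots b kap a) f L S = (\<Prod>i<b. L (bpos kap i) ^ (a ! i)) * f L S"
proof -
  have r: "actw s (replicate m (Dot q) @ D) f = actw s D (\<lambda>L S. L q ^ m * f L S)" for m q D f
    by (induction m arbitrary: f) (auto simp: fun_eq_iff algebra_simps)
  have "actw s (concat (map (\<lambda>i. replicate (a ! i) (Dot (bpos kap i))) xs)) f = (\<lambda>L S. (\<Prod>i\<leftarrow>xs. L (bpos kap i) ^ (a ! i)) * f L S)" for xs
    by (induction xs arbitrary: f) (auto simp: r fun_eq_iff algebra_simps)
  then show ?thesis unfolding basis_dots_def using prod.distinct_set_conv_list[of "[0..<b]" "\<lambda>i. L (bpos kap i) ^ (a ! i)"] by (simp add: lessThan_atLeast0)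
qed

section \<open>Linear algebra and polynomial identities\<close>

text \<open>A left inverse of a square matrix over a field is also a right inverse, so
  \<open>P M = 0\<close> gives \<open>P = P M C = 0\<close>. The enumeration \<open>e\<close> of
  \<open>J\<close> turns the indexed families into matrices.\<close>

lemma left_inverse_kernel:
  fixes M C :: "'j \<Rightarrow> 'j \<Rightarrow> 'a::field"
  assumes fin: "finite J"
    and inv: "\<And>i j. i \<in> J \<Longrightarrow> j \<in> J \<Longrightarrow> (\<Sum>k\<in>J. C i k * M k j) = (if i = j then 1 else 0)"
    and ker: "\<And>j. j \<in> J \<Longrightarrow> (\<Sum>k\<in>J. P k * M k j) = 0" and i: "i \<in> J"
  shows "P i = 0"
proof -
  define n where "n = card J"
  obtain e where e: "bij_betw e {0..<n} J" using ex_bij_betw_nat_finite[OF fin] unfolding n_def by blast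
  have eJ: "e r \<in> J" if "r < n" for r using bij_betwE[OF e] that by auto
  have einj: "e r = e s \<longleftrightarrow> r = s" if "r < n" "s < n" for r s
    using bij_betw_imp_inj_on[OF e] that by (auto simp: inj_on_def)
  have re: "(\<Sum>k\<in>J. f k) = (\<Sum>k<n. f (e k))" for f :: "'j \<Rightarrow> 'a"
    using sum.reindex_bij_betw[OF e, of f] by (simp add: lessThan_atLeast0)
  define amp_mat where "amp_mat = mat n n (\<lambda>(r, s). M (e r) (e s))"
  define CC where "CC = mat n n (\<lambda>(r, s). C (e r) (e s))"
  have car: "amp_mat \<in> carrier_mat n n" "CC \<in> carrier_mat n n" by (simp_all add: amp_mat_def CC_def)
  have "CC * amp_mat = 1\<^sub>m n"
  proof (rule eq_matI)
    fix r s assume rs: "r < dim_row (1\<^sub>m n)" "s < dim_col (1\<^sub>m n)"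
    then have "(CC * amp_mat) $$ (r, s) = (\<Sum>k<n. C (e r) (e k) * M (e k) (e s))"
      by (simp add: amp_mat_def CC_def scalar_prod_def lessThan_atLeast0)
    also have "\<dots> = (if e r = e s then 1 else 0)" using inv[of "e r" "e s"] eJ rs re by simp
    finally show "(CC * amp_mat) $$ (r, s) = 1\<^sub>m n $$ (r, s)" using rs einj by simp
  qed (simp_all add: amp_mat_def CC_def)
  then have MC: "amp_mat * CC = 1\<^sub>m n" by (rule mat_mult_left_right_inverse[OF car(2,1)])
  have MCe: "(\<Sum>k<n. M (e r) (e k) * C (e k) (e s)) = (if r = s then 1 else 0)" if "r < n" "s < n" for r s
  proof -
    have "(amp_mat * CC) $$ (r, s) = (\<Sum>k<n. M (e r) (e k) * C (e k) (e s))"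
      using that by (simp add: amp_mat_def CC_def scalar_prod_def lessThan_atLeast0)
    then show ?thesis using MC that by simp
  qed
  obtain s where s: "s < n" "i = e s" using e i unfolding bij_betw_def by auto
  have "P i = (\<Sum>r<n. P (e r) * (if r = s then 1 else 0))"
    using s by (simp add: if_distrib[of "\<lambda>x. _ * x"] cong: if_cong)
  also have "\<dots> = (\<Sum>r<n. P (e r) * (\<Sum>k<n. M (e r) (e k) * C (e k) (e s)))"
    by (rule sum.cong) (use MCe s in auto)
  also have "\<dots> = (\<Sum>r<n. \<Sum>k<n. P (e r) * M (e r) (e k) * C (e k) (e s))"
    by (simp add: sum_distrib_left mult.assoc)
  also have "\<dots> = (\<Sum>k<n. (\<Sum>r<n. P (e r) * M (e r) (e k)) * C (e k) (e s))"
    by (subst sum.swap) (simp add: sum_distrib_right)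
  also have "\<dots> = 0" by (rule sum.neutral) (use ker re eJ in auto)
  finally show ?thesis .
qed

text \<open>Uniqueness of base \<open>N\<close> expansions, needed to separate exponents after a
  Kronecker substitution.\<close>

lemma digits_unique:
  fixes d d' :: "nat \<Rightarrow> nat"
  assumes "\<forall>q<n. d q < N" "\<forall>q<n. d' q < N" "(\<Sum>q<n. d q * N ^ q) = (\<Sum>q<n. d' q * N ^ q)"
  shows "\<forall>q<n. d q = d' q"
  using assms
proof (induction n arbitrary: d d')
  case (Suc n)
  have e: "(\<Sum>q<Suc n. d q * N ^ q) = d 0 + N * (\<Sum>q<n. d (Suc q) * N ^ q)" for d :: "nat \<Rightarrow> nat"
    by (simp add: sum.lessThan_Suc_shift sum_distrib_left algebra_simps del: sum.lessThan_Suc)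
  have eq: "d 0 + N * (\<Sum>q<n. d (Suc q) * N ^ q) = d' 0 + N * (\<Sum>q<n. d' (Suc q) * N ^ q)"
    using Suc(4) unfolding e .
  have lt: "d 0 < N" "d' 0 < N" using Suc(2,3) by auto
  have 0: "d 0 = d' 0" using arg_cong[OF eq, of "\<lambda>x. x mod N"] lt by simp
  have "(\<Sum>q<n. d (Suc q) * N ^ q) = (\<Sum>q<n. d' (Suc q) * N ^ q)"
    using eq 0 lt by simp
  with Suc(1)[of "\<lambda>q. d (Suc q)" "\<lambda>q. d' (Suc q)"] Suc(2,3) have "\<forall>q<n. d (Suc q) = d' (Suc q)" by auto
  with 0 show ?case using less_Suc_eq_0_disj by auto
qed simp

text \<open>Since the exponents are distinct, the numbers \<open>c a\<close> are the coefficients of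
  one polynomial, which has infinitely many roots.\<close>

lemma poly_exponents:
  fixes c :: "'a \<Rightarrow> int"
  assumes "finite A" "inj_on ex A" "\<And>t::nat. 2 \<le> t \<Longrightarrow> (\<Sum>a\<in>A. of_int (c a) * (of_nat t :: rat) ^ ex a) = 0" "a \<in> A"
  shows "c a = 0"
proof -
  define p where "p = (\<Sum>a\<in>A. monom (of_int (c a) :: rat) (ex a))"
  have "poly p (of_nat t) = 0" if "2 \<le> t" for t :: nat
    using assms(3)[OF that] by (simp add: p_def poly_sum poly_monom)
  then have "of_nat ` {2..} \<subseteq> {x. poly p x = 0}" by auto
  moreover have "infinite (of_nat ` {2::nat..} :: rat set)"
    by (subst finite_image_iff) (auto simp: inj_on_def infinite_Ici)
  ultimately have "p = 0" using poly_roots_finite finite_subset by blast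
  then have "0 = coeff p (ex a)" by simp
  also have "\<dots> = (\<Sum>a'\<in>A. if a' = a then of_int (c a) else 0)"
    unfolding p_def coeff_sum by (rule sum.cong) (use assms(2,4) in \<open>auto simp: inj_on_def\<close>)
  also have "\<dots> = of_int (c a)" using assms(1,4) by simp
  finally show ?thesis by simp
qed

section \<open>Operators obtained from rational combinations of diagrams\<close>

inductive realizable :: "color list \<Rightarrow> color list \<Rightarrow> nat \<Rightarrow> (amp \<Rightarrow> amp) \<Rightarrow> bool" for rho where
  word: "run rho p = Some t \<Longrightarrow> ndb p = d \<Longrightarrow> realizable rho t d (actw rho p)"
| comb: "realizable rho t d F \<Longrightarrow> realizable rho t d G \<Longrightarrow> realizable rho t d (\<lambda>f L S. \<alpha> * F f L S + \<beta> * G f L S)"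

lemma realizable_step:
  "realizable rho t d F \<Longrightarrow> valid t g \<Longrightarrow> realizable rho (step t g) (d + (if g = DB then 1 else 0)) (\<lambda>f. act t g (F f))"
proof (induction rule: realizable.induct)
  case (word p t d)
  have "actw rho (p @ [g]) = (\<lambda>f. act t g (actw rho p f))"
    using actw_append[OF word(1), of "[g]"] by (simp add: fun_eq_iff)
  moreover have "realizable rho (step t g) (d + (if g = DB then 1 else 0)) (actw rho (p @ [g]))"
    by (rule realizable.word) (use word in \<open>auto simp: run_append\<close>)
  ultimately show ?case by simp
next
  case (comb t d F G \<alpha> \<beta>)
  then show ?case unfolding act_add by (intro realizable.comb) auto
qed

lemma realizable_dot:
  assumes "realizable rho t d F" "valid t (Dot q)"
  shows "realizable rho t d (\<lambda>f L S. (L q - \<gamma>) * F f L S)"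
proof -
  have "realizable rho t d (\<lambda>f. act t (Dot q) (F f))" using realizable_step[OF assms] by simp
  from realizable.comb[OF this assms(1), of 1 "- \<gamma>"] show ?thesis by (simp add: algebra_simps)
qed

text \<open>Each factor vanishes where a chosen black strand has a prescribed value, so a product of
  shifted dots singles out one starting state among finitely many.\<close>

lemma realizable_project:
  assumes "finite W" "\<And>w. w \<in> W \<Longrightarrow> valid rho (Dot (q w))"
  shows "realizable rho rho 0 (\<lambda>f L S. (\<Prod>w\<in>W. L (q w) - \<gamma> w) * f L S)"
  using assms
proof (induction W rule: finite_induct)
  case empty
  have "realizable rho rho 0 (actw rho [])" by (rule realizable.word) auto
  moreover have "actw rho [] = (\<lambda>f L S. (\<Prod>w\<in>{}. L (q w) - \<gamma> w) * f L S)" by (simp add: fun_eq_iff)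
  ultimately show ?case by simp
next
  case (insert w W)
  then have "realizable rho rho 0 (\<lambda>f L S. (L (q w) - \<gamma> w) * ((\<Prod>w\<in>W. L (q w) - \<gamma> w) * f L S))"
    by (intro realizable_dot) auto
  then show ?case using insert by (simp add: mult.assoc)
qed

definition nails :: "color list \<Rightarrow> (nat \<Rightarrow> rat) \<Rightarrow> (nat \<Rightarrow> int) \<Rightarrow> rat set" where
  "nails rho V L = {V (origin L q) |q. q < length rho \<and> L q < 0 \<and> rho ! origin L q = Black}"

definition point_amp :: "(nat \<Rightarrow> rat) \<Rightarrow> rat set \<Rightarrow> amp" where
  "point_amp Y Z = (\<lambda>L S. if L = Y \<and> S = Z then 1 else 0)"

lemma origin_sw: "origin (L \<circ> sw j) q = origin L (sw j q)"
  by (simp add: origin_def)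

lemma nails_sw:
  assumes j: "Suc j < length rho"
  shows "nails rho V (L \<circ> sw j) = nails rho V L"
proof -
  let ?A = "{q. q < length rho \<and> L q < 0 \<and> rho ! origin L q = Black}"
  have n: "sw j q < length rho \<longleftrightarrow> q < length rho" for q using j by (auto simp: sw_def)
  have "nails rho V (L \<circ> sw j) = (\<lambda>q. V (origin L q)) ` sw j ` {q. sw j q \<in> ?A}"
    unfolding nails_def origin_sw image_image by (auto simp: n)
  also have "sw j ` {q. sw j q \<in> ?A} = ?A"
  proof (intro equalityI subsetI)
    fix x assume "x \<in> ?A"
    then have "sw j x \<in> {q. sw j q \<in> ?A}" by simp
    then show "x \<in> sw j ` {q. sw j q \<in> ?A}" by (rule rev_image_eqI) simp
  qed blast
  also have "(\<lambda>q. V (origin L q)) ` ?A = nails rho V L" unfolding nails_def by blast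
  finally show ?thesis .
qed

text \<open>Multiplying by a dot minus the value of the uncrossed strand kills the non-crossing term of a divided difference,
so that a reduced word can be followed along its fully crossing path.\<close>

lemma walk_step:
  assumes g: "good rho L" and d: "desc rho L s" and V: "inj V" "\<And>q. V q \<noteq> 0"
    and F: "realizable rho (colours rho (sstep L s)) n F" and W: "w0 \<in> W" "\<beta> \<noteq> 0"
    and eq: "\<And>w L' S'. w \<in> W \<Longrightarrow> inj L' \<Longrightarrow> finite S' \<Longrightarrow> F (f w) L' S' =
       (if w = w0 then \<beta> * point_amp (V \<circ> origin (sstep L s)) (nails rho V (sstep L s)) L' S' else 0)"
  shows "\<exists>F' \<beta>'. realizable rho (colours rho L) (n + (if s = DB then 1 else 0)) F' \<and> \<beta>' \<noteq> 0 \<and>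
    (\<forall>w\<in>W. \<forall>L' S'. inj L' \<longrightarrow> finite S' \<longrightarrow> F' (f w) L' S' =
       (if w = w0 then \<beta>' * point_amp (V \<circ> origin L) (nails rho V L) L' S' else 0))"
proof -
  let ?L1 = "sstep L s"
  let ?t = "colours rho ?L1"
  note ds = desc_step[OF g d]
  have o: "realizable rho (colours rho L) (n + (if s = DB then 1 else 0)) (\<lambda>f. act ?t s (F f))"
    using realizable_step[OF F ds(2)] ds(3) by simp
  have pinj: "origin L q = origin L q' \<longleftrightarrow> q = q'" for q q' using good_origin_inj[OF g] by blast
  have Vinj: "V a = V b \<longleftrightarrow> a = b" for a b using V(1) by (simp add: inj_eq)
  show ?thesis
  proof (cases s)
    case (Cr j)
    have j: "Suc j < length rho" using d Cr by simp
    have L1: "?L1 = L \<circ> sw j" using Cr by simp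
    let ?Y = "V \<circ> origin L" and ?Z = "nails rho V L"
    have Y1: "V \<circ> origin ?L1 = ?Y \<circ> sw j" unfolding L1 by (simp add: fun_eq_iff origin_sw)
    have Z1: "nails rho V ?L1 = ?Z" unfolding L1 by (rule nails_sw[OF j])
    have ptsw: "point_amp (?Y \<circ> sw j) ?Z (L' \<circ> sw j) S' = point_amp ?Y ?Z L' S'" for L' S'
    proof -
      have "L' \<circ> sw j = ?Y \<circ> sw j \<longleftrightarrow> L' = ?Y"
        using comp_sw_sw[of L' j] comp_sw_sw[of ?Y j] by metis
      then show ?thesis by (simp add: point_amp_def)
    qed
    have tj: "?t ! j = rho ! origin L (Suc j)" "?t ! Suc j = rho ! origin L j"
      using j unfolding L1 by (simp_all add: origin_sw)
    have v: "\<not> (?t ! j = Red \<and> ?t ! Suc j = Red)" by (metis Cr ds(2) valid.simps(2))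
    have e: "F (f w) L' S' = (if w = w0 then \<beta> * point_amp (?Y \<circ> sw j) ?Z L' S' else 0)"
      if "w \<in> W" "inj L'" "finite S'" for w L' S' using eq[OF that] unfolding Y1 Z1 .
    consider (BB) "?t ! j = Black" "?t ! Suc j = Black" | (BR) "?t ! j = Black" "?t ! Suc j = Red"
      | (RB) "?t ! j = Red" "?t ! Suc j = Black"
      using v by (cases "?t ! j"; cases "?t ! Suc j") auto
    then show ?thesis
    proof cases
      case BB
      \<comment> \<open>The value at position \<open>j\<close> on the path that does not cross,
        where the labelling is \<open>?Y \<circ> sw j\<close>.\<close>
      define \<gamma> where "\<gamma> = ?Y (Suc j)"
      let ?F' = "\<lambda>f L S. (L j - \<gamma>) * act ?t s (F f) L S"
      have "valid (colours rho L) (Dot j)" using BB tj j by simp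
      then have "realizable rho (colours rho L) (n + (if s = DB then 1 else 0)) ?F'" by (rule realizable_dot[OF o])
      moreover have "?F' (f w) L' S' = (if w = w0 then (- \<beta>) * point_amp ?Y ?Z L' S' else 0)"
        if w: "w \<in> W" "inj L'" "finite S'" for w L' S'
      proof -
        have a: "?F' (f w) L' S' = (L' j - \<gamma>) * ((F (f w) L' S' - F (f w) (L' \<circ> sw j) S') / (L' j - L' (Suc j)))"
          unfolding Cr act_BB[OF BB[unfolded Cr]] by (simp add: divdiff_def)
        have b: "F (f w) L' S' = (if w = w0 then \<beta> * point_amp (?Y \<circ> sw j) ?Z L' S' else 0)" by (rule e[OF w])
        have c: "F (f w) (L' \<circ> sw j) S' = (if w = w0 then \<beta> * point_amp ?Y ?Z L' S' else 0)"
          using e[OF w(1) inj_sw[OF w(2)] w(3)] ptsw by simp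
        have z1: "(L' j - \<gamma>) * point_amp (?Y \<circ> sw j) ?Z L' S' = 0" by (simp add: point_amp_def \<gamma>_def)
        \<comment> \<open>On the crossing path the shifted dot equals the denominator, so the
          coefficient survives up to sign.\<close>
        have z2: "(L' j - \<gamma>) / (L' j - L' (Suc j)) * point_amp ?Y ?Z L' S' = point_amp ?Y ?Z L' S'"
        proof (cases "L' = ?Y")
          case True
          then have "L' j \<noteq> L' (Suc j)" using Vinj pinj by simp
          then show ?thesis using True by (simp add: \<gamma>_def)
        qed (simp add: point_amp_def)
        show ?thesis
        proof (cases "w = w0")
          case True
          have "?F' (f w) L' S' = \<beta> * ((L' j - \<gamma>) * point_amp (?Y \<circ> sw j) ?Z L' S') / (L' j - L' (Suc j))
             - \<beta> * ((L' j - \<gamma>) / (L' j - L' (Suc j)) * point_amp ?Y ?Z L' S')"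
            unfolding a b c using True by (simp add: diff_divide_distrib algebra_simps)
          then show ?thesis unfolding z1 z2 using True by simp
        qed (simp add: a b c)
      qed
      ultimately show ?thesis using W(2) by (intro exI[of _ ?F'] exI[of _ "- \<beta>"]) auto
    next
      case BR
      have "act ?t s (F (f w)) L' S' = (if w = w0 then \<beta> * point_amp ?Y ?Z L' S' else 0)"
        if w: "w \<in> W" "inj L'" "finite S'" for w L' S'
        using e[OF w(1) inj_sw[OF w(2)] w(3)] ptsw act_BR[OF BR[unfolded Cr]] Cr by simp
      then show ?thesis using o W(2) by (intro exI[of _ "\<lambda>f. act ?t s (F f)"] exI[of _ \<beta>]) auto
    next
      case RB
      have "act ?t s (F (f w)) L' S' = (if w = w0 then (?Y j * \<beta>) * point_amp ?Y ?Z L' S' else 0)"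
        if w: "w \<in> W" "inj L'" "finite S'" for w L' S'
      proof -
        have "act ?t s (F (f w)) L' S' = L' j * (if w = w0 then \<beta> * point_amp ?Y ?Z L' S' else 0)"
          using e[OF w(1) inj_sw[OF w(2)] w(3)] ptsw act_RB[OF RB[unfolded Cr]] Cr by simp
        then show ?thesis by (simp add: point_amp_def)
      qed
      \<comment> \<open>The extra factor is a strand value, nonzero by the assumption on
        \<open>V\<close>.\<close>
      then show ?thesis using o W(2) V(2)
        by (intro exI[of _ "\<lambda>f. act ?t s (F f)"] exI[of _ "?Y j * \<beta>"]) auto
    qed
  next
    case Nail
    let ?Y = "V \<circ> origin L" and ?Z = "nails rho V L" and ?Z1 = "nails rho V ?L1"
    have L1: "?L1 = L(0 := - L 0)" using Nail by simp
    have p1: "origin ?L1 = origin L" unfolding L1 by simp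
    have n0: "0 < length rho" "L 0 < 0" "rho ! origin L 0 = Black" using d Nail by auto
    have notin: "?Y 0 \<notin> ?Z1" unfolding nails_def p1 using n0 by (auto simp: L1 Vinj pinj)
    have Z: "?Z = insert (?Y 0) ?Z1"
    proof (intro equalityI subsetI)
      fix x assume "x \<in> ?Z"
      then obtain q where q: "x = V (origin L q)" "q < length rho" "L q < 0" "rho ! origin L q = Black" unfolding nails_def by blast
      show "x \<in> insert (?Y 0) ?Z1"
      proof (cases "q = 0")
        case False
        then have "?L1 q < 0" using q by (simp add: L1)
        then show ?thesis using q unfolding nails_def p1 by blast
      qed (use q in simp)
    next
      fix x assume "x \<in> insert (?Y 0) ?Z1"
      then consider "x = V (origin L 0)" | q where "x = V (origin L q)" "q < length rho" "?L1 q < 0" "rho ! origin L q = Black"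
        unfolding nails_def p1 by auto
      then show "x \<in> ?Z"
      proof cases
        case 1 then show ?thesis unfolding nails_def using n0 by blast
      next
        case 2
        then have "L q < 0" using n0 by (cases "q = 0") (auto simp: L1)
        then show ?thesis unfolding nails_def using 2 by blast
      qed
    qed
    have e: "act ?t s (F (f w)) L' S' = (if w = w0 then (fsign ?Z (?Y 0) * \<beta>) * point_amp ?Y ?Z L' S' else 0)"
      if w: "w \<in> W" "inj L'" "finite S'" for w L' S'
    proof -
      have "act ?t s (F (f w)) L' S' = (if L' 0 \<in> S' then fsign S' (L' 0) * F (f w) L' (S' - {L' 0}) else 0)"
        using Nail by simp
      also have "\<dots> = (if L' 0 \<in> S' then fsign S' (L' 0) * (if w = w0 then \<beta> * point_amp ?Y ?Z1 L' (S' - {L' 0}) else 0) else 0)"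
        using eq[OF w(1,2), of "S' - {L' 0}"] w(3) unfolding p1 by simp
      also have "\<dots> = (if w = w0 then (fsign ?Z (?Y 0) * \<beta>) * point_amp ?Y ?Z L' S' else 0)"
      proof (cases "L' = ?Y")
        case True
        have "?Y 0 \<in> S' \<and> S' - {?Y 0} = ?Z1 \<longleftrightarrow> S' = ?Z" unfolding Z using notin by auto
        then show ?thesis using True by (auto simp: point_amp_def)
      qed (simp add: point_amp_def)
      finally show ?thesis .
    qed
    have "fsign ?Z (?Y 0) \<noteq> 0" by (simp add: fsign_def)
    then show ?thesis using o W(2) e
      by (intro exI[of _ "\<lambda>f. act ?t s (F f)"] exI[of _ "fsign ?Z (?Y 0) * \<beta>"]) auto
  next
    case DB
    have L1: "?L1 = L(0 := - L 0)" using DB by simp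
    have p1: "origin ?L1 = origin L" unfolding L1 by simp
    have n0: "rho ! origin L 0 = Red" using d DB by auto
    have "nails rho V ?L1 = nails rho V L"
    proof -
      have "?L1 q < 0 \<and> rho ! origin L q = Black \<longleftrightarrow> L q < 0 \<and> rho ! origin L q = Black" for q
        using n0 by (cases "q = 0") (auto simp: L1)
      then show ?thesis unfolding nails_def p1 by blast
    qed
    with eq p1 have "act ?t s (F (f w)) L' S' = (if w = w0 then \<beta> * point_amp (V \<circ> origin L) (nails rho V L) L' S' else 0)"
      if w: "w \<in> W" "inj L'" "finite S'" for w L' S' using eq[OF w] DB by simp
    then show ?thesis using o W(2) by (intro exI[of _ "\<lambda>f. act ?t s (F f)"] exI[of _ \<beta>]) auto
  qed (use d in auto)
qed

text \<open>One operator serves all starts \<open>f w\<close> at once: it sends \<open>f w0\<close>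
  to a multiple of a single state and kills the others, as it will become a row tested against all
  columns.\<close>

lemma walk:
  assumes r: "redw rho u L" and V: "inj V" "\<And>q. V q \<noteq> 0" and w0: "w0 \<in> W"
    and G: "realizable rho rho 0 G" "\<gamma> \<noteq> 0" "\<And>w L' S'. w \<in> W \<Longrightarrow> G (f w) L' S' = (if w = w0 then \<gamma> * point_amp V {} L' S' else 0)"
  shows "\<exists>F' \<beta>'. realizable rho (colours rho L) (ndb u) F' \<and> \<beta>' \<noteq> 0 \<and>
    (\<forall>w\<in>W. \<forall>L' S'. inj L' \<longrightarrow> finite S' \<longrightarrow> F' (f w) L' S' =
       (if w = w0 then \<beta>' * point_amp (V \<circ> origin L) (nails rho V L) L' S' else 0))"
  using r
proof (induction rule: redw.induct)
  case Nil
  have "nails rho V id_labels = {}" by (auto simp: nails_def id_labels_def)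
  then show ?case using G by (intro exI[of _ G] exI[of _ \<gamma>]) auto
next
  case (snoc u L s)
  from snoc.IH obtain F \<beta> where F: "realizable rho (colours rho (sstep L s)) (ndb u) F" "\<beta> \<noteq> 0"
    "\<And>w L' S'. w \<in> W \<Longrightarrow> inj L' \<Longrightarrow> finite S' \<Longrightarrow> F (f w) L' S' =
       (if w = w0 then \<beta> * point_amp (V \<circ> origin (sstep L s)) (nails rho V (sstep L s)) L' S' else 0)" by blast
  have "ndb (u @ [s]) = ndb u + (if s = DB then 1 else 0)" by simp
  then show ?case
    using walk_step[where f = f and F = F and W = W and \<beta> = \<beta>, OF snoc.hyps(2,3) V F(1) w0 F(2)] F(3)
    by (simp only:)
qed

section \<open>The amplitude matrix and independence over the integers\<close>

context basis_setting begin

text \<open>The basis word of \<open>w\<close> has a \<open>good\<close> labelling with this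
  permutation, and \<open>good\<close> keeps red strands in order.\<close>

lemma Sperm_red_dot_weight:
  assumes w: "w \<in> Sperm kap rho" and q: "q < q'" "q' < length rho" "rho ! q = Red" "rho ! q' = Red"
  shows "w q < w q'"
proof (rule ccontr)
  assume c: "\<not> w q < w q'"
  have wp: "w permutes {..<length rho}" using w unfolding Sperm_def by blast
  have r: "redw rho (basis_word b ch kap w []) (basis_labels kap b w [])" by (rule basis_word_redw[OF w])
  have p: "origin (basis_labels kap b w []) = inv_into UNIV w" by (auto simp: origin_def basis_labels_def)
  have i: "inv_into UNIV w (w x) = x" for x using permutes_inverses(2)[OF wp] by simp
  have "w q \<noteq> w q'" using q(1) permutes_inj[OF wp] by (metis injD less_irrefl)
  with c have lt: "w q' < w q" by simp
  have "w q < length rho" using permutes_in_image[OF wp, of q] q by simp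
  from good_red[OF redwD(1)[OF r] lt this] show False using q unfolding p i by simp
qed

text \<open>Dots sit on black strands only, so starting states can be separated by black values
  alone; this shows that these suffice. At the first disagreement, a red position, the smaller image
  is taken by the other permutation at a later red position, against the order of red
  strands.\<close>

lemma Sperm_black_eq:
  assumes w: "w \<in> Sperm kap rho" "w' \<in> Sperm kap rho"
    and e: "\<And>q. q < length rho \<Longrightarrow> rho ! q = Black \<Longrightarrow> w q = w' q"
  shows "w = w'"
proof (rule ccontr)
  assume "w \<noteq> w'"
  then obtain q0 where q0: "w q0 \<noteq> w' q0" by blast
  define q where "q = (LEAST q. w q \<noteq> w' q)"
  have q: "w q \<noteq> w' q" unfolding q_def by (rule LeastI[of _ q0]) (rule q0)
  have lq: "w x = w' x" if "x < q" for x using not_less_Least[of x "\<lambda>q. w q \<noteq> w' q"] that unfolding q_def by blast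
  have wp: "w permutes {..<length rho}" "w' permutes {..<length rho}" using w unfolding Sperm_def by blast+
  have qn: "q < length rho" using q wp permutes_not_in[of _ "{..<length rho}" q] by (metis lessThan_iff)
  have qr: "rho ! q = Red" using e[OF qn] q by (cases "rho ! q") auto
  have main: False if W: "v \<in> Sperm kap rho" "v' \<in> Sperm kap rho" and vp: "v permutes {..<length rho}" "v' permutes {..<length rho}"
    and ve: "\<And>x. x < length rho \<Longrightarrow> rho ! x = Black \<Longrightarrow> v x = v' x" and vl: "\<And>x. x < q \<Longrightarrow> v x = v' x" and lt: "v q < v' q" for v v'
  proof -
    obtain x where x: "v' x = v q" using permutes_surj[OF vp(2)] by (metis surjD)
    have ne: "x \<noteq> q" using x lt by auto
    have xn: "x < length rho" using permutes_in_image[OF vp(2), of x] permutes_in_image[OF vp(1), of q] x qn by simp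
    have vx: "v x \<noteq> v' x" using x ne permutes_inj[OF vp(1)] by (metis injD)
    have "q < x" using vl[of x] vx ne by (meson linorder_neqE_nat)
    moreover have "rho ! x = Red" using ve[OF xn] vx by (cases "rho ! x") auto
    ultimately have "v' q < v' x" using Sperm_red_dot_weight[OF W(2)] xn qr by blast
    then show False using x lt by simp
  qed
  show False
    using main[of w w'] main[of w' w] w wp e lq q by (metis linorder_neqE_nat)
qed

definition top_idx :: "((nat \<Rightarrow> nat) \<times> nat list) set" where
  "top_idx = {(w, l). w \<in> Sperm kap rho \<and> length l = b \<and> set l \<subseteq> {0, 1}}"

definition nail_vals :: "(nat \<Rightarrow> rat) \<Rightarrow> nat list \<Rightarrow> rat set" where
  "nail_vals T l = {T (bpos kap i) |i. i < b \<and> l ! i = 1}"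

text \<open>Column \<open>j = (w, l)\<close> starts from the bottom values that \<open>w\<close>
  carries to \<open>T\<close> and reads the amplitude with top values \<open>T\<close> and exactly
  the nails of \<open>l\<close>.\<close>

definition \<Phi> :: "(nat \<Rightarrow> rat) \<Rightarrow> (nat \<Rightarrow> nat) \<times> nat list \<Rightarrow> path \<Rightarrow> rat" where
  "\<Phi> T j p = (if fst p = rho then actw rho (snd p) (vac (T \<circ> fst j)) T (nail_vals T (snd j)) else 0)"

definition amp_mat :: "(nat \<Rightarrow> rat) \<Rightarrow> (nat \<Rightarrow> nat) \<times> nat list \<Rightarrow> (nat \<Rightarrow> nat) \<times> nat list \<Rightarrow> rat" where
  "amp_mat T i j = \<Phi> T j (rho, basis_word b ch kap (fst i) (snd i))"

definition dot_weight :: "(nat \<Rightarrow> rat) \<Rightarrow> nat list \<Rightarrow> rat" where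
  "dot_weight T a = (\<Prod>i<b. T (bpos kap i) ^ (a ! i))"

lemma finite_Sperm: "finite (Sperm kap rho)"
  by (rule finite_subset[OF _ finite_permutations[of "{..<length rho}"]]) (auto simp: Sperm_def)

lemma finite_top_idx: "finite top_idx"
proof -
  have "top_idx \<subseteq> Sperm kap rho \<times> {l. set l \<subseteq> {0, 1} \<and> length l = b}" by (auto simp: top_idx_def)
  then show ?thesis by (rule finite_subset) (simp add: finite_Sperm finite_lists_length_eq)
qed

lemma finite_nail_vals: "finite (nail_vals T l)"
  by (simp add: nail_vals_def)

lemma nail_vals_inj:
  assumes T: "inj T" and l: "length l = b" "set l \<subseteq> {0, 1}" "length l' = b" "set l' \<subseteq> {0, 1}" and e: "nail_vals T l = nail_vals T l'"
  shows "l = l'"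
proof (rule nth_equalityI)
  fix i assume i: "i < length l"
  have ib: "i < b" using i l(1) by simp
  have tb: "T (bpos kap i) = T (bpos kap k) \<longleftrightarrow> i = k" if "k < b" for k
    using injD[OF T] bpos_inj[of i kap k] nb ib that by blast
  have m: "T (bpos kap i) \<in> nail_vals T v \<longleftrightarrow> v ! i = 1" for v
    unfolding nail_vals_def using tb ib by blast
  have "l ! i = 1 \<longleftrightarrow> l' ! i = 1" using m[of l] m[of l'] unfolding e by blast
  moreover have "l ! i \<in> set l" "l' ! i \<in> set l'" using l(1,3) i by simp_all
  then have "l ! i = 0 \<or> l ! i = 1" "l' ! i = 0 \<or> l' ! i = 1" using l(2,4) by blast+
  ultimately show "l ! i = l' ! i" by presburger
qed (use l in simp)

lemma \<Phi>_xel: 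
  assumes "w \<in> Sperm kap rho"
  shows "\<Phi> T j (xel b ch kap rho (w, l, a)) = dot_weight T a * amp_mat T (w, l) j"
proof -
  obtain t where "run rho (basis_word b ch kap w l) = Some t"
    using xel_run(1)[OF assms, of l a] by (auto simp: run_append split: option.splits)
  from actw_append[OF this] show ?thesis unfolding xel_eq \<Phi>_def amp_mat_def dot_weight_def by (simp add: actw_basis_dots)
qed

definition top_poly :: "((nat \<Rightarrow> nat) \<times> nat list \<times> nat list \<Rightarrow> int) \<Rightarrow> (nat \<Rightarrow> rat) \<Rightarrow> (nat \<Rightarrow> nat) \<times> nat list \<Rightarrow> rat" where
  "top_poly c T i = (\<Sum>a\<in>{a. c (fst i, snd i, a) \<noteq> 0}. of_int (c (fst i, snd i, a)) * dot_weight T a)"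

text \<open>Dots at the top multiply by monomials in the top values, so all dotted versions of one
  undotted element contribute multiples of the same row.\<close>

lemma \<Phi>_lcomb:
  assumes c: "finite {i. c i \<noteq> 0}" "{i. c i \<noteq> 0} \<subseteq> Idx b kap rho"
  shows "eval_lin of_int (\<Phi> T j) (lcomb c basis_path) = (\<Sum>i\<in>top_idx. top_poly c T i * amp_mat T i j)"
proof -
  interpret H: ring_hom0 "of_int :: int \<Rightarrow> rat" by (rule ring_hom0_of_int)
  let ?C = "{i. c i \<noteq> 0}"
  let ?A = "\<lambda>i. {a. c (fst i, snd i, a) \<noteq> 0}"
  have fA: "finite (?A i)" for i
    by (rule finite_subset[OF _ finite_imageI[OF c(1), of "\<lambda>(w, l, a). a"]]) (force simp: image_iff)
  have "eval_lin of_int (\<Phi> T j) (lcomb c basis_path) = (\<Sum>i\<in>?C. of_int (c i) * \<Phi> T j (xel b ch kap rho i))"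
    using H.eval_lin_lcomb[OF c(1)] by blast
  also have "\<dots> = (\<Sum>x\<in>Sigma top_idx ?A. of_int (c (fst (fst x), snd (fst x), snd x)) * (dot_weight T (snd x) * amp_mat T (fst x) j))"
  proof (rule sum.reindex_bij_witness[of _ "\<lambda>x. (fst (fst x), snd (fst x), snd x)" "\<lambda>(w, l, a). ((w, l), a)"])
    fix i assume i: "i \<in> ?C"
    obtain w l a where wla: "i = (w, l, a)" by (cases i)
    have "i \<in> Idx b kap rho" using c(2) i by blast
    then have w: "w \<in> Sperm kap rho" "(w, l) \<in> top_idx" unfolding wla Idx_def top_idx_def by auto
    show "(case i of (w, l, a) \<Rightarrow> ((w, l), a)) \<in> Sigma top_idx ?A" using w i wla by simp
    show "of_int (c (fst (fst (case i of (w, l, a) \<Rightarrow> ((w, l), a))), snd (fst (case i of (w, l, a) \<Rightarrow> ((w, l), a))), snd (case i of (w, l, a) \<Rightarrow> ((w, l), a)))) *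
         (dot_weight T (snd (case i of (w, l, a) \<Rightarrow> ((w, l), a))) * amp_mat T (fst (case i of (w, l, a) \<Rightarrow> ((w, l), a))) j) =
         of_int (c i) * \<Phi> T j (xel b ch kap rho i)"
      unfolding wla using \<Phi>_xel[OF w(1)] by simp
  qed auto
  also have "\<dots> = (\<Sum>i\<in>top_idx. \<Sum>a\<in>?A i. of_int (c (fst i, snd i, a)) * (dot_weight T a * amp_mat T i j))"
    by (subst sum.Sigma[OF finite_top_idx]) (use fA in \<open>auto simp: case_prod_unfold\<close>)
  also have "\<dots> = (\<Sum>i\<in>top_idx. top_poly c T i * amp_mat T i j)"
    unfolding top_poly_def by (simp add: sum_distrib_right mult.assoc)
  finally show ?thesis .
qed

lemma \<Phi>_relN:
  assumes T: "inj T" and f: "f \<in> relN"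
  shows "finite {p. f p \<noteq> 0} \<and> eval_lin of_int (\<Phi> T j) f = 0"
proof -
  interpret H: ring_hom0 "of_int :: int \<Rightarrow> rat" by (rule ring_hom0_of_int)
  show ?thesis
  proof (rule H.eval_lin_relN[OF _ f])
    fix R :: "(int \<times> gen list) list" and s s0 lo hi t
    assume a: "R \<in> rels s" "run s0 lo = Some s" "\<forall>(c, g) \<in> set R. run s g = Some t"
    show "(\<Sum>(c, g)\<leftarrow>R. of_int c * \<Phi> T j (s0, lo @ g @ hi)) = 0"
    proof (cases "s0 = rho")
      case True
      then show ?thesis using actw_kill[OF a T finite_nail_vals[of T "snd j"], of hi "vac (T \<circ> fst j)"] by (simp add: \<Phi>_def)
    next
      case False
      have "(\<Sum>(c, g)\<leftarrow>R. of_int c * \<Phi> T j (s0, lo @ g @ hi)) = (\<Sum>x\<leftarrow>R. (0::rat))"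
        by (rule arg_cong[of _ _ sum_list], rule map_cong) (use False in \<open>auto simp: \<Phi>_def\<close>)
      then show ?thesis by simp
    qed
  qed
qed

text \<open>Integral spanning writes each word as a combination of basis elements modulo relations,
  and \<open>\<Phi> T j\<close> kills the relations. The coefficients do not depend on
  \<open>j\<close>, so the values form a combination of rows.\<close>

lemma realizable_span:
  assumes F: "realizable rho t d F" and td: "t = kap" "d = 1" and T: "inj T"
  shows "\<exists>e. \<forall>j. F (vac (T \<circ> fst j)) T (nail_vals T (snd j)) = (\<Sum>i\<in>top_idx. e i * amp_mat T i j)"
  using F td
proof (induction rule: realizable.induct)
  case (word p t d)
  interpret H: ring_hom0 "of_int :: int \<Rightarrow> rat" by (rule ring_hom0_of_int)
  have "(delta (rho, p) :: path \<Rightarrow> int) \<in> spanned (Idx b kap rho) basis_path"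
    using spanning_path[of p] word by simp
  then obtain c where c: "finite {i. c i \<noteq> 0}" "{i. c i \<noteq> 0} \<subseteq> Idx b kap rho"
    "(\<lambda>q. (delta (rho, p) :: path \<Rightarrow> int) q - lcomb c basis_path q) \<in> relN" unfolding spanned_def by blast
  have "actw rho p (vac (T \<circ> fst j)) T (nail_vals T (snd j)) = (\<Sum>i\<in>top_idx. top_poly c T i * amp_mat T i j)" for j
  proof -
    let ?l = "lcomb c basis_path"
    have fl: "finite {q. ?l q \<noteq> 0}" using H.eval_lin_lcomb[OF c(1)] by blast
    have "eval_lin of_int (\<Phi> T j) (\<lambda>q. delta (rho, p) q + (- 1) * ?l q) = 0"
      using \<Phi>_relN[OF T c(3), of j] by simp
    moreover have "eval_lin of_int (\<Phi> T j) (\<lambda>q. delta (rho, p) q + (- 1) * ?l q) = \<Phi> T j (rho, p) - eval_lin of_int (\<Phi> T j) ?l"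
      using H.eval_lin_add[OF H.finite_delta H.finite_smult_supp[OF fl, of "- 1"]] H.eval_lin_smult[OF fl, of _ "- 1"] H.eval_lin_delta
      by simp
    ultimately show ?thesis using \<Phi>_lcomb[OF c(1,2)] by (simp add: \<Phi>_def)
  qed
  then show ?case by blast
next
  case (comb t d F G \<alpha> \<beta>)
  then obtain e e' where e: "\<And>j. F (vac (T \<circ> fst j)) T (nail_vals T (snd j)) = (\<Sum>i\<in>top_idx. e i * amp_mat T i j)"
    "\<And>j. G (vac (T \<circ> fst j)) T (nail_vals T (snd j)) = (\<Sum>i\<in>top_idx. e' i * amp_mat T i j)" by blast
  have "\<alpha> * F (vac (T \<circ> fst j)) T (nail_vals T (snd j)) + \<beta> * G (vac (T \<circ> fst j)) T (nail_vals T (snd j))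
    = (\<Sum>i\<in>top_idx. (\<alpha> * e i + \<beta> * e' i) * amp_mat T i j)" for j
    unfolding e by (simp add: sum_distrib_left algebra_simps sum.distrib)
  then show ?case by (intro exI[of _ "\<lambda>i. \<alpha> * e i + \<beta> * e' i"]) blast
qed

text \<open>Shifted dots at the bottom kill the starts belonging to \<open>w\<close> different from
  \<open>w0\<close>; \<open>walk\<close> then follows the basis word to one final state. The
  resulting row has one nonzero entry \<open>\<beta>\<close>, and \<open>realizable_span\<close>
  places it in the row space.\<close>

lemma matrix_unit:
  assumes T: "inj T" "\<And>q. T q \<noteq> 0" and i: "i \<in> top_idx"
  shows "\<exists>e. \<forall>j\<in>top_idx. (\<Sum>k\<in>top_idx. e k * amp_mat T k j) = (if i = j then 1 else 0)"
proof -
  obtain w0 l0 where wl: "i = (w0, l0)" "w0 \<in> Sperm kap rho" "length l0 = b" "set l0 \<subseteq> {0, 1}"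
    using i unfolding top_idx_def by blast
  have wp: "w permutes {..<length rho}" if "w \<in> Sperm kap rho" for w using that unfolding Sperm_def by blast
  let ?W = "Sperm kap rho"
  have "\<forall>w\<in>?W - {w0}. \<exists>q. q < length rho \<and> rho ! q = Black \<and> w q \<noteq> w0 q"
    using Sperm_black_eq[OF _ wl(2)] by blast
  then obtain q where q: "\<And>w. w \<in> ?W - {w0} \<Longrightarrow> q w < length rho \<and> rho ! q w = Black \<and> w (q w) \<noteq> w0 (q w)" by metis
  \<comment> \<open>Bottom values that \<open>w0\<close> carries to \<open>T\<close>; this makes
    \<open>T\<close> the labelling of the final state, as in \<open>Y\<close>.\<close>
  define V where "V = T \<circ> w0"
  have injw: "inj w" if "w \<in> Sperm kap rho" for w using permutes_inj[OF wp[OF that]] .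
  have V: "inj V" "\<And>q. V q \<noteq> 0" unfolding V_def using T inj_compose[OF T(1) injw[OF wl(2)]] by simp_all
  let ?F0 = "\<lambda>f L S. (\<Prod>w\<in>?W - {w0}. L (q w) - T (w (q w))) * f L S"
  let ?\<beta>0 = "\<Prod>w\<in>?W - {w0}. V (q w) - T (w (q w))"
  have F0: "realizable rho rho 0 ?F0"
    by (rule realizable_project) (use finite_Sperm q in auto)
  have "V (q w) - T (w (q w)) \<noteq> 0" if "w \<in> ?W - {w0}" for w
    using q[OF that] T(1) by (auto simp: V_def inj_eq)
  then have b0: "?\<beta>0 \<noteq> 0" using finite_Sperm by (simp add: prod_zero_iff)
  have F0e: "?F0 (vac (T \<circ> w)) L' S' = (if w = w0 then ?\<beta>0 * point_amp V {} L' S' else 0)" if "w \<in> ?W" for w L' S'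
  proof (cases "w = w0")
    case True
    then show ?thesis by (simp add: vac_def point_amp_def V_def)
  next
    case False
    have "(\<Prod>w\<in>?W - {w0}. (T \<circ> w') (q w) - T (w (q w))) = 0" if "w' = w" for w'
      by (rule prod_zero) (use finite_Sperm that \<open>w \<in> ?W\<close> False in auto)
    then show ?thesis using False by (simp add: vac_def)
  qed
  let ?L = "basis_labels kap b w0 l0" and ?u = "basis_word b ch kap w0 l0"
  have r: "redw rho ?u ?L" by (rule basis_word_redw[OF wl(2)])
  from walk[where f = "\<lambda>w. vac (T \<circ> w)" and W = ?W and G = ?F0 and \<gamma> = ?\<beta>0, OF r V wl(2) F0 b0 F0e]
  obtain F \<beta> where F: "realizable rho (colours rho ?L) (ndb ?u) F" "\<beta> \<noteq> 0"
    "\<And>w L' S'. w \<in> ?W \<Longrightarrow> inj L' \<Longrightarrow> finite S' \<Longrightarrow> F (vac (T \<circ> w)) L' S' =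
       (if w = w0 then \<beta> * point_amp (V \<circ> origin ?L) (nails rho V ?L) L' S' else 0)" by blast
  have ru: "run rho ?u = Some kap" "ndb ?u = 1"
  proof -
    have "basis_dots b kap (replicate b 0) = []" by (simp add: basis_dots_def)
    then show "run rho ?u = Some kap" "ndb ?u = 1"
      using xel_run[OF wl(2), of l0 "replicate b 0"] by simp_all
  qed
  have ck: "colours rho ?L = kap" using redwD(2)[OF r] ru by simp
  from realizable_span[OF F(1)[unfolded ck ru(2)] refl refl T(1)] obtain e where
    e: "\<And>j. F (vac (T \<circ> fst j)) T (nail_vals T (snd j)) = (\<Sum>k\<in>top_idx. e k * amp_mat T k j)" by blast
  have pL: "origin ?L = inv_into UNIV w0" by (auto simp: origin_def basis_labels_def)
  have VT: "V (origin ?L t) = T t" for t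
    unfolding V_def pL using permutes_inverses(1)[OF wp[OF wl(2)]] by simp
  have Y: "V \<circ> origin ?L = T" using VT by (simp add: fun_eq_iff)
  have col: "rho ! origin ?L t = kap ! t" if "t < length rho" for t using ck that colours_nth by metis
  have Z: "nails rho V ?L = nail_vals T l0"
  proof (intro equalityI subsetI)
    fix x assume "x \<in> nails rho V ?L"
    then obtain t where t0: "x = V (origin ?L t)" "t < length rho" "?L t < 0" "rho ! origin ?L t = Black"
      unfolding nails_def by blast
    have t: "x = T t" "kap ! t = Black" using t0(1) VT t0(4) col[OF t0(2)] by simp_all
    have "negated kap b l0 t" using t0(3) by (simp add: basis_labels_def split: if_splits)
    moreover obtain j where "j < length kap" "kap ! j = Red" using red by blast
    then have "kap ! rpos kap = Red" by (rule rpos_props)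
    with t(2) have "t \<noteq> rpos kap" by auto
    ultimately obtain k where "k < b" "l0 ! k = 1" "t = bpos kap k" unfolding negated_def by blast
    with t(1) show "x \<in> nail_vals T l0" unfolding nail_vals_def by blast
  next
    fix x assume "x \<in> nail_vals T l0"
    then obtain k where k: "x = T (bpos kap k)" "k < b" "l0 ! k = 1" unfolding nail_vals_def by blast
    note bp = bpos_props[of k kap] nb k(2)
    have "negated kap b l0 (bpos kap k)" using k unfolding negated_def by blast
    then have "?L (bpos kap k) < 0" by (simp add: basis_labels_def)
    moreover have "bpos kap k < length rho" "kap ! bpos kap k = Black" using bp len by simp_all
    moreover have "rho ! origin ?L (bpos kap k) = Black" using col calculation(2,3) by simp
    moreover have "x = V (origin ?L (bpos kap k))" unfolding VT by (rule k(1))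
    ultimately show "x \<in> nails rho V ?L" unfolding nails_def by blast
  qed
  have res: "(\<Sum>k\<in>top_idx. e k / \<beta> * amp_mat T k j) = (if i = j then 1 else 0)" if j: "j \<in> top_idx" for j
  proof -
    obtain w l where jj: "j = (w, l)" "w \<in> ?W" "length l = b" "set l \<subseteq> {0, 1}" using j unfolding top_idx_def by blast
    have "(\<Sum>k\<in>top_idx. e k / \<beta> * amp_mat T k j) = (\<Sum>k\<in>top_idx. e k * amp_mat T k j) / \<beta>"
      by (simp add: sum_divide_distrib)
    also have "\<dots> = (if w = w0 then \<beta> * point_amp T (nail_vals T l0) T (nail_vals T l) else 0) / \<beta>"
      using e[of j] F(3)[OF jj(2) T(1) finite_nail_vals[of T l]] unfolding Y Z jj by simp
    also have "\<dots> = (if i = j then 1 else 0)"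
    proof -
      have "nail_vals T l = nail_vals T l0 \<longleftrightarrow> l = l0" using nail_vals_inj[OF T(1) jj(3,4) wl(3,4)] by blast
      then show ?thesis using F(2) unfolding wl(1) jj(1) point_amp_def by simp
    qed
    finally show ?thesis .
  qed
  then show ?thesis by (intro exI[of _ "\<lambda>k. e k / \<beta>"]) blast
qed

text \<open>Invertibility makes each \<open>top_poly\<close> vanish at all admissible values. The
  Kronecker substitution \<open>T p = t ^ (N ^ p)\<close> turns the dot monomials into distinct
  powers of one variable, so their coefficients vanish.\<close>

lemma independent_int:
  assumes c: "finite {i. c i \<noteq> 0}" "{i. c i \<noteq> (0::int)} \<subseteq> Idx b kap rho" and N: "lcomb c basis_path \<in> relN"
  shows "c i = 0"
proof -
  have PP0: "top_poly c T j = 0" if T: "inj T" "\<And>q. T q \<noteq> 0" and j: "j \<in> top_idx" for T j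
  proof -
    have "\<forall>i\<in>top_idx. \<exists>e. \<forall>j\<in>top_idx. (\<Sum>k\<in>top_idx. e k * amp_mat T k j) = (if i = j then 1 else 0)"
      using matrix_unit[OF T] by blast
    then obtain E where E: "\<And>i j. i \<in> top_idx \<Longrightarrow> j \<in> top_idx \<Longrightarrow> (\<Sum>k\<in>top_idx. E i k * amp_mat T k j) = (if i = j then 1 else 0)"
      by metis
    show ?thesis
    proof (rule left_inverse_kernel[OF finite_top_idx E _ j])
      show "(\<Sum>k\<in>top_idx. top_poly c T k * amp_mat T k j) = 0" for j
        using \<Phi>_lcomb[OF c, of T j] \<Phi>_relN[OF T(1) N, of j] by simp
    qed
  qed
  show ?thesis
  proof (rule ccontr)
    assume ci: "c i \<noteq> 0"
    obtain w l a where i: "i = (w, l, a)" by (cases i)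
    define A where "A = {a. c (w, l, a) \<noteq> 0}"
    have fA: "finite A" unfolding A_def
      by (rule finite_subset[OF _ finite_imageI[OF c(1), of "\<lambda>(w, l, a). a"]]) (force simp: image_iff)
    have aA: "a \<in> A" using ci i by (simp add: A_def)
    have lenA: "length a' = b" if "a' \<in> A" for a'
      using c(2) that unfolding A_def Idx_def by auto
    have j: "(w, l) \<in> top_idx" using c(2) ci i unfolding Idx_def top_idx_def by auto
    \<comment> \<open>Larger than every exponent, and at least 2 so that \<open>T\<close> is
      injective even when all exponents are 0. The inserted 0 gives \<open>Max\<close> a nonempty
      set.\<close>
    define N where "N = Suc (Suc (Max (\<Union>a\<in>A. insert 0 (set a))))"
    have N: "a' ! k < N" if "a' \<in> A" "k < b" for a' k
    proof -
      have "a' ! k \<in> set a'" using that lenA[OF that(1)] by simp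
      then have "a' ! k \<le> Max (\<Union>a\<in>A. insert 0 (set a))"
        by (intro Max_ge UN_I[OF that(1)]) (use fA in auto)
      then show ?thesis by (simp add: N_def)
    qed
    define ex where "ex a = (\<Sum>k<b. a ! k * N ^ bpos kap k)" for a :: "nat list"
    have bp: "bpos kap k < length kap" "k' < b \<Longrightarrow> bpos kap k = bpos kap k' \<longleftrightarrow> k = k'" if "k < b" for k k'
      using bpos_props[of k kap] bpos_inj[of k kap k'] nb that by auto
    have inj_ex: "inj_on ex A"
    proof (rule inj_onI)
      fix x y assume xy: "x \<in> A" "y \<in> A" "ex x = ex y"
      \<comment> \<open>Spreads the exponents over all positions, with digit 0 at red ones, so that
        \<open>ex\<close> becomes a base \<open>N\<close> expansion.\<close>
      define d where "d a p = (\<Sum>k<b. if p = bpos kap k then a ! k else 0)" for a :: "nat list" and p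
      have d1: "d a (bpos kap k) = a ! k" if "k < b" for a k
      proof -
        have "d a (bpos kap k) = (\<Sum>k'<b. if k' = k then a ! k' else 0)"
          unfolding d_def by (rule sum.cong) (use bp that in auto)
        then show ?thesis using that by simp
      qed
      have d0: "d a p = 0" if "\<And>k. k < b \<Longrightarrow> p \<noteq> bpos kap k" for a p
        unfolding d_def by (rule sum.neutral) (use that in auto)
      have dN: "d a p < N" if "a \<in> A" for a p
      proof (cases "\<exists>k<b. p = bpos kap k")
        case True then show ?thesis using d1 N[OF that] by auto
      next
        case False then show ?thesis using d0[of p a] by (auto simp: N_def)
      qed
      have exd: "ex a = (\<Sum>p<length kap. d a p * N ^ p)" for a
      proof -
        have "(\<Sum>p<length kap. d a p * N ^ p) = (\<Sum>p<length kap. \<Sum>k<b. if p = bpos kap k then a ! k * N ^ p else 0)"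
          unfolding d_def sum_distrib_right by (intro sum.cong refl) auto
        also have "\<dots> = (\<Sum>k<b. \<Sum>p<length kap. if p = bpos kap k then a ! k * N ^ p else 0)"
          by (rule sum.swap)
        also have "\<dots> = ex a" unfolding ex_def by (rule sum.cong) (use bp in auto)
        finally show ?thesis by simp
      qed
      have "\<forall>p<length kap. d x p = d y p"
        by (rule digits_unique[of _ _ N]) (use dN xy exd in auto)
      then have "x ! k = y ! k" if "k < b" for k using d1[OF that] bp(1)[OF that] by metis
      then show "x = y" using lenA xy by (intro nth_equalityI) auto
    qed
    have "(\<Sum>a\<in>A. of_int (c (w, l, a)) * (of_nat t :: rat) ^ ex a) = 0" if t: "2 \<le> t" for t :: nat
    proof -
      define T where "T p = (of_nat t :: rat) ^ (N ^ p)" for p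
      have "inj T"
      proof (rule injI)
        fix x y assume "T x = T y"
        then have "N ^ x = N ^ y" using t power_inject_exp[of "of_nat t :: rat"] unfolding T_def by simp
        then show "x = y" using power_inject_exp[of N] by (simp add: N_def)
      qed
      moreover have "T p \<noteq> 0" for p using t by (simp add: T_def)
      ultimately have "top_poly c T (w, l) = 0" using PP0 j by blast
      moreover have "dot_weight T a = (of_nat t :: rat) ^ ex a" for a
        unfolding dot_weight_def ex_def T_def power_sum by (simp add: power_mult[symmetric] mult.commute)
      ultimately show ?thesis unfolding top_poly_def A_def by simp
    qed
    from poly_exponents[OF fA inj_ex this aA] show False using ci i by simp
  qed
qed

end

section \<open>From the integers to an arbitrary ground ring\<close>

lemma image_Collect1: "(\<And>j. F (f' j) = f j) \<Longrightarrow> {f j |j. P j} \<subseteq> F ` {f' j |j. P j}"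
  by (auto simp: image_iff) metis

lemma image_Collect2: "(\<And>g h. F (f' g h) = f g h) \<Longrightarrow> {f g h |g h. P g h} \<subseteq> F ` {f' g h |g h. P g h}"
  by (auto simp: image_iff) metis

lemma rels_of_int: "(rels s :: ('k::comm_ring_1 \<times> gen list) list set) \<subseteq> map (map_prod of_int id) ` rels s"
  unfolding rels_def image_Un by (intro Un_mono image_Collect1 image_Collect2) simp_all

text \<open>Homogeneity in the double braidings allows a functional supported on words with exactly
  one of them to respect the relations.\<close>

lemma rels_ndb:
  assumes "(R :: ('k::comm_ring_1 \<times> gen list) list) \<in> rels s"
  shows "\<exists>m. \<forall>(c, g)\<in>set R. ndb g = m"
  using assms unfolding rels_def by (elim UnE CollectE exE conjE) auto

lemma sum_list_neutral: "(\<And>x. x \<in> set xs \<Longrightarrow> f x = 0) \<Longrightarrow> (\<Sum>x\<leftarrow>xs. f x) = (0::'a::comm_monoid_add)"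
  by (induction xs) auto

lemma sum_list_of_int:
  "(\<And>x. x \<in> set xs \<Longrightarrow> f x = of_int (g x)) \<Longrightarrow> (\<Sum>x\<leftarrow>xs. f x) = (of_int (\<Sum>x\<leftarrow>xs. g x) :: 'a::comm_ring_1)"
  by (induction xs) auto

context basis_setting begin

definition valp :: "path \<Rightarrow> bool" where
  "valp p \<longleftrightarrow> fst p = rho \<and> run rho (snd p) = Some kap \<and> ndb (snd p) = 1"

lemma coefficients:
  obtains C :: "path \<Rightarrow> (nat \<Rightarrow> nat) \<times> nat list \<times> nat list \<Rightarrow> int" where
    "\<And>p. valp p \<Longrightarrow> finite {i. C p i \<noteq> 0} \<and> {i. C p i \<noteq> 0} \<subseteq> Idx b kap rho \<and>
       (\<lambda>q. (delta p :: path \<Rightarrow> int) q - lcomb (C p) basis_path q) \<in> relN"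
proof -
  have "\<exists>c. valp p \<longrightarrow> finite {i. c i \<noteq> 0} \<and> {i. c i \<noteq> 0} \<subseteq> Idx b kap rho \<and>
       (\<lambda>q. (delta p :: path \<Rightarrow> int) q - lcomb c basis_path q) \<in> relN" for p
  proof (cases "valp p")
    case True
    then have "p = (rho, snd p)" "run rho (snd p) = Some kap" "ndb (snd p) = 1"
      unfolding valp_def by (simp_all add: prod_eq_iff)
    then have "(delta p :: path \<Rightarrow> int) \<in> spanned (Idx b kap rho) basis_path" using spanning_path by metis
    then show ?thesis unfolding spanned_def by blast
  qed simp
  then obtain C where "\<forall>p. valp p \<longrightarrow> finite {i. C p i \<noteq> 0} \<and> {i. C p i \<noteq> 0} \<subseteq> Idx b kap rho \<and>
       (\<lambda>q. (delta p :: path \<Rightarrow> int) q - lcomb (C p) basis_path q) \<in> relN"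
    using choice[of "\<lambda>p c. valp p \<longrightarrow> finite {i. c i \<noteq> 0} \<and> {i. c i \<noteq> 0} \<subseteq> Idx b kap rho \<and>
       (\<lambda>q. (delta p :: path \<Rightarrow> int) q - lcomb c basis_path q) \<in> relN"] by blast
  then show thesis by (intro that[of C]) blast
qed

text \<open>The functional \<open>\<Psi>\<close> reads the integral coordinate \<open>i\<close> of a
  word and maps it to the ground ring. A relation in its context lifts to an integral one, whose
  coordinates vanish by independence over the integers; so \<open>\<Psi>\<close> kills all
  relations, while on the basis it is a Kronecker delta.\<close>

theorem independent:
  fixes c :: "(nat \<Rightarrow> nat) \<times> nat list \<times> nat list \<Rightarrow> 'k::comm_ring_1"
  assumes c: "finite {i. c i \<noteq> 0}" "{i. c i \<noteq> 0} \<subseteq> Idx b kap rho" and N: "lcomb c basis_path \<in> relN"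
  shows "c i = 0"
proof -
  obtain C :: "path \<Rightarrow> (nat \<Rightarrow> nat) \<times> nat list \<times> nat list \<Rightarrow> int" where
    C: "\<And>p. valp p \<Longrightarrow> finite {i. C p i \<noteq> 0}" "\<And>p. valp p \<Longrightarrow> {i. C p i \<noteq> 0} \<subseteq> Idx b kap rho"
       "\<And>p. valp p \<Longrightarrow> (\<lambda>q. (delta p :: path \<Rightarrow> int) q - lcomb (C p) basis_path q) \<in> relN"
    by (rule coefficients) blast
  have lc: "lcomb (\<lambda>i. a * u i + v i) basis_path = (\<lambda>q. a * lcomb u basis_path q + lcomb v basis_path q) \<and>
      finite {i. a * u i + v i \<noteq> 0} \<and> {i. a * u i + v i \<noteq> 0} \<subseteq> Idx b kap rho"
    if "finite {i. u i \<noteq> 0}" "finite {i. v i \<noteq> 0}" "{i. u i \<noteq> 0} \<subseteq> Idx b kap rho" "{i. v i \<noteq> 0} \<subseteq> Idx b kap rho"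
    for u v :: "(nat \<Rightarrow> nat) \<times> nat list \<times> nat list \<Rightarrow> int" and a
  proof -
    let ?A = "{i. u i \<noteq> 0} \<union> {i. v i \<noteq> 0}"
    have sub: "{i. a * u i + v i \<noteq> 0} \<subseteq> ?A" by auto
    have "lcomb (\<lambda>i. a * u i + v i) basis_path q = a * lcomb u basis_path q + lcomb v basis_path q" for q
      using that(1,2) by (subst (1 2 3) lcomb_sum[of ?A]) (auto simp: sum.distrib sum_distrib_left algebra_simps)
    then show ?thesis using sub that finite_subset[OF sub] by auto
  qed
  have Cx: "C (xel b ch kap rho j) k = (if k = j then 1 else 0)" if j: "j \<in> Idx b kap rho" for j k
  proof -
    obtain w l a where wla: "j = (w, l, a)" "w \<in> Sperm kap rho" using j unfolding Idx_def by auto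
    have v: "valp (xel b ch kap rho j)" unfolding valp_def wla xel_eq using xel_run[OF wla(2)] by simp
    let ?e = "\<lambda>k. if k = j then 1 else (0::int)"
    have e: "lcomb ?e basis_path = basis_path j" by (simp add: fun_eq_iff lcomb_sum[of "{j}"])
    have fe: "finite {k. ?e k \<noteq> 0}" "{k. ?e k \<noteq> 0} \<subseteq> Idx b kap rho" using j by auto
    note L = lc[OF C(1)[OF v] fe(1) C(2)[OF v] fe(2), of "- 1"]
    have "lcomb (\<lambda>k. - 1 * C (xel b ch kap rho j) k + ?e k) basis_path \<in> relN"
      using C(3)[OF v] L e by simp
    from independent_int[OF _ _ this, of k] L show ?thesis by simp
  qed
  define \<Psi> where "\<Psi> p = (if valp p then of_int (C p i) else (0::'k))" for p
  interpret H: ring_hom0 "\<lambda>x. x :: 'k" by (rule ring_hom0_id)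
  have kill: "(\<Sum>(c, g)\<leftarrow>R. c * \<Psi> (s0, lo @ g @ hi)) = 0"
    if R: "(R :: ('k \<times> gen list) list) \<in> rels s" "run s0 lo = Some s" "\<forall>(c, g) \<in> set R. run s g = Some t" "run t hi \<noteq> None"
    for R s s0 lo hi t
  proof -
    obtain R' :: "(int \<times> gen list) list" where R': "R' \<in> rels s" "R = map (map_prod of_int id) R'"
      using R(1) rels_of_int by blast
    have rg: "\<forall>(c, g) \<in> set R'. run s g = Some t" using R(3) unfolding R'(2) by fastforce
    obtain m where m: "\<forall>(c, g)\<in>set R'. ndb g = m" using rels_ndb[OF R'(1)] by blast
    \<comment> \<open>All terms of a relation have the same top state and the same number of double
      braidings, so in a given context either all of them satisfy \<open>valp\<close> or none
      does.\<close>
    define ok where "ok \<longleftrightarrow> s0 = rho \<and> run t hi = Some kap \<and> ndb lo + m + ndb hi = 1"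
    have vp: "valp (s0, lo @ g @ hi) \<longleftrightarrow> ok" if "(c, g) \<in> set R'" for c g
      using that rg m R(2) unfolding valp_def ok_def by (auto simp: run_append)
    have "(\<Sum>(c, g)\<leftarrow>map (map_prod of_int id) Q. c * \<Psi> (s0, lo @ g @ hi)) = (\<Sum>(c, g)\<leftarrow>Q. of_int c * \<Psi> (s0, lo @ g @ hi))"
      for Q by (induction Q) auto
    then have eq: "(\<Sum>(c, g)\<leftarrow>R. c * \<Psi> (s0, lo @ g @ hi)) = (\<Sum>(c, g)\<leftarrow>R'. of_int c * \<Psi> (s0, lo @ g @ hi))"
      unfolding R'(2) .
    show ?thesis
    proof (cases ok)
      case False
      have "(case x of (c, g) \<Rightarrow> of_int c * \<Psi> (s0, lo @ g @ hi)) = 0" if "x \<in> set R'" for x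
      proof -
        obtain c g where x: "x = (c, g)" by force
        have "\<not> valp (s0, lo @ g @ hi)" using vp[of c g] that False unfolding x by blast
        then show ?thesis unfolding x \<Psi>_def by simp
      qed
      then show ?thesis unfolding eq by (rule sum_list_neutral)
    next
      case True
      \<comment> \<open>The coordinates of the relation in its context, summed over its words;
        integral independence will show that they are 0.\<close>
      define d where "d Q k = (\<Sum>(c, g)\<leftarrow>Q. c * C (s0, lo @ g @ hi) k)" for Q k
      have "finite {k. d Q k \<noteq> 0} \<and> {k. d Q k \<noteq> 0} \<subseteq> Idx b kap rho \<and>
         (\<lambda>q. sandwich s0 lo Q hi q - lcomb (d Q) basis_path q) \<in> relN" if "set Q \<subseteq> set R'" for Q
        using that
      proof (induction Q)
        case Nil
        then show ?case by (simp add: d_def lcomb_def sandwich_Nil relN.zero)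
      next
        case (Cons cg Q)
        obtain c g where cg: "cg = (c, g)" by force
        let ?p = "(s0, lo @ g @ hi)"
        have v: "valp ?p" using vp[of c g] Cons(2) True unfolding cg by simp
        have IH: "finite {k. d Q k \<noteq> 0}" "{k. d Q k \<noteq> 0} \<subseteq> Idx b kap rho"
         "(\<lambda>q. sandwich s0 lo Q hi q - lcomb (d Q) basis_path q) \<in> relN" using Cons by auto
        have dC: "d ((c, g) # Q) = (\<lambda>k. c * C ?p k + d Q k)" by (simp add: d_def fun_eq_iff)
        note L = lc[OF C(1)[OF v] IH(1) C(2)[OF v] IH(2), of c]
        have "(\<lambda>q. c * (delta ?p q - lcomb (C ?p) basis_path q) + (sandwich s0 lo Q hi q - lcomb (d Q) basis_path q)) \<in> relN"
          by (rule relN.add[OF relN.smult[OF C(3)[OF v]] IH(3)])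
        moreover have "(\<lambda>q. c * (delta ?p q - lcomb (C ?p) basis_path q) + (sandwich s0 lo Q hi q - lcomb (d Q) basis_path q))
          = (\<lambda>q. sandwich s0 lo (cg # Q) hi q - lcomb (d (cg # Q)) basis_path q)"
          unfolding cg dC conjunct1[OF L] sandwich_Cons by (simp add: algebra_simps)
        ultimately show ?case using L unfolding cg dC by simp
      qed
      from this[of R'] have D: "finite {k. d R' k \<noteq> 0}" "{k. d R' k \<noteq> 0} \<subseteq> Idx b kap rho"
         "(\<lambda>q. sandwich s0 lo R' hi q - lcomb (d R') basis_path q) \<in> relN" by auto
      have "(sandwich s0 lo R' hi :: path \<Rightarrow> int) \<in> relN"
        by (rule relN.gen[OF R'(1) R(2) rg R(4)])
      from relN_diff[OF this D(3)] have "lcomb (d R') basis_path \<in> relN" by simp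
      from independent_int[OF D(1,2) this] have 0: "d R' i = 0" .
      have "(case x of (c, g) \<Rightarrow> of_int c * \<Psi> (s0, lo @ g @ hi)) = of_int (case x of (c, g) \<Rightarrow> c * C (s0, lo @ g @ hi) i)"
        if "x \<in> set R'" for x
      proof -
        obtain c g where x: "x = (c, g)" by force
        have "valp (s0, lo @ g @ hi)" using vp[of c g] that True unfolding x by blast
        then show ?thesis unfolding x \<Psi>_def by simp
      qed
      then have "(\<Sum>(c, g)\<leftarrow>R'. of_int c * \<Psi> (s0, lo @ g @ hi)) = of_int (d R' i)"
        unfolding d_def by (rule sum_list_of_int)
      then show ?thesis unfolding eq 0 by simp
    qed
  qed
  have "finite {p. lcomb c basis_path p \<noteq> (0 :: 'k)} \<and> eval_lin (\<lambda>x. x) \<Psi> (lcomb c basis_path) = 0"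
    by (rule H.eval_lin_relN[OF _ N]) (rule kill)
  then have "eval_lin (\<lambda>x. x) \<Psi> (lcomb c basis_path) = 0" by blast
  moreover have "eval_lin (\<lambda>x. x) \<Psi> (lcomb c basis_path) = (\<Sum>j\<in>{j. c j \<noteq> 0}. c j * \<Psi> (xel b ch kap rho j))"
    using H.eval_lin_lcomb[OF c(1)] by blast
  also have "\<dots> = (\<Sum>j\<in>{j. c j \<noteq> 0}. if j = i then c i else 0)"
  proof (rule sum.cong[OF refl])
    fix j assume "j \<in> {j. c j \<noteq> 0}"
    then have j: "j \<in> Idx b kap rho" using c(2) by blast
    obtain w l a where wla: "j = (w, l, a)" "w \<in> Sperm kap rho" using j unfolding Idx_def by auto
    have v: "valp (xel b ch kap rho j)" unfolding valp_def wla xel_eq using xel_run[OF wla(2)] by simp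
    show "c j * \<Psi> (xel b ch kap rho j) = (if j = i then c i else 0)"
      unfolding \<Psi>_def Cx[OF j] using v by simp
  qed
  also have "\<dots> = c i" using c(1) by simp
  finally show ?thesis by simp
qed

theorem basis:
  "quot_basis (Xsp kap rho :: (path \<Rightarrow> 'k::comm_ring_1) set) relN (Idx b kap rho) basis_path"
  unfolding quot_basis_def
proof (intro conjI ballI allI impI)
  fix i assume "i \<in> Idx b kap rho"
  then obtain w l a where i: "i = (w, l, a)" "w \<in> Sperm kap rho" unfolding Idx_def by auto
  show "(basis_path i :: path \<Rightarrow> 'k) \<in> Xsp kap rho"
    unfolding Xsp_def i(1) xel_eq using xel_run[OF i(2), of l a]
    by (auto simp: delta_def split: if_splits)
next
  fix c :: "(nat \<Rightarrow> nat) \<times> nat list \<times> nat list \<Rightarrow> 'k" and i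
  assume "finite {i. c i \<noteq> 0} \<and> {i. c i \<noteq> 0} \<subseteq> Idx b kap rho \<and> lcomb c basis_path \<in> relN"
  then show "c i = 0" using independent by blast
next
  fix v :: "path \<Rightarrow> 'k" assume v: "v \<in> Xsp kap rho"
  let ?S = "{p. v p \<noteq> 0}"
  have f: "finite ?S" using v unfolding Xsp_def by blast
  have "(\<lambda>p. \<Sum>q\<in>?S. v q * delta q p) \<in> spanned (Idx b kap rho) basis_path"
  proof (rule spanned_sum[OF f])
    fix q assume "q \<in> ?S"
    then have "fst q = rho" "run rho (snd q) = Some kap" "ndb (snd q) = 1" using v unfolding Xsp_def by blast+
    then show "(delta q :: path \<Rightarrow> 'k) \<in> spanned (Idx b kap rho) basis_path"
      using spanning_path[of "snd q"] by (cases q) simp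
  qed
  moreover have "(\<lambda>p. \<Sum>q\<in>?S. v q * delta q p) = v"
  proof
    fix p
    have "(\<Sum>q\<in>?S. v q * delta q p) = (\<Sum>q\<in>?S. if q = p then v p else 0)"
      by (rule sum.cong) (auto simp: delta_def)
    also have "\<dots> = v p" using f by simp
    finally show "(\<Sum>q\<in>?S. v q * delta q p) = v p" .
  qed
  ultimately show "\<exists>c. finite {i. c i \<noteq> 0} \<and> {i. c i \<noteq> 0} \<subseteq> Idx b kap rho \<and> (\<lambda>p. v p - lcomb c basis_path p) \<in> relN"
    unfolding spanned_def by simp
qed

end

section \<open>States that come from compositions\<close>

lemma length_filter_nth: "length (filter (\<lambda>j. P (xs ! j)) [0..<length xs]) = length (filter P xs)"
proof -
  have "filter P xs = filter P (map ((!) xs) [0..<length xs])" by (simp add: map_nth)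
  also have "\<dots> = map ((!) xs) (filter (\<lambda>j. P (xs ! j)) [0..<length xs])" by (simp add: filter_map comp_def)
  finally show ?thesis by simp
qed

lemma cstate_comps:
  assumes "c \<in> comps b r"
  shows "length (cstate c) = b + r" "length (filter (\<lambda>x. x = Black) (cstate c)) = b" "1 \<le> r \<Longrightarrow> Red \<in> set (cstate c)"
proof -
  obtain b0 bs where c: "c = b0 # bs" "length bs = r" "b0 + sum_list bs = b"
    using assms unfolding comps_def by (cases c) auto
  have 1: "length (concat (map (\<lambda>bi. Red # replicate bi Black) bs)) = sum_list bs + length bs" for bs
    by (induction bs) auto
  have 2: "length (filter (\<lambda>x. x = Black) (concat (map (\<lambda>bi. Red # replicate bi Black) bs))) = sum_list bs" for bs
    by (induction bs) (auto simp: filter_replicate)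
  show "length (cstate c) = b + r" using 1[of bs] c by simp
  show "length (filter (\<lambda>x. x = Black) (cstate c)) = b" using 2[of bs] c by simp
  show "Red \<in> set (cstate c)" if "1 \<le> r" using c that by (cases bs) auto
qed

theorem theorem5p5:
  fixes b r :: nat and kap rho :: "nat list" and ch :: "(nat \<Rightarrow> nat) \<Rightarrow> nat list"
  assumes "1 \<le> r"
    and "kap \<in> comps b r" and "rho \<in> comps b r"
    and "\<forall>w \<in> Sperm (cstate kap) (cstate rho). left_adjusted (b + r) w (ch w)"
  shows "quot_basis (Xsp (cstate kap) (cstate rho) :: (path \<Rightarrow> 'k::comm_ring_1) set)
           relN (Idx b (cstate kap) (cstate rho))
           (\<lambda>i. delta (xel b ch (cstate kap) (cstate rho) i))"
proof -
  interpret basis_setting "cstate rho" "cstate kap" b ch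
  proof
    show "length (cstate kap) = length (cstate rho)"
      using cstate_comps(1) assms(2,3) by metis
    show "length (filter (\<lambda>j. cstate kap ! j = Black) [0..<length (cstate kap)]) = b"
      unfolding length_filter_nth[of "\<lambda>x. x = Black"] by (rule cstate_comps(2)[OF assms(2)])
    \<comment> \<open>\<open>1 \<le> r\<close> supplies the red strand that carries the double
      braiding.\<close>
    show "\<exists>j<length (cstate kap). cstate kap ! j = Red"
      using cstate_comps(3)[OF assms(2,1)] by (simp add: in_set_conv_nth)
    show "left_adjusted (length (cstate rho)) w (ch w)" if "w \<in> Sperm (cstate kap) (cstate rho)" for w
      using assms(4) that cstate_comps(1)[OF assms(3)] by simp
  qed
  show ?thesis by (rule basis)
qed

end
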